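(* Let $p\in[1,\infty]$ and $q\in(2,\infty]$. Then there exist $\mathbb{K}\in\{\mathbb{R},\mathbb{C}\}$, Hilbert spaces $V$ and $H$ over $\mathbb{K}$ such that $V$ is continuously and densely embedded in $H$, a number $T>0$, and a coercive, symmetric, non-autonomous form $\mathfrak{a}\colon[0,T]\times V\times V\to\mathbb{K}$ with associated operator function $\mathcal{A}\colon[0,T]\to\mathcal{L}(V,V')$ such that $\mathcal{A}\in\mathring{B}^{\frac12,p}_q(I)$ with $I=[0,T]$, and such that $\mathfrak{a}$ does not satisfy maximal regularity in $H$.
   Context: Let $V,H$ be Hilbert spaces over $\mathbb{K}$ ($\mathbb{R}$ or $\mathbb{C}$) with $V$ continuously and densely embedded in $H$. Let $V'$ denote the dual of $V$ (antidual, i.e. the continuous antilinear functionals, if $\mathbb{K}=\mathbb{C}$). Identify $h\in H$ with the functional $(h\,|\,\cdot)_H\in V'$, so that $V\hookrightarrow H\hookrightarrow V'$. Let $T>0$. A non-autonomous form is a map $\mathfrak{a}\colon[0,T]\times V\times V\to\mathbb{K}$ such that $\mathfrak{a}(t,\cdot,\cdot)$ is sesquilinear for each $t\in[0,T]$, $\mathfrak{a}(\cdot,v,w)$ is measurable for all $v,w\in V$, and there is $M\ge 0$ with $|\mathfrak{a}(t,v,w)|\le M\|v\|_V\|w\|_V$ for all $t\in[0,T]$, $v,w\in V$. It is coercive if there is $\alpha>0$ with $\operatorname{Re}\mathfrak{a}(t,v,v)\ge\alpha\|v\|_V^2$ for all $t\in[0,T]$, $v\in V$. It is symmetric if $\mathfrak{a}(t,v,w)=\overline{\mathfrak{a}(t,w,v)}$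 for all $t\in[0,T]$, $v,w\in V$. The associated operators $\mathcal{A}(t)\in\mathcal{L}(V,V')$ are given by $\mathcal{A}(t)v=\mathfrak{a}(t,v,\cdot)$. Homogeneous Besov regularity: for an interval $I$, $s\in(0,1)$ and $p,q\in[1,\infty]$, one writes $\mathcal{A}\in\mathring{B}^{s,p}_q(I)$ if the semi-norm $$\|\mathcal{A}\|_{\mathring{B}^{s,p}_q(I)}=\biggl(\int_0^\infty\biggl(\frac{1}{h^s}\biggl(\int_{I_h}\|\mathcal{A}(t+h)-\mathcal{A}(t)\|_{\mathcal{L}(V,V')}^p\,\mathrm{d}t\biggr)^{1/p}\biggr)^q\frac{\mathrm{d}h}{h}\biggr)^{1/q}$$ is finite, where $I_h=\{t\in I: t+h\in I\}$. For $p=\infty$ the inner $L^p$-norm is replaced by the essential supremum over $t\in I_h$, and for $q=\infty$ the outer expression is replaced by the essential supremum over $h>0$ of $h^{-s}$ times the inner norm. Let $MR(V,V')=L^2(0,T;V)\cap H^1(0,T;V')$, which embeds continuously in $C([0,T];H)$. By a theorem of Lions, for a coercive non-autonomous form and every $u_0\in H$, $f\in L^2(0,T;V')$ there is a unique $u\in MR(V,V')$ with $u'(t)+\mathcal{A}(t)u(t)=f(t)$ in $V'$ for almost every $t\in[0,T]$ and $u(0)=u_0$. A coercive non-autonomous form $\mathfrak{a}$ satisfies maximal regularity in $H$ if for $u_0=0$ and every $f\in L^2(0,T;H)$ this unique solution $u\in MR(V,V')$ belongs to $H^1(0,T;H)$. *)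

theory Defs
  imports
    "HOL-Analysis.Analysis"
    "HOL-Probability.Essential_Supremum"
    "HOL-Algebra.Module"
begin

section \<open>Normed and Hilbert spaces with explicit carriers\<close>

text \<open>
  Spaces are modules in the sense of HOL-Algebra, so that one can quantify over them.
  The scalar field is a set \<open>K\<close> of complex numbers, either all of them or the real ones.
  The fields \<open>mult\<close> and \<open>one\<close>, which module records inherit from ring records, play no role.
\<close>

definition scalars :: "complex set \<Rightarrow> complex ring" where
  "scalars K = \<lparr>carrier = K, monoid.mult = (*), one = 1, zero = 0, add = (+)\<rparr>"

record 'a normed_module = "(complex, 'a) module" +
  nrm :: "'a \<Rightarrow> real"

record 'a inner_module = "'a normed_module" +
  ip :: "'a \<Rightarrow> 'a \<Rightarrow> complex"

text \<open>Inner products are linear in the first and antilinear in the second argument.\<close>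

locale hilbert_space = Module.module "scalars K" X
  for K :: "complex set" and X :: "'a inner_module" (structure) +
  assumes scalar_field: "K = \<real> \<or> K = UNIV"
    and ip_closed: "\<lbrakk>x \<in> carrier X; y \<in> carrier X\<rbrakk> \<Longrightarrow> ip X x y \<in> K"
    and ip_add: "\<lbrakk>x \<in> carrier X; y \<in> carrier X; z \<in> carrier X\<rbrakk>
      \<Longrightarrow> ip X (x \<oplus> y) z = ip X x z + ip X y z"
    and ip_smult: "\<lbrakk>c \<in> K; x \<in> carrier X; y \<in> carrier X\<rbrakk> \<Longrightarrow> ip X (c \<odot> x) y = c * ip X x y"
    and ip_commute: "\<lbrakk>x \<in> carrier X; y \<in> carrier X\<rbrakk> \<Longrightarrow> ip X y x = cnj (ip X x y)"
    and ip_pos: "\<lbrakk>x \<in> carrier X; x \<noteq> \<zero>\<rbrakk> \<Longrightarrow> 0 < Re (ip X x x)"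
    and nrm_eq: "x \<in> carrier X \<Longrightarrow> nrm X x = sqrt (Re (ip X x x))"
    and complete:
      "\<lbrakk>\<And>n. \<sigma> n \<in> carrier X;
        \<And>e. 0 < e \<Longrightarrow> \<exists>N. \<forall>m\<ge>N. \<forall>n\<ge>N. nrm X (\<sigma> m \<ominus> \<sigma> n) < e\<rbrakk>
      \<Longrightarrow> \<exists>x\<in>carrier X. (\<lambda>n. nrm X (\<sigma> n \<ominus> x)) \<longlonglongrightarrow> 0"

definition densely_embedded :: "complex set \<Rightarrow> 'a inner_module \<Rightarrow> 'a inner_module \<Rightarrow> bool" where
  "densely_embedded K V H \<longleftrightarrow>
     carrier V \<subseteq> carrier H \<and>
     (\<forall>v\<in>carrier V. \<forall>w\<in>carrier V. v \<oplus>\<^bsub>V\<^esub> w = v \<oplus>\<^bsub>H\<^esub> w) \<and>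
     (\<forall>c\<in>K. \<forall>v\<in>carrier V. c \<odot>\<^bsub>V\<^esub> v = c \<odot>\<^bsub>H\<^esub> v) \<and>
     (\<exists>C. \<forall>v\<in>carrier V. nrm H v \<le> C * nrm V v) \<and>
     (\<forall>x\<in>carrier H. \<forall>e>0. \<exists>v\<in>carrier V. nrm H (x \<ominus>\<^bsub>H\<^esub> v) < e)"

text \<open>
  The space \<open>V'\<close> of continuous antilinear functionals (for \<open>K = \<real>\<close> this is the dual).
  Functionals are taken to be \<open>undefined\<close> outside of the carrier of \<open>V\<close>, so that equality in \<open>V'\<close>
  is equality of HOL functions.
\<close>

definition antidual :: "complex set \<Rightarrow> ('a, 'm) normed_module_scheme \<Rightarrow> ('a \<Rightarrow> complex) normed_module"
  where
  "antidual K V =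
    \<lparr>carrier = {\<phi> \<in> carrier V \<rightarrow>\<^sub>E K.
        (\<forall>v\<in>carrier V. \<forall>w\<in>carrier V. \<phi> (v \<oplus>\<^bsub>V\<^esub> w) = \<phi> v + \<phi> w) \<and>
        (\<forall>c\<in>K. \<forall>v\<in>carrier V. \<phi> (c \<odot>\<^bsub>V\<^esub> v) = cnj c * \<phi> v) \<and>
        (\<exists>C. \<forall>v\<in>carrier V. cmod (\<phi> v) \<le> C * nrm V v)},
     monoid.mult = undefined,
     one = undefined,
     zero = (\<lambda>v\<in>carrier V. 0),
     add = (\<lambda>\<phi> \<psi>. \<lambda>v\<in>carrier V. \<phi> v + \<psi> v),
     smult = (\<lambda>c \<phi>. \<lambda>v\<in>carrier V. c * \<phi> v),
     nrm = (\<lambda>\<phi>. SUP v\<in>{v \<in> carrier V. nrm V v \<le> 1}. cmod (\<phi> v))\<rparr>"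

text \<open>The identification of \<open>h \<in> H\<close> with the functional \<open>(h | \<cdot>)\<^sub>H \<in> V'\<close>.\<close>

definition to_antidual :: "'a inner_module \<Rightarrow> 'a inner_module \<Rightarrow> 'a \<Rightarrow> 'a \<Rightarrow> complex" where
  "to_antidual V H h = (\<lambda>v\<in>carrier V. ip H h v)"

definition op_nrm ::
  "('a, 'm) normed_module_scheme \<Rightarrow> ('b, 'n) normed_module_scheme \<Rightarrow> ('a \<Rightarrow> 'b) \<Rightarrow> real" where
  "op_nrm X Y B = (SUP x\<in>{x \<in> carrier X. nrm X x \<le> 1}. nrm Y (B x))"


section \<open>Vector-valued function spaces\<close>

text \<open>
  The library's Bochner integral needs type classes, so the following repeats its definition
  (approximation by simple functions) relative to a carrier.
\<close>

definition strongly_measurable ::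
  "'t measure \<Rightarrow> ('a, 'm) normed_module_scheme \<Rightarrow> ('t \<Rightarrow> 'a) \<Rightarrow> bool" where
  "strongly_measurable M X u \<longleftrightarrow>
     u \<in> space M \<rightarrow> carrier X \<and>
     (\<exists>s. (\<forall>i. simple_function M (s i) \<and> s i \<in> space M \<rightarrow> carrier X) \<and>
          (AE t in M. (\<lambda>i. nrm X (u t \<ominus>\<^bsub>X\<^esub> s i t)) \<longlonglongrightarrow> 0))"

definition simple_integral_in ::
  "'t measure \<Rightarrow> ('a, 'm) normed_module_scheme \<Rightarrow> ('t \<Rightarrow> 'a) \<Rightarrow> 'a" where
  "simple_integral_in M X s =
     finsum X (\<lambda>y. complex_of_real (measure M {t \<in> space M. s t = y}) \<odot>\<^bsub>X\<^esub> y) (s ` space M)"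

text \<open>
  Only used for finite measures, where every simple function is integrable.
\<close>

definition has_integral_in ::
  "'t measure \<Rightarrow> ('a, 'm) normed_module_scheme \<Rightarrow> ('t \<Rightarrow> 'a) \<Rightarrow> 'a \<Rightarrow> bool" where
  "has_integral_in M X u x \<longleftrightarrow>
     strongly_measurable M X u \<and> x \<in> carrier X \<and>
     (\<exists>s. (\<forall>i. simple_function M (s i) \<and> s i \<in> space M \<rightarrow> carrier X) \<and>
          (\<lambda>i. \<integral>\<^sup>+ t. ennreal (nrm X (u t \<ominus>\<^bsub>X\<^esub> s i t)) \<partial>M) \<longlonglongrightarrow> 0 \<and>
          (\<lambda>i. nrm X (simple_integral_in M X (s i) \<ominus>\<^bsub>X\<^esub> x)) \<longlonglongrightarrow> 0)"

text \<open>
  Elements of \<open>L2 T X\<close> are representatives, and their values outside of \<open>[0,T]\<close> are irrelevant.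
\<close>

definition L2 :: "real \<Rightarrow> ('a, 'm) normed_module_scheme \<Rightarrow> (real \<Rightarrow> 'a) set" where
  "L2 T X = {u. strongly_measurable (lebesgue_on {0..T}) X u \<and>
     (\<integral>\<^sup>+ t. ennreal ((nrm X (u t))\<^sup>2) \<partial>lebesgue_on {0..T}) < \<infinity>}"

text \<open>The test functions are the real-valued functions in \<open>C\<^sub>c\<^sup>1(0,T)\<close>.\<close>

definition test_functions :: "real \<Rightarrow> (real \<Rightarrow> real) set" where
  "test_functions T = {\<phi>. \<phi> differentiable_on UNIV \<and> continuous_on UNIV (deriv \<phi>) \<and>
     (\<exists>a b. 0 < a \<and> b < T \<and> (\<forall>t. t \<notin> {a..b} \<longrightarrow> \<phi> t = 0))}"

definition has_weak_derivative ::
  "real \<Rightarrow> ('a, 'm) normed_module_scheme \<Rightarrow> (real \<Rightarrow> 'a) \<Rightarrow> (real \<Rightarrow> 'a) \<Rightarrow> bool" where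
  "has_weak_derivative T X u w \<longleftrightarrow>
     (\<forall>\<phi>\<in>test_functions T. \<exists>x\<in>carrier X.
        has_integral_in (lebesgue_on {0..T}) X (\<lambda>t. complex_of_real (deriv \<phi> t) \<odot>\<^bsub>X\<^esub> u t) x \<and>
        has_integral_in (lebesgue_on {0..T}) X (\<lambda>t. complex_of_real (\<phi> t) \<odot>\<^bsub>X\<^esub> w t) (\<ominus>\<^bsub>X\<^esub> x))"

definition H1 :: "real \<Rightarrow> ('a, 'm) normed_module_scheme \<Rightarrow> (real \<Rightarrow> 'a) set" where
  "H1 T X = {u \<in> L2 T X. \<exists>w\<in>L2 T X. has_weak_derivative T X u w}"

definition MR ::
  "complex set \<Rightarrow> 'a inner_module \<Rightarrow> 'a inner_module \<Rightarrow> real \<Rightarrow> (real \<Rightarrow> 'a) set" where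
  "MR K V H T = {u \<in> L2 T V. (\<lambda>t. to_antidual V H (u t)) \<in> H1 T (antidual K V)}"

text \<open>The value at time \<open>0\<close> is that of the representative in \<open>C([0,T];H)\<close>.\<close>

definition has_initial_value :: "'a inner_module \<Rightarrow> real \<Rightarrow> (real \<Rightarrow> 'a) \<Rightarrow> 'a \<Rightarrow> bool" where
  "has_initial_value H T u u0 \<longleftrightarrow>
     (\<exists>g. g \<in> {0..T} \<rightarrow> carrier H \<and>
          (\<forall>t\<in>{0..T}. ((\<lambda>r. nrm H (g r \<ominus>\<^bsub>H\<^esub> g t)) \<longlongrightarrow> 0) (at t within {0..T})) \<and>
          (AE t in lebesgue_on {0..T}. g t = u t) \<and>
          g 0 = u0)"


section \<open>Homogeneous Besov regularity\<close>

text \<open>For exponents \<open>r > 0\<close>.\<close>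

definition ennreal_powr :: "ennreal \<Rightarrow> real \<Rightarrow> ennreal" where
  "ennreal_powr x r = (if x = \<infinity> then \<infinity> else ennreal (enn2real x powr r))"

text \<open>
  The \<open>L\<^sup>p\<close> norm of a nonnegative function. As for \<^const>\<open>esssup\<close>, it is \<open>\<infinity>\<close> for a
  non-measurable function.
\<close>

definition Lp_norm :: "'t measure \<Rightarrow> ennreal \<Rightarrow> ('t \<Rightarrow> ennreal) \<Rightarrow> ennreal" where
  "Lp_norm M p f =
     (if p = \<infinity> then esssup M f
      else if f \<in> borel_measurable M
        then ennreal_powr (\<integral>\<^sup>+ t. ennreal_powr (f t) (enn2real p) \<partial>M) (1 / enn2real p)
      else \<infinity>)"

definition besov_seminorm ::
  "real set \<Rightarrow> ('a, 'm) normed_module_scheme \<Rightarrow> ('b, 'n) normed_module_scheme \<Rightarrow>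
   real \<Rightarrow> ennreal \<Rightarrow> ennreal \<Rightarrow> (real \<Rightarrow> 'a \<Rightarrow> 'b) \<Rightarrow> ennreal" where
  "besov_seminorm I X Y s p q A =
     Lp_norm (density (lebesgue_on {0<..}) (\<lambda>h. ennreal (1 / h))) q
       (\<lambda>h. ennreal (1 / h powr s) *
            Lp_norm (lebesgue_on {t \<in> I. t + h \<in> I}) p
              (\<lambda>t. ennreal (op_nrm X Y (\<lambda>v. A (t + h) v \<ominus>\<^bsub>Y\<^esub> A t v))))"

definition besov_regular ::
  "real set \<Rightarrow> ('a, 'm) normed_module_scheme \<Rightarrow> ('b, 'n) normed_module_scheme \<Rightarrow>
   real \<Rightarrow> ennreal \<Rightarrow> ennreal \<Rightarrow> (real \<Rightarrow> 'a \<Rightarrow> 'b) \<Rightarrow> bool" where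
  "besov_regular I X Y s p q A \<longleftrightarrow> besov_seminorm I X Y s p q A < \<infinity>"


section \<open>Non-autonomous forms and maximal regularity\<close>

definition sesquilinear_form ::
  "complex set \<Rightarrow> 'a inner_module \<Rightarrow> ('a \<Rightarrow> 'a \<Rightarrow> complex) \<Rightarrow> bool" where
  "sesquilinear_form K V b \<longleftrightarrow>
     (\<forall>v\<in>carrier V. \<forall>w\<in>carrier V. b v w \<in> K) \<and>
     (\<forall>u\<in>carrier V. \<forall>v\<in>carrier V. \<forall>w\<in>carrier V.
        b (u \<oplus>\<^bsub>V\<^esub> v) w = b u w + b v w \<and> b w (u \<oplus>\<^bsub>V\<^esub> v) = b w u + b w v) \<and>
     (\<forall>c\<in>K. \<forall>v\<in>carrier V. \<forall>w\<in>carrier V.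
        b (c \<odot>\<^bsub>V\<^esub> v) w = c * b v w \<and> b v (c \<odot>\<^bsub>V\<^esub> w) = cnj c * b v w)"

definition nonautonomous_form ::
  "complex set \<Rightarrow> 'a inner_module \<Rightarrow> real \<Rightarrow> (real \<Rightarrow> 'a \<Rightarrow> 'a \<Rightarrow> complex) \<Rightarrow> bool" where
  "nonautonomous_form K V T a \<longleftrightarrow>
     (\<forall>t\<in>{0..T}. sesquilinear_form K V (a t)) \<and>
     (\<forall>v\<in>carrier V. \<forall>w\<in>carrier V. (\<lambda>t. a t v w) \<in> borel_measurable (lebesgue_on {0..T})) \<and>
     (\<exists>M\<ge>0. \<forall>t\<in>{0..T}. \<forall>v\<in>carrier V. \<forall>w\<in>carrier V. cmod (a t v w) \<le> M * nrm V v * nrm V w)"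

definition coercive_form ::
  "'a inner_module \<Rightarrow> real \<Rightarrow> (real \<Rightarrow> 'a \<Rightarrow> 'a \<Rightarrow> complex) \<Rightarrow> bool" where
  "coercive_form V T a \<longleftrightarrow>
     (\<exists>\<alpha>>0. \<forall>t\<in>{0..T}. \<forall>v\<in>carrier V. Re (a t v v) \<ge> \<alpha> * (nrm V v)\<^sup>2)"

definition symmetric_form ::
  "'a inner_module \<Rightarrow> real \<Rightarrow> (real \<Rightarrow> 'a \<Rightarrow> 'a \<Rightarrow> complex) \<Rightarrow> bool" where
  "symmetric_form V T a \<longleftrightarrow>
     (\<forall>t\<in>{0..T}. \<forall>v\<in>carrier V. \<forall>w\<in>carrier V. a t v w = cnj (a t w v))"

definition associated_operator ::
  "'a inner_module \<Rightarrow> (real \<Rightarrow> 'a \<Rightarrow> 'a \<Rightarrow> complex) \<Rightarrow> real \<Rightarrow> 'a \<Rightarrow> ('a \<Rightarrow> complex)" where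
  "associated_operator V a t v = (\<lambda>w\<in>carrier V. a t v w)"

text \<open>Here the right-hand side \<open>f\<close> takes values in \<open>V'\<close>.\<close>

definition solves ::
  "complex set \<Rightarrow> 'a inner_module \<Rightarrow> 'a inner_module \<Rightarrow> real \<Rightarrow> (real \<Rightarrow> 'a \<Rightarrow> 'a \<Rightarrow> complex) \<Rightarrow>
   (real \<Rightarrow> 'a \<Rightarrow> complex) \<Rightarrow> 'a \<Rightarrow> (real \<Rightarrow> 'a) \<Rightarrow> bool" where
  "solves K V H T a f u0 u \<longleftrightarrow>
     u \<in> MR K V H T \<and>
     (\<exists>w\<in>L2 T (antidual K V).
        has_weak_derivative T (antidual K V) (\<lambda>t. to_antidual V H (u t)) w \<and>
        (AE t in lebesgue_on {0..T}. w t \<oplus>\<^bsub>antidual K V\<^esub> associated_operator V a t (u t) = f t)) \<and>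
     has_initial_value H T u u0"

text \<open>
  By the theorem of Lions the solution \<open>u\<close> exists and is unique up to null sets; hence the
  universal quantifier over \<open>u\<close>.
\<close>

definition maximal_regularity ::
  "complex set \<Rightarrow> 'a inner_module \<Rightarrow> 'a inner_module \<Rightarrow> real \<Rightarrow> (real \<Rightarrow> 'a \<Rightarrow> 'a \<Rightarrow> complex) \<Rightarrow> bool"
  where
  "maximal_regularity K V H T a \<longleftrightarrow>
     (\<forall>f\<in>L2 T H. \<forall>u. solves K V H T a (\<lambda>t. to_antidual V H (f t)) \<zero>\<^bsub>H\<^esub> u \<longrightarrow> u \<in> H1 T H)"

end

theory Submission
  imports Defs
begin

text \<open>
  The space \<open>H\<close> consists of the square summable sequences and \<open>V\<close> of those that are square summable
  with the weights \<open>freq k = 4 ^ k\<close>, both over the complex numbers; time runs in \<open>[0,1]\<close>.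

  The idea is to prescribe a solution that is too rough for maximal regularity and to choose the form
  such that the equation holds with a harmless right-hand side. Let \<open>osc t\<close> be the sequence with
  coordinates \<open>amp k * exp (\<i> * freq k * t)\<close>. For \<open>u t = t * (unit0 + osc t)\<close>, where \<open>unit0\<close> is the
  unit vector of coordinate \<open>0\<close>, the derivative of \<open>u\<close> and the inner product of \<open>V\<close> applied to \<open>u\<close>
  both contain a multiple of \<open>t * (osc t | z)\<close> with the inner product of \<open>V\<close>, because frequencies and
  weights coincide. This functional of \<open>z\<close> is not bounded in \<open>H\<close>. The form is the inner product of
  \<open>V\<close> plus the coupling \<open>gam * v 0 * (osc t | z)\<close> and its adjoint. As coordinate \<open>0\<close> of \<open>u t\<close> is \<open>t\<close>,
  the coupling cancels the bad terms if \<open>gam = - (1 + \<i>)\<close>, and the adjoint, which is there for symmetry,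
  only adds a multiple of \<open>unit0\<close>. So \<open>u\<close> solves the equation with a right-hand side that is
  continuous with values in \<open>H\<close> (\<open>sol_equation\<close>, \<open>solves_sol\<close>).

  Everything depends on the choice \<open>freq k * amp k = 1 / (8 * sqrt k)\<close>. A derivative of \<open>u\<close> with values
  in \<open>H\<close> would have coordinates of this order, whose squares form the harmonic series; hence \<open>u\<close> is
  not in \<open>H\<^sup>1(0,1;H)\<close> (\<open>sol_not_H1\<close>).

  On the other hand, the operators inherit the regularity of the oscillation: the norm of
  \<open>A (t + h) - A t\<close> is \<open>sqrt 2\<close> times the distance of \<open>osc (t + h)\<close> and \<open>osc t\<close> in \<open>V\<close>
  (\<open>op_nrm_difference\<close>). This distance does not depend on \<open>t\<close>, which settles all \<open>p\<close> at once. Since the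
  frequencies are lacunary, essentially only the frequency near \<open>1 / h\<close> contributes at scale \<open>h\<close>, and the distance
  is at most a constant times \<open>sqrt (h / (n + 1))\<close> for \<open>h\<close> of about \<open>4 ^ (-n)\<close> (\<open>modulus_le\<close>). After
  division by \<open>sqrt h\<close> the \<open>q\<close>-th power is integrable with respect to \<open>dh / h\<close> because
  \<open>(n + 1) powr (- q / 2)\<close> is summable for \<open>q > 2\<close> (\<open>besov_regular_form\<close>). The same example serves all
  \<open>p\<close> and \<open>q\<close>.

  The vector-valued notions reduce to scalar ones. Every functional that is integrated is represented
  by a vector of \<open>V\<close> through the inner product and depends on time uniformly continuously, so its integral is approximated by step functions and can be evaluated pointwise
  (\<open>has_integral_riesz\<close>). In the opposite direction, a weak derivative with values in \<open>H\<close> is a weak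
  derivative of each coordinate (\<open>weak_derivative_coordinate\<close>).
\<close>

section \<open>Weighted sequence spaces\<close>

definition square_summable :: "(nat \<Rightarrow> real) \<Rightarrow> (nat \<Rightarrow> complex) \<Rightarrow> bool" where
  "square_summable w x \<longleftrightarrow> summable (\<lambda>k. w k * (cmod (x k))\<^sup>2)"

definition wip :: "(nat \<Rightarrow> real) \<Rightarrow> (nat \<Rightarrow> complex) \<Rightarrow> (nat \<Rightarrow> complex) \<Rightarrow> complex" where
  "wip w x y = (\<Sum>k. complex_of_real (w k) * x k * cnj (y k))"

definition wnorm :: "(nat \<Rightarrow> real) \<Rightarrow> (nat \<Rightarrow> complex) \<Rightarrow> real" where
  "wnorm w x = sqrt (\<Sum>k. w k * (cmod (x k))\<^sup>2)"

definition wl2 :: "(nat \<Rightarrow> real) \<Rightarrow> (nat \<Rightarrow> complex) inner_module" where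
  "wl2 w = \<lparr>carrier = Collect (square_summable w), monoid.mult = undefined, one = undefined,
     zero = (\<lambda>k. 0), add = (\<lambda>x y k. x k + y k), smult = (\<lambda>c x k. c * x k),
     nrm = wnorm w, ip = wip w\<rparr>"

lemma wl2_simps [simp]:
  "x \<in> carrier (wl2 w) \<longleftrightarrow> square_summable w x"
  "\<zero>\<^bsub>wl2 w\<^esub> = (\<lambda>k. 0)"
  "x \<oplus>\<^bsub>wl2 w\<^esub> y = (\<lambda>k. x k + y k)"
  "c \<odot>\<^bsub>wl2 w\<^esub> x = (\<lambda>k. c * x k)"
  "nrm (wl2 w) = wnorm w"
  "ip (wl2 w) = wip w"
  by (simp_all add: wl2_def)

locale weight =
  fixes w :: "nat \<Rightarrow> real"
  assumes weight_pos: "0 < w k"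
begin

lemma weight_nonneg [simp]: "0 \<le> w k"
  using weight_pos[of k] by simp

lemma square_summable_zero [simp]: "square_summable w (\<lambda>k. 0)"
  by (simp add: square_summable_def)

lemma square_summable_add [simp]:
  assumes "square_summable w x" "square_summable w y"
  shows "square_summable w (\<lambda>k. x k + y k)"
  unfolding square_summable_def
proof (rule summable_comparison_test')
  show "summable (\<lambda>k. 2 * (w k * (cmod (x k))\<^sup>2) + 2 * (w k * (cmod (y k))\<^sup>2))"
    using assms unfolding square_summable_def by (intro summable_add summable_mult)
next
  fix k :: nat
  have "(cmod (x k + y k))\<^sup>2 \<le> (cmod (x k) + cmod (y k))\<^sup>2"
    by (intro power_mono norm_triangle_ineq) auto
  also have "\<dots> \<le> 2 * (cmod (x k))\<^sup>2 + 2 * (cmod (y k))\<^sup>2"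
    using sum_squares_bound[of "cmod (x k)" "cmod (y k)"] by (simp add: power2_sum)
  finally have "w k * (cmod (x k + y k))\<^sup>2 \<le> w k * (2 * (cmod (x k))\<^sup>2 + 2 * (cmod (y k))\<^sup>2)"
    by (rule mult_left_mono) simp
  then show "norm (w k * (cmod (x k + y k))\<^sup>2)
      \<le> 2 * (w k * (cmod (x k))\<^sup>2) + 2 * (w k * (cmod (y k))\<^sup>2)"
    by (simp add: algebra_simps)
qed

lemma square_summable_scale [simp]:
  assumes "square_summable w x"
  shows "square_summable w (\<lambda>k. c * x k)"
  using summable_mult[of _ "(cmod c)\<^sup>2", OF assms[unfolded square_summable_def]]
  by (simp add: square_summable_def norm_mult power_mult_distrib mult.left_commute)

lemma square_summable_diff [simp]:
  "square_summable w x \<Longrightarrow> square_summable w y \<Longrightarrow> square_summable w (\<lambda>k. x k - y k)"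
  using square_summable_add[of x "\<lambda>k. -1 * y k"] square_summable_scale[of y "-1"] by simp

lemma wnorm_nonneg [simp]: "square_summable w x \<Longrightarrow> 0 \<le> wnorm w x"
  by (auto simp: wnorm_def square_summable_def intro!: suminf_nonneg)

lemma wnorm_power2:
  assumes "square_summable w x"
  shows "(wnorm w x)\<^sup>2 = (\<Sum>k. w k * (cmod (x k))\<^sup>2)"
  using assms by (simp add: wnorm_def square_summable_def suminf_nonneg)

lemma sum_le_wnorm:
  assumes "square_summable w x" "finite A"
  shows "(\<Sum>k\<in>A. w k * (cmod (x k))\<^sup>2) \<le> (wnorm w x)\<^sup>2"
  unfolding wnorm_power2[OF assms(1)]
  using assms by (intro sum_le_suminf) (auto simp: square_summable_def)

lemma coordinate_le_wnorm:
  assumes "square_summable w x"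
  shows "sqrt (w k) * cmod (x k) \<le> wnorm w x"
proof (rule power2_le_imp_le)
  show "(sqrt (w k) * cmod (x k))\<^sup>2 \<le> (wnorm w x)\<^sup>2"
    using sum_le_wnorm[OF assms, of "{k}"] by (simp add: power_mult_distrib)
qed (simp add: assms)

lemma wip_partial_sum_le:
  assumes "square_summable w x" "square_summable w y"
  shows "(\<Sum>k<n. cmod (complex_of_real (w k) * x k * cnj (y k))) \<le> wnorm w x * wnorm w y"
proof -
  have L2: "L2_set (\<lambda>k. sqrt (w k) * cmod (z k)) {..<n} \<le> wnorm w z" if "square_summable w z" for z
    using sum_le_wnorm[OF that, of "{..<n}"] wnorm_nonneg[OF that]
    by (auto simp: L2_set_def power_mult_distrib intro!: real_le_lsqrt)
  have "(\<Sum>k<n. cmod (complex_of_real (w k) * x k * cnj (y k)))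
      = (\<Sum>k<n. \<bar>sqrt (w k) * cmod (x k)\<bar> * \<bar>sqrt (w k) * cmod (y k)\<bar>)"
    by (intro sum.cong) (auto simp: norm_mult abs_mult mult.left_commute mult.assoc)
  also have "\<dots> \<le> L2_set (\<lambda>k. sqrt (w k) * cmod (x k)) {..<n}
      * L2_set (\<lambda>k. sqrt (w k) * cmod (y k)) {..<n}"
    by (rule L2_set_mult_ineq)
  also have "\<dots> \<le> wnorm w x * wnorm w y"
    using assms by (intro mult_mono L2) auto
  finally show ?thesis .
qed

lemma summable_wip_norm:
  assumes "square_summable w x" "square_summable w y"
  shows "summable (\<lambda>k. cmod (complex_of_real (w k) * x k * cnj (y k)))"
  by (rule bounded_imp_summable[OF _ wip_partial_sum_le[OF assms, of "Suc n" for n, unfolded lessThan_Suc_atMost]])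
    auto

lemma summable_wip:
  assumes "square_summable w x" "square_summable w y"
  shows "summable (\<lambda>k. complex_of_real (w k) * x k * cnj (y k))"
  using summable_wip_norm[OF assms] by (rule summable_norm_cancel)

text \<open>
  The library's finite Cauchy-Schwarz inequality bounds all partial sums (\<open>wip_partial_sum_le\<close>);
  the series inherits the bound.
\<close>

lemma cauchy_schwarz:
  assumes "square_summable w x" "square_summable w y"
  shows "cmod (wip w x y) \<le> wnorm w x * wnorm w y"
proof -
  have "cmod (wip w x y) \<le> (\<Sum>k. cmod (complex_of_real (w k) * x k * cnj (y k)))"
    unfolding wip_def by (rule summable_norm[OF summable_wip_norm[OF assms]])
  also have "\<dots> \<le> wnorm w x * wnorm w y"
    by (rule suminf_le_const[OF summable_wip_norm[OF assms] wip_partial_sum_le[OF assms]])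
  finally show ?thesis .
qed

lemma wip_add_left:
  assumes "square_summable w x" "square_summable w y" "square_summable w z"
  shows "wip w (\<lambda>k. x k + y k) z = wip w x z + wip w y z"
  using suminf_add[OF summable_wip[OF assms(1,3)] summable_wip[OF assms(2,3)]]
  by (simp add: wip_def algebra_simps)

lemma wip_scale_left:
  assumes "square_summable w x" "square_summable w z"
  shows "wip w (\<lambda>k. c * x k) z = c * wip w x z"
  unfolding wip_def using suminf_mult[OF summable_wip[OF assms], of c] by (simp add: ac_simps)

lemma wip_commute:
  assumes "square_summable w x" "square_summable w y"
  shows "wip w y x = cnj (wip w x y)"
proof -
  have "(\<lambda>k. cnj (complex_of_real (w k) * x k * cnj (y k))) sums cnj (wip w x y)"
    unfolding wip_def using summable_sums[OF summable_wip[OF assms]] by (simp only: sums_cnj)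
  then show ?thesis
    by (simp add: wip_def sums_iff ac_simps)
qed

lemma wip_add_right:
  assumes "square_summable w x" "square_summable w y" "square_summable w z"
  shows "wip w z (\<lambda>k. x k + y k) = wip w z x + wip w z y"
  using assms wip_add_left[OF assms] by (metis wip_commute square_summable_add complex_cnj_add)

lemma wip_scale_right:
  assumes "square_summable w x" "square_summable w z"
  shows "wip w z (\<lambda>k. c * x k) = cnj c * wip w z x"
  using assms wip_scale_left[OF assms] by (metis wip_commute square_summable_scale complex_cnj_mult)

lemma wip_diff_left:
  assumes "square_summable w x" "square_summable w y" "square_summable w z"
  shows "wip w (\<lambda>k. x k - y k) z = wip w x z - wip w y z"
  using wip_add_left[OF assms(1) square_summable_scale[OF assms(2), of "-1"] assms(3)]
    wip_scale_left[OF assms(2,3), of "-1"] by simp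

lemma wip_self:
  assumes "square_summable w x"
  shows "wip w x x = complex_of_real ((wnorm w x)\<^sup>2)"
proof -
  have "(\<lambda>k. complex_of_real (w k * (cmod (x k))\<^sup>2)) sums complex_of_real (\<Sum>k. w k * (cmod (x k))\<^sup>2)"
    using assms unfolding square_summable_def by (intro sums_of_real summable_sums)
  then have "(\<lambda>k. complex_of_real (w k) * x k * cnj (x k)) sums complex_of_real (\<Sum>k. w k * (cmod (x k))\<^sup>2)"
    unfolding of_real_mult complex_norm_square mult.assoc .
  then show ?thesis
    unfolding wip_def wnorm_power2[OF assms] by (rule sums_unique[symmetric])
qed

lemma wnorm_scale:
  assumes "square_summable w x"
  shows "wnorm w (\<lambda>k. c * x k) = cmod c * wnorm w x"
  using suminf_mult[OF assms[unfolded square_summable_def], of "(cmod c)\<^sup>2"]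
  by (simp add: wnorm_def norm_mult power_mult_distrib mult.left_commute real_sqrt_mult)

lemma wnorm_triangle:
  assumes "square_summable w x" "square_summable w y"
  shows "wnorm w (\<lambda>k. x k + y k) \<le> wnorm w x + wnorm w y"
proof (rule power2_le_imp_le)
  have "complex_of_real ((wnorm w (\<lambda>k. x k + y k))\<^sup>2) = wip w x x + wip w y y + (wip w x y + cnj (wip w x y))"
    unfolding wip_self[OF square_summable_add[OF assms], symmetric]
    using assms by (simp add: square_summable_add wip_add_left wip_add_right wip_commute[of x y])
  also have "\<dots> = complex_of_real ((wnorm w x)\<^sup>2 + (wnorm w y)\<^sup>2 + 2 * Re (wip w x y))"
    using assms by (simp add: wip_self complex_add_cnj)
  finally have "(wnorm w (\<lambda>k. x k + y k))\<^sup>2 = (wnorm w x)\<^sup>2 + (wnorm w y)\<^sup>2 + 2 * Re (wip w x y)"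
    using of_real_eq_iff by blast
  moreover have "Re (wip w x y) \<le> wnorm w x * wnorm w y"
    using cauchy_schwarz[OF assms] complex_Re_le_cmod[of "wip w x y"] by linarith
  ultimately show "(wnorm w (\<lambda>k. x k + y k))\<^sup>2 \<le> (wnorm w x + wnorm w y)\<^sup>2"
    by (simp add: power2_sum)
qed (simp add: assms)

lemma abelian_group_wl2: "abelian_group (wl2 w)"
proof (rule abelian_groupI)
  fix x assume "x \<in> carrier (wl2 w)"
  then show "\<exists>y\<in>carrier (wl2 w). y \<oplus>\<^bsub>wl2 w\<^esub> x = \<zero>\<^bsub>wl2 w\<^esub>"
    using square_summable_scale[of x "-1"] by (intro bexI[of _ "\<lambda>k. -1 * x k"]) auto
qed (auto simp: algebra_simps)

lemma a_inv_wl2: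
  assumes "square_summable w x"
  shows "\<ominus>\<^bsub>wl2 w\<^esub> x = (\<lambda>k. - x k)"
proof -
  interpret abelian_group "wl2 w" by (rule abelian_group_wl2)
  show ?thesis
    using assms square_summable_scale[of x "-1"]
    by (intro minus_equality) auto
qed

lemma a_minus_wl2:
  assumes "square_summable w y"
  shows "x \<ominus>\<^bsub>wl2 w\<^esub> y = (\<lambda>k. x k - y k)"
  by (simp add: a_minus_def a_inv_wl2[OF assms])

lemma complete_wl2:
  assumes mem: "\<And>n. square_summable w (\<sigma> n)"
    and cauchy: "\<And>e. 0 < e \<Longrightarrow> \<exists>N. \<forall>m\<ge>N. \<forall>n\<ge>N. wnorm w (\<lambda>k. \<sigma> m k - \<sigma> n k) < e"
  shows "\<exists>x. square_summable w x \<and> (\<lambda>n. wnorm w (\<lambda>k. \<sigma> n k - x k)) \<longlonglongrightarrow> 0"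
proof -
  have "Cauchy (\<lambda>n. \<sigma> n k)" for k
  proof (rule metric_CauchyI)
    fix e :: real assume "0 < e"
    then have "0 < sqrt (w k) * e" using weight_pos[of k] by simp
    from cauchy[OF this] obtain N where
      N: "\<And>m n. m \<ge> N \<Longrightarrow> n \<ge> N \<Longrightarrow> wnorm w (\<lambda>k. \<sigma> m k - \<sigma> n k) < sqrt (w k) * e" by blast
    have "dist (\<sigma> m k) (\<sigma> n k) < e" if "m \<ge> N" "n \<ge> N" for m n
    proof -
      have "sqrt (w k) * cmod (\<sigma> m k - \<sigma> n k) < sqrt (w k) * e"
        using coordinate_le_wnorm[OF square_summable_diff[OF mem mem]] N[OF that] by (rule le_less_trans)
      then show ?thesis using weight_pos[of k] by (simp add: dist_norm)
    qed
    then show "\<exists>M. \<forall>m\<ge>M. \<forall>n\<ge>M. dist (\<sigma> m k) (\<sigma> n k) < e" by blast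
  qed
  then have "\<exists>l. (\<lambda>n. \<sigma> n k) \<longlonglongrightarrow> l" for k
    using Cauchy_convergent convergent_def by blast
  then obtain x where x: "\<And>k. (\<lambda>n. \<sigma> n k) \<longlonglongrightarrow> x k" by metis
  \<comment> \<open>The Cauchy condition passes to the limit in every finite partial sum of the norm.\<close>
  have tail: "\<exists>N. \<forall>m\<ge>N. square_summable w (\<lambda>k. \<sigma> m k - x k) \<and> wnorm w (\<lambda>k. \<sigma> m k - x k) \<le> e"
    if "0 < e" for e
  proof -
    from cauchy[OF that] obtain N where
      N: "\<And>m n. m \<ge> N \<Longrightarrow> n \<ge> N \<Longrightarrow> wnorm w (\<lambda>k. \<sigma> m k - \<sigma> n k) < e" by blast
    have "square_summable w (\<lambda>k. \<sigma> m k - x k) \<and> wnorm w (\<lambda>k. \<sigma> m k - x k) \<le> e" if "m \<ge> N" for m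
    proof -
      have part: "(\<Sum>k<j. w k * (cmod (\<sigma> m k - x k))\<^sup>2) \<le> e\<^sup>2" for j
      proof (rule LIMSEQ_le_const2)
        show "(\<lambda>n. \<Sum>k<j. w k * (cmod (\<sigma> m k - \<sigma> n k))\<^sup>2)
            \<longlonglongrightarrow> (\<Sum>k<j. w k * (cmod (\<sigma> m k - x k))\<^sup>2)"
          by (intro tendsto_intros x)
        have "(\<Sum>k<j. w k * (cmod (\<sigma> m k - \<sigma> n k))\<^sup>2) \<le> e\<^sup>2" if "n \<ge> N" for n
        proof -
          have "(\<Sum>k<j. w k * (cmod (\<sigma> m k - \<sigma> n k))\<^sup>2) \<le> (wnorm w (\<lambda>k. \<sigma> m k - \<sigma> n k))\<^sup>2"
            by (rule sum_le_wnorm[OF square_summable_diff[OF mem mem]]) simp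
          also have "\<dots> \<le> e\<^sup>2"
            using N[OF \<open>m \<ge> N\<close> that] wnorm_nonneg[OF square_summable_diff[OF mem mem]]
            by (intro power_mono) auto
          finally show ?thesis .
        qed
        then show "\<exists>N. \<forall>n\<ge>N. (\<Sum>k<j. w k * (cmod (\<sigma> m k - \<sigma> n k))\<^sup>2) \<le> e\<^sup>2" by blast
      qed
      have ss: "square_summable w (\<lambda>k. \<sigma> m k - x k)"
        unfolding square_summable_def
        by (rule bounded_imp_summable[OF _ part[of "Suc n" for n, unfolded lessThan_Suc_atMost]]) simp
      moreover have "(wnorm w (\<lambda>k. \<sigma> m k - x k))\<^sup>2 \<le> e\<^sup>2"
        unfolding wnorm_power2[OF ss]
        using ss part unfolding square_summable_def by (rule suminf_le_const)
      ultimately show ?thesis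
        using \<open>0 < e\<close> by (auto intro: power2_le_imp_le)
    qed
    then show ?thesis by blast
  qed
  from tail[of 1] obtain N where "square_summable w (\<lambda>k. \<sigma> N k - x k)" by auto
  from square_summable_diff[OF mem[of N] this] have "square_summable w x" by simp
  moreover have "(\<lambda>n. wnorm w (\<lambda>k. \<sigma> n k - x k)) \<longlonglongrightarrow> 0"
  proof (rule LIMSEQ_I)
    fix r :: real assume "0 < r"
    with tail[of "r / 2"] obtain N
      where "\<And>m. m \<ge> N \<Longrightarrow> square_summable w (\<lambda>k. \<sigma> m k - x k) \<and> wnorm w (\<lambda>k. \<sigma> m k - x k) \<le> r / 2" by auto
    with \<open>0 < r\<close> have "\<forall>m\<ge>N. norm (wnorm w (\<lambda>k. \<sigma> m k - x k) - 0) < r"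
      by fastforce
    then show "\<exists>N. \<forall>m\<ge>N. norm (wnorm w (\<lambda>k. \<sigma> m k - x k) - 0) < r" by blast
  qed
  ultimately show ?thesis by blast
qed

lemma hilbert_space_wl2: "hilbert_space UNIV (wl2 w)"
proof -
  have "cring (scalars UNIV)"
  proof (rule cringI)
    show "abelian_group (scalars UNIV)"
    proof (rule abelian_groupI)
      fix x assume "x \<in> carrier (scalars UNIV)"
      show "\<exists>y\<in>carrier (scalars UNIV). y \<oplus>\<^bsub>scalars UNIV\<^esub> x = \<zero>\<^bsub>scalars UNIV\<^esub>"
        by (intro bexI[of _ "-x"]) (auto simp: scalars_def)
    qed (auto simp: scalars_def)
    show "comm_monoid (scalars UNIV)"
      by (rule comm_monoidI) (auto simp: scalars_def)
  qed (auto simp: scalars_def algebra_simps)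
  then have "Module.module (scalars UNIV) (wl2 w)"
    by (rule moduleI[OF _ abelian_group_wl2]) (auto simp: scalars_def algebra_simps)
  then show ?thesis
  proof (intro hilbert_space.intro hilbert_space_axioms.intro)
    fix x :: "nat \<Rightarrow> complex" assume x: "x \<in> carrier (wl2 w)" "x \<noteq> \<zero>\<^bsub>wl2 w\<^esub>"
    then obtain k where "x k \<noteq> 0" by auto
    then have "0 < sqrt (w k) * cmod (x k)" using weight_pos[of k] by simp
    with coordinate_le_wnorm[of x k] x show "0 < Re (ip (wl2 w) x x)"
      by (auto simp: wip_self)
  next
    fix \<sigma> :: "nat \<Rightarrow> nat \<Rightarrow> complex"
    assume \<sigma>: "\<And>n. \<sigma> n \<in> carrier (wl2 w)"
      "\<And>e. 0 < e \<Longrightarrow> \<exists>N. \<forall>m\<ge>N. \<forall>n\<ge>N. nrm (wl2 w) (\<sigma> m \<ominus>\<^bsub>wl2 w\<^esub> \<sigma> n) < e"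
    then show "\<exists>x\<in>carrier (wl2 w). (\<lambda>n. nrm (wl2 w) (\<sigma> n \<ominus>\<^bsub>wl2 w\<^esub> x)) \<longlonglongrightarrow> 0"
      using complete_wl2[of \<sigma>] by (auto simp: a_minus_wl2)
  qed (auto simp: wip_add_left wip_scale_left wip_commute[symmetric] wip_self real_sqrt_abs)
qed

end

text \<open>
  Pointwise multiplication is the only map between weighted spaces used below. The multiplier
  \<open>1\<close> is the embedding of \<open>V\<close> into \<open>H\<close>, and \<open>1 / freq k\<close> turns the inner product of \<open>H\<close> into that
  of \<open>V\<close>.
\<close>

lemma multiplier_bound:
  assumes "weight v" "weight w" and x: "square_summable v x"
    and le: "\<And>k. w k * (cmod (m k))\<^sup>2 \<le> v k"
  shows "square_summable w (\<lambda>k. m k * x k)" and "wnorm w (\<lambda>k. m k * x k) \<le> wnorm v x"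
proof -
  interpret v: weight v by fact
  interpret w: weight w by fact
  have le': "w k * (cmod (m k * x k))\<^sup>2 \<le> v k * (cmod (x k))\<^sup>2" for k
    using mult_right_mono[OF le[of k], of "(cmod (x k))\<^sup>2"]
    by (simp add: norm_mult power_mult_distrib mult.assoc)
  show ss: "square_summable w (\<lambda>k. m k * x k)"
    using x unfolding square_summable_def
    by (rule summable_comparison_test'[where N = 0]) (use le' in simp)
  show "wnorm w (\<lambda>k. m k * x k) \<le> wnorm v x"
    using suminf_le[OF le'] ss x by (simp add: wnorm_def square_summable_def)
qed

text \<open>
  Truncating a sequence approximates it in the smaller norm, and a finitely supported sequence
  lies in every weighted space.
\<close>

lemma densely_embedded_wl2:
  assumes "weight v" "weight w" and le: "\<And>k. w k \<le> v k"
  shows "densely_embedded UNIV (wl2 v) (wl2 w)"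
proof -
  interpret v: weight v by fact
  interpret w: weight w by fact
  have smaller: "square_summable w x \<and> wnorm w x \<le> wnorm v x" if "square_summable v x" for x
    using multiplier_bound[OF assms(1,2) that, of "\<lambda>_. 1"] le by simp
  have dense: "\<exists>y. square_summable v y \<and> wnorm w (\<lambda>k. x k - y k) < e"
    if x: "square_summable w x" and "0 < e" for x and e :: real
  proof -
    have "(\<lambda>n. \<Sum>k. w (k + n) * (cmod (x (k + n)))\<^sup>2) \<longlonglongrightarrow> 0"
      using suminf_exist_split2[of "\<lambda>k. w k * (cmod (x k))\<^sup>2"] x
      unfolding square_summable_def by simp
    then have "eventually (\<lambda>n. (\<Sum>k. w (k + n) * (cmod (x (k + n)))\<^sup>2) < e\<^sup>2) sequentially"
      by (rule order_tendstoD(2)) (use \<open>0 < e\<close> in simp)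
    then obtain n where n: "(\<Sum>k. w (k + n) * (cmod (x (k + n)))\<^sup>2) < e\<^sup>2"
      by (auto simp: eventually_sequentially)
    define y where "y k = (if k < n then x k else 0)" for k
    have y: "square_summable u y" for u
      unfolding square_summable_def
      by (rule summable_finite[of "{..<n}"]) (auto simp: y_def)
    have "(wnorm w (\<lambda>k. x k - y k))\<^sup>2 = (\<Sum>k. w k * (cmod (x k - y k))\<^sup>2)"
      by (rule w.wnorm_power2[OF w.square_summable_diff[OF x y]])
    also have "\<dots> = (\<Sum>k. w (k + n) * (cmod (x (k + n) - y (k + n)))\<^sup>2)
        + (\<Sum>k<n. w k * (cmod (x k - y k))\<^sup>2)"
      by (rule suminf_split_initial_segment)
        (use w.square_summable_diff[OF x y] in \<open>simp add: square_summable_def\<close>)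
    also have "\<dots> < e\<^sup>2" using n by (simp add: y_def)
    finally have "wnorm w (\<lambda>k. x k - y k) < e"
      by (rule power_less_imp_less_base) (use \<open>0 < e\<close> in simp)
    with y show ?thesis by blast
  qed
  show ?thesis
    unfolding densely_embedded_def
  proof (intro conjI)
    show "\<exists>C. \<forall>x\<in>carrier (wl2 v). nrm (wl2 w) x \<le> C * nrm (wl2 v) x"
      using smaller by (intro exI[of _ 1]) simp
    show "\<forall>x\<in>carrier (wl2 w). \<forall>e>0. \<exists>y\<in>carrier (wl2 v). nrm (wl2 w) (x \<ominus>\<^bsub>wl2 w\<^esub> y) < e"
    proof (intro ballI allI impI)
      fix x :: "nat \<Rightarrow> complex" and e :: real
      assume "x \<in> carrier (wl2 w)" "0 < e"
      then obtain y where "square_summable v y" "wnorm w (\<lambda>k. x k - y k) < e"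
        using dense[of x e] by auto
      then show "\<exists>y\<in>carrier (wl2 v). nrm (wl2 w) (x \<ominus>\<^bsub>wl2 w\<^esub> y) < e"
        using smaller[of y] by (intro bexI[of _ y]) (auto simp: w.a_minus_wl2)
    qed
  qed (use smaller in auto)
qed

section \<open>The antidual and Riesz functionals\<close>

lemma antidual_simps [simp]:
  "\<zero>\<^bsub>antidual K V\<^esub> = (\<lambda>v\<in>carrier V. 0)"
  "\<phi> \<oplus>\<^bsub>antidual K V\<^esub> \<psi> = (\<lambda>v\<in>carrier V. \<phi> v + \<psi> v)"
  "c \<odot>\<^bsub>antidual K V\<^esub> \<phi> = (\<lambda>v\<in>carrier V. c * \<phi> v)"
  by (simp_all add: antidual_def)

lemma antidual_carrier_iff:
  "\<phi> \<in> carrier (antidual UNIV V) \<longleftrightarrow> \<phi> \<in> extensional (carrier V) \<and>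
     (\<forall>v\<in>carrier V. \<forall>u\<in>carrier V. \<phi> (v \<oplus>\<^bsub>V\<^esub> u) = \<phi> v + \<phi> u) \<and>
     (\<forall>c. \<forall>v\<in>carrier V. \<phi> (c \<odot>\<^bsub>V\<^esub> v) = cnj c * \<phi> v) \<and>
     (\<exists>C. \<forall>v\<in>carrier V. cmod (\<phi> v) \<le> C * nrm V v)"
  by (auto simp: antidual_def PiE_def)

lemma nrm_antidual:
  "nrm (antidual K V) \<phi> = (SUP v\<in>{v \<in> carrier V. nrm V v \<le> 1}. cmod (\<phi> v))"
  by (simp add: antidual_def)

lemma antidual_scale_closed:
  assumes V: "\<And>v u. v \<in> carrier V \<Longrightarrow> u \<in> carrier V \<Longrightarrow> v \<oplus>\<^bsub>V\<^esub> u \<in> carrier V"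
    "\<And>c v. v \<in> carrier V \<Longrightarrow> c \<odot>\<^bsub>V\<^esub> v \<in> carrier V"
    and \<phi>: "\<phi> \<in> carrier (antidual UNIV V)"
  shows "(\<lambda>v\<in>carrier V. a * \<phi> v) \<in> carrier (antidual UNIV V)"
proof -
  from \<phi> obtain C where "\<And>v. v \<in> carrier V \<Longrightarrow> cmod (\<phi> v) \<le> C * nrm V v"
    unfolding antidual_carrier_iff by blast
  then have "cmod (a * \<phi> v) \<le> (cmod a * C) * nrm V v" if "v \<in> carrier V" for v
    using that by (simp add: norm_mult mult.assoc mult_left_mono)
  then have "\<exists>C. \<forall>v\<in>carrier V. cmod (a * \<phi> v) \<le> C * nrm V v" by blast
  with \<phi> V show ?thesis
    by (simp add: antidual_carrier_iff algebra_simps)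
qed

lemma abelian_group_antidual:
  assumes V: "\<And>v u. v \<in> carrier V \<Longrightarrow> u \<in> carrier V \<Longrightarrow> v \<oplus>\<^bsub>V\<^esub> u \<in> carrier V"
    "\<And>c v. v \<in> carrier V \<Longrightarrow> c \<odot>\<^bsub>V\<^esub> v \<in> carrier V"
  shows "abelian_group (antidual UNIV V)"
proof (rule abelian_groupI)
  fix \<phi> \<psi> assume \<phi>: "\<phi> \<in> carrier (antidual UNIV V)" and \<psi>: "\<psi> \<in> carrier (antidual UNIV V)"
  from \<phi> obtain C where C: "\<And>v. v \<in> carrier V \<Longrightarrow> cmod (\<phi> v) \<le> C * nrm V v"
    unfolding antidual_carrier_iff by blast
  from \<psi> obtain D where D: "\<And>v. v \<in> carrier V \<Longrightarrow> cmod (\<psi> v) \<le> D * nrm V v"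
    unfolding antidual_carrier_iff by blast
  have "cmod (\<phi> v + \<psi> v) \<le> (C + D) * nrm V v" if "v \<in> carrier V" for v
    using norm_triangle_ineq[of "\<phi> v" "\<psi> v"] C[OF that] D[OF that] by (simp add: algebra_simps)
  then have "\<exists>C. \<forall>v\<in>carrier V. cmod (\<phi> v + \<psi> v) \<le> C * nrm V v" by blast
  with \<phi> \<psi> V show "\<phi> \<oplus>\<^bsub>antidual UNIV V\<^esub> \<psi> \<in> carrier (antidual UNIV V)"
    by (simp add: antidual_carrier_iff algebra_simps)
next
  show "\<zero>\<^bsub>antidual UNIV V\<^esub> \<in> carrier (antidual UNIV V)"
    using V by (auto simp: antidual_carrier_iff intro!: exI[of _ 0])
next
  fix \<phi> assume \<phi>: "\<phi> \<in> carrier (antidual UNIV V)"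
  have "(\<lambda>v\<in>carrier V. -1 * \<phi> v) \<oplus>\<^bsub>antidual UNIV V\<^esub> \<phi> = \<zero>\<^bsub>antidual UNIV V\<^esub>"
    by (auto simp: fun_eq_iff)
  with antidual_scale_closed[OF V \<phi>, of "-1"]
  show "\<exists>\<psi>\<in>carrier (antidual UNIV V). \<psi> \<oplus>\<^bsub>antidual UNIV V\<^esub> \<phi> = \<zero>\<^bsub>antidual UNIV V\<^esub>"
    by blast
next
  fix \<phi> assume "\<phi> \<in> carrier (antidual UNIV V)"
  then show "\<zero>\<^bsub>antidual UNIV V\<^esub> \<oplus>\<^bsub>antidual UNIV V\<^esub> \<phi> = \<phi>"
    by (auto simp: fun_eq_iff antidual_carrier_iff extensional_def)
qed (auto simp: fun_eq_iff)

lemma a_minus_antidual: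
  assumes V: "\<And>v u. v \<in> carrier V \<Longrightarrow> u \<in> carrier V \<Longrightarrow> v \<oplus>\<^bsub>V\<^esub> u \<in> carrier V"
    "\<And>c v. v \<in> carrier V \<Longrightarrow> c \<odot>\<^bsub>V\<^esub> v \<in> carrier V"
    and \<psi>: "\<psi> \<in> carrier (antidual UNIV V)"
  shows "\<phi> \<ominus>\<^bsub>antidual UNIV V\<^esub> \<psi> = (\<lambda>v\<in>carrier V. \<phi> v - \<psi> v)"
proof -
  interpret abelian_group "antidual UNIV V" by (rule abelian_group_antidual[OF V])
  have "\<ominus>\<^bsub>antidual UNIV V\<^esub> \<psi> = (\<lambda>v\<in>carrier V. -1 * \<psi> v)"
    using \<psi> antidual_scale_closed[OF V \<psi>, of "-1"] by (intro minus_equality) (auto simp: fun_eq_iff)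
  then show ?thesis
    by (auto simp: a_minus_def fun_eq_iff)
qed

text \<open>
  The norm of the antidual is a real supremum, so it dominates the values only because a bounded
  functional makes the supremum bounded above.
\<close>

lemma cmod_le_nrm_antidual:
  assumes V: "\<And>v. v \<in> carrier V \<Longrightarrow> 0 \<le> nrm V v"
    and \<phi>: "\<phi> \<in> carrier (antidual UNIV V)" and z: "z \<in> carrier V" "nrm V z \<le> 1"
  shows "cmod (\<phi> z) \<le> nrm (antidual UNIV V) \<phi>"
proof -
  from \<phi> obtain C where C: "\<And>v. v \<in> carrier V \<Longrightarrow> cmod (\<phi> v) \<le> C * nrm V v"
    unfolding antidual_carrier_iff by blast
  have "cmod (\<phi> v) \<le> \<bar>C\<bar>" if v: "v \<in> carrier V" "nrm V v \<le> 1" for v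
  proof -
    have "C * nrm V v \<le> \<bar>C\<bar> * 1"
      using V[OF v(1)] v(2) by (intro mult_mono) auto
    with C[OF v(1)] show ?thesis by simp
  qed
  then have "bdd_above ((\<lambda>v. cmod (\<phi> v)) ` {v \<in> carrier V. nrm V v \<le> 1})"
    by (intro bdd_aboveI[of _ "\<bar>C\<bar>"]) blast
  then show ?thesis
    unfolding nrm_antidual by (rule cSUP_upper[rotated]) (simp add: z)
qed

context weight
begin

abbreviation dual :: "((nat \<Rightarrow> complex) \<Rightarrow> complex) normed_module" where
  "dual \<equiv> antidual UNIV (wl2 w)"

definition riesz :: "(nat \<Rightarrow> complex) \<Rightarrow> (nat \<Rightarrow> complex) \<Rightarrow> complex" where
  "riesz r = (\<lambda>z\<in>carrier (wl2 w). wip w r z)"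

text \<open>
  The curves in the antidual that are integrated below have the form \<open>riesz (r t)\<close>. The representing vector \<open>r\<close>
  carries addition, scalars and norm, so that statements about curves in the antidual reduce to
  curves of square summable sequences.
\<close>

lemma riesz_apply [simp]: "square_summable w z \<Longrightarrow> riesz r z = wip w r z"
  by (simp add: riesz_def)

lemma abelian_group_dual: "abelian_group dual"
  by (rule abelian_group_antidual) auto

lemma a_minus_dual:
  "\<psi> \<in> carrier dual \<Longrightarrow> \<phi> \<ominus>\<^bsub>dual\<^esub> \<psi> = (\<lambda>v\<in>carrier (wl2 w). \<phi> v - \<psi> v)"
  by (rule a_minus_antidual) auto

lemma riesz_in_dual:
  assumes "square_summable w r"
  shows "riesz r \<in> carrier dual"
  unfolding antidual_carrier_iff
  using assms cauchy_schwarz[OF assms]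
  by (auto simp: riesz_def square_summable_add square_summable_scale wip_add_right wip_scale_right
      intro!: exI[of _ "wnorm w r"])

lemma riesz_diff:
  assumes "square_summable w r" "square_summable w s"
  shows "riesz r \<ominus>\<^bsub>dual\<^esub> riesz s = riesz (\<lambda>k. r k - s k)"
  unfolding a_minus_dual[OF riesz_in_dual[OF assms(2)]]
  using assms by (auto simp: fun_eq_iff riesz_def wip_diff_left)

lemma riesz_scale:
  assumes "square_summable w r"
  shows "c \<odot>\<^bsub>dual\<^esub> riesz r = riesz (\<lambda>k. c * r k)"
  using assms by (auto simp: fun_eq_iff riesz_def wip_scale_left)

lemma nrm_dual_le:
  assumes "\<And>z. square_summable w z \<Longrightarrow> wnorm w z \<le> 1 \<Longrightarrow> cmod (\<phi> z) \<le> C"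
  shows "nrm dual \<phi> \<le> C"
proof -
  have "(\<lambda>k. 0) \<in> {v \<in> carrier (wl2 w). nrm (wl2 w) v \<le> 1}"
    by (simp add: wnorm_def)
  then have "{v \<in> carrier (wl2 w). nrm (wl2 w) v \<le> 1} \<noteq> {}" by blast
  then show ?thesis
    unfolding nrm_antidual using assms by (intro cSUP_least) auto
qed

lemma cmod_le_nrm_dual:
  "\<phi> \<in> carrier dual \<Longrightarrow> square_summable w z \<Longrightarrow> wnorm w z \<le> 1 \<Longrightarrow> cmod (\<phi> z) \<le> nrm dual \<phi>"
  by (rule cmod_le_nrm_antidual) auto

text \<open>
  The upper bound is the Cauchy-Schwarz inequality; it is attained at \<open>r\<close> scaled to norm \<open>1\<close>.
\<close>

lemma nrm_riesz:
  assumes r: "square_summable w r"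
  shows "nrm dual (riesz r) = wnorm w r"
proof (rule antisym)
  show "nrm dual (riesz r) \<le> wnorm w r"
  proof (rule nrm_dual_le)
    fix z assume z: "square_summable w z" "wnorm w z \<le> 1"
    have "cmod (wip w r z) \<le> wnorm w r * wnorm w z" by (rule cauchy_schwarz[OF r z(1)])
    also have "\<dots> \<le> wnorm w r * 1" using z r by (intro mult_left_mono) auto
    finally show "cmod (riesz r z) \<le> wnorm w r" using z by simp
  qed
  show "wnorm w r \<le> nrm dual (riesz r)"
  proof (cases "wnorm w r = 0")
    case True
    have "cmod (riesz r (\<lambda>k. 0)) \<le> nrm dual (riesz r)"
      by (rule cmod_le_nrm_dual[OF riesz_in_dual[OF r]]) (simp_all add: wnorm_def)
    then have "0 \<le> nrm dual (riesz r)" by (rule order_trans[OF norm_ge_zero])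
    with True show ?thesis by simp
  next
    case False
    define c where "c = complex_of_real (1 / wnorm w r)"
    have z: "square_summable w (\<lambda>k. c * r k)" using r by auto
    have c: "cmod c = 1 / wnorm w r" using r by (simp add: c_def norm_divide)
    have "wnorm w (\<lambda>k. c * r k) = 1" unfolding wnorm_scale[OF r] c using False by simp
    then have "cmod (riesz r (\<lambda>k. c * r k)) \<le> nrm dual (riesz r)"
      by (intro cmod_le_nrm_dual[OF riesz_in_dual[OF r] z]) simp
    moreover have "riesz r (\<lambda>k. c * r k) = complex_of_real (wnorm w r)"
      unfolding riesz_apply[OF z] wip_scale_right[OF r r] wip_self[OF r]
      using False by (simp add: c_def power2_eq_square)
    ultimately show ?thesis using r by simp
  qed
qed

end

section \<open>Integrals of uniformly continuous curves\<close>

text \<open>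
  The spaces are records over explicit carriers and have no topology of their own, hence the
  explicit \<open>\<epsilon>\<close>-\<open>\<delta>\<close> form. The absolute value takes the place of nonnegativity of the norm, which an
  arbitrary record does not guarantee.
\<close>

definition uniform_curve :: "('a, 'm) normed_module_scheme \<Rightarrow> (real \<Rightarrow> 'a) \<Rightarrow> bool" where
  "uniform_curve X u \<longleftrightarrow> (\<forall>t. u t \<in> carrier X) \<and>
     (\<forall>e>0. \<exists>d>0. \<forall>s\<in>{0..1}. \<forall>t\<in>{0..1}. \<bar>s - t\<bar> < d \<longrightarrow> \<bar>nrm X (u t \<ominus>\<^bsub>X\<^esub> u s)\<bar> < e)"

text \<open>
  The step function that freezes \<open>u\<close> at the left end point of each interval of length
  \<open>1 / (n + 1)\<close>. It takes finitely many values on \<open>[0,1]\<close> and is uniformly close to a uniformly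
  continuous \<open>u\<close>, so a single sequence serves both for strong measurability and for the integral.
\<close>

definition sampled :: "(real \<Rightarrow> 'a) \<Rightarrow> nat \<Rightarrow> real \<Rightarrow> 'a" where
  "sampled u n t = u (real_of_int \<lfloor>real (Suc n) * t\<rfloor> / real (Suc n))"

lemma simple_function_sampled: "simple_function (lebesgue_on {0..1}) (sampled u n)"
proof -
  let ?f = "\<lambda>t. real_of_int \<lfloor>real (Suc n) * t\<rfloor>"
  have "?f \<in> borel_measurable borel" by measurable
  then have "?f \<in> borel_measurable (lebesgue_on {0..1})"
    by (intro measurable_restrict_space1 measurable_completion) simp
  moreover have "?f ` {0..1} \<subseteq> real_of_int ` {0..int (Suc n)}"
  proof (intro image_subsetI imageI)
    fix t :: real assume t: "t \<in> {0..1}"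
    then have "real (Suc n) * t \<le> real (Suc n)" "0 \<le> real (Suc n) * t"
      by (auto intro: mult_left_le)
    then have "real (Suc n) * t < real_of_int (int (Suc n)) + 1" by linarith
    with \<open>0 \<le> real (Suc n) * t\<close> show "\<lfloor>real (Suc n) * t\<rfloor> \<in> {0..int (Suc n)}"
      unfolding atLeastAtMost_iff floor_le_iff zero_le_floor by blast
  qed
  then have "finite (?f ` {0..1})" by (rule finite_subset) simp
  ultimately have "simple_function (lebesgue_on {0..1}) ?f"
    by (intro simple_function_borel_measurable) simp_all
  from simple_function_compose1[OF this, of "\<lambda>x. u (x / real (Suc n))"]
  show ?thesis by (simp add: sampled_def[abs_def])
qed

lemma sampled_error:
  assumes u: "uniform_curve X u" and "0 < e"
  shows "\<exists>N. \<forall>n\<ge>N. \<forall>t\<in>{0..1}. \<bar>nrm X (u t \<ominus>\<^bsub>X\<^esub> sampled u n t)\<bar> < e"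
proof -
  from assms obtain d where "0 < d"
    and d: "\<And>s t. s \<in> {0..1} \<Longrightarrow> t \<in> {0..1} \<Longrightarrow> \<bar>s - t\<bar> < d \<Longrightarrow> \<bar>nrm X (u t \<ominus>\<^bsub>X\<^esub> u s)\<bar> < e"
    unfolding uniform_curve_def by metis
  from reals_Archimedean[OF \<open>0 < d\<close>] obtain N where N: "1 / real (Suc N) < d"
    by (auto simp: inverse_eq_divide)
  show ?thesis
  proof (intro exI[of _ N] allI ballI impI)
    fix n t assume n: "n \<ge> N" and t: "t \<in> {0..1::real}"
    define p where "p = real_of_int \<lfloor>real (Suc n) * t\<rfloor> / real (Suc n)"
    have "real_of_int \<lfloor>real (Suc n) * t\<rfloor> \<le> real (Suc n) * t"
      "real (Suc n) * t < real_of_int \<lfloor>real (Suc n) * t\<rfloor> + 1"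
      by linarith+
    then have p: "p \<le> t" "t < p + 1 / real (Suc n)"
      by (simp_all add: p_def field_simps del: of_nat_Suc)
    have "0 \<le> p" using t by (simp add: p_def del: of_nat_Suc)
    moreover have "1 / real (Suc n) \<le> 1 / real (Suc N)" using n by (simp add: field_simps)
    ultimately show "\<bar>nrm X (u t \<ominus>\<^bsub>X\<^esub> sampled u n t)\<bar> < e"
      unfolding sampled_def p_def[symmetric] using p t N by (intro d[of p t]) simp_all
  qed
qed

lemma sampled_closed: "uniform_curve X u \<Longrightarrow> sampled u n t \<in> carrier X"
  by (simp add: uniform_curve_def sampled_def)

lemma strongly_measurable_curve:
  assumes u: "uniform_curve X u"
  shows "strongly_measurable (lebesgue_on {0..1}) X u"
proof -
  have "(\<lambda>i. nrm X (u t \<ominus>\<^bsub>X\<^esub> sampled u i t)) \<longlonglongrightarrow> 0" if t: "t \<in> {0..1}" for t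
  proof (rule LIMSEQ_I)
    fix e :: real assume "0 < e"
    from sampled_error[OF u this] t
    show "\<exists>N. \<forall>n\<ge>N. norm (nrm X (u t \<ominus>\<^bsub>X\<^esub> sampled u n t) - 0) < e"
      unfolding real_norm_def diff_0_right by meson
  qed
  then have "AE t in lebesgue_on {0..1}. (\<lambda>i. nrm X (u t \<ominus>\<^bsub>X\<^esub> sampled u i t)) \<longlonglongrightarrow> 0"
    by (intro AE_I2) simp
  moreover have "\<forall>i. simple_function (lebesgue_on {0..1}) (sampled u i) \<and>
      sampled u i \<in> space (lebesgue_on {0..1}) \<rightarrow> carrier X"
    by (simp add: simple_function_sampled sampled_closed[OF u])
  moreover have "u \<in> space (lebesgue_on {0..1}) \<rightarrow> carrier X"
    using u by (simp add: uniform_curve_def)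
  ultimately show ?thesis
    unfolding strongly_measurable_def by blast
qed

lemma emeasure_unit_interval [simp]: "emeasure (lebesgue_on {0..1::real}) {0..1} = 1"
  by (simp add: emeasure_restrict_space)

lemma finite_measure_unit_interval: "finite_measure (lebesgue_on {0..1::real})"
  by (rule finite_measureI) simp

lemma measure_unit_interval [simp]: "measure (lebesgue_on {0..1::real}) {0..1} = 1"
  by (simp add: measure_def)

lemma integral_unit_interval_le:
  fixes f :: "real \<Rightarrow> complex"
  assumes f: "integrable (lebesgue_on {0..1}) f" and B: "\<And>t. t \<in> {0..1} \<Longrightarrow> cmod (f t) \<le> B"
  shows "cmod (integral\<^sup>L (lebesgue_on {0..1}) f) \<le> B"
proof -
  interpret finite_measure "lebesgue_on {0..1::real}" by (rule finite_measure_unit_interval)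
  have "cmod (integral\<^sup>L (lebesgue_on {0..1}) f) \<le> (\<integral>t. cmod (f t) \<partial>lebesgue_on {0..1})"
    by (rule integral_norm_bound)
  also have "\<dots> \<le> (\<integral>t. B \<partial>lebesgue_on {0..1::real})"
    using f B by (intro Bochner_Integration.integral_mono) auto
  also have "\<dots> = B" by simp
  finally show ?thesis .
qed

lemma L2_curve:
  assumes u: "uniform_curve X u" and C: "\<And>t. t \<in> {0..1} \<Longrightarrow> \<bar>nrm X (u t)\<bar> \<le> C"
  shows "u \<in> L2 1 X"
proof -
  have "(\<integral>\<^sup>+ t. ennreal ((nrm X (u t))\<^sup>2) \<partial>lebesgue_on {0..1}) \<le> (\<integral>\<^sup>+ t. ennreal (C\<^sup>2) \<partial>lebesgue_on {0..1::real})"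
  proof (rule nn_integral_mono)
    fix t assume "t \<in> space (lebesgue_on {0..1::real})"
    then have "\<bar>nrm X (u t)\<bar> \<le> \<bar>C\<bar>" using C[of t] by simp
    then show "ennreal ((nrm X (u t))\<^sup>2) \<le> ennreal (C\<^sup>2)"
      by (intro ennreal_leI) (simp add: abs_le_square_iff)
  qed
  also have "\<dots> = ennreal (C\<^sup>2)"
    using emeasure_unit_interval by (simp only: nn_integral_const space_lebesgue_on mult_1_right)
  also have "\<dots> < \<infinity>" by simp
  finally show ?thesis
    unfolding L2_def using strongly_measurable_curve[OF u] by blast
qed

lemma integrable_simple_function_eval:
  fixes e :: "'a \<Rightarrow> complex"
  assumes "finite_measure M" "simple_function M s"
  shows "integrable M (\<lambda>t. e (s t))"
proof -
  interpret finite_measure M by fact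
  have "(\<lambda>t. e (s t)) \<in> borel_measurable M"
    using measurable_compose[OF measurable_simple_function[OF assms(2)], of e borel] by simp
  moreover have "finite ((\<lambda>x. cmod (e x)) ` s ` space M)"
    using simple_functionD(1)[OF assms(2)] by simp
  then have "cmod (e (s t)) \<le> Max ((\<lambda>x. cmod (e x)) ` s ` space M)" if "t \<in> space M" for t
    using that by (intro Max_ge) auto
  ultimately show ?thesis
    by (intro integrable_const_bound AE_I2)
qed

text \<open>
  A functional that is additive and real-homogeneous commutes with the integral of simple functions.
  It is applied to evaluation of functionals at a vector and to coordinates of sequences.
\<close>

lemma simple_integral_eval:
  fixes e :: "'a \<Rightarrow> complex" and M :: "'b measure"
  assumes X: "abelian_group X"
    and M: "finite_measure M"
    and s: "simple_function M s" "\<And>t. t \<in> space M \<Longrightarrow> s t \<in> carrier X"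
    and closed: "\<And>c x. x \<in> carrier X \<Longrightarrow> complex_of_real c \<odot>\<^bsub>X\<^esub> x \<in> carrier X"
    and e0: "e \<zero>\<^bsub>X\<^esub> = 0"
    and e_add: "\<And>x y. x \<in> carrier X \<Longrightarrow> y \<in> carrier X \<Longrightarrow> e (x \<oplus>\<^bsub>X\<^esub> y) = e x + e y"
    and e_scale: "\<And>c x. x \<in> carrier X \<Longrightarrow> e (complex_of_real c \<odot>\<^bsub>X\<^esub> x) = complex_of_real c * e x"
  shows "simple_integral_in M X s \<in> carrier X"
    and "e (simple_integral_in M X s) = (\<integral>t. e (s t) \<partial>M)"
proof -
  interpret abelian_group X by (rule X)
  interpret M: finite_measure M by (rule M)
  let ?f = "\<lambda>y. complex_of_real (measure M {t \<in> space M. s t = y}) \<odot>\<^bsub>X\<^esub> y"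
  have fin: "finite (s ` space M)" by (rule simple_functionD(1)[OF s(1)])
  have f: "?f \<in> s ` space M \<rightarrow> carrier X" using s(2) closed by auto
  show "simple_integral_in M X s \<in> carrier X"
    unfolding simple_integral_in_def by (rule finsum_closed[OF f])
  have sum: "e (finsum X g A) = (\<Sum>a\<in>A. e (g a))" if "finite A" "g \<in> A \<rightarrow> carrier X" for g :: "'a \<Rightarrow> 'a" and A
    using that
  proof (induction A rule: finite_induct)
    case (insert a A)
    then have g: "g \<in> A \<rightarrow> carrier X" "g a \<in> carrier X" by auto
    have "e (finsum X g (insert a A)) = e (g a \<oplus>\<^bsub>X\<^esub> finsum X g A)"
      by (subst finsum_insert[OF insert.hyps g]) (rule refl)
    also have "\<dots> = e (g a) + e (finsum X g A)"
      by (rule e_add[OF g(2) finsum_closed[OF g(1)]])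
    finally show ?case unfolding insert.IH[OF g(1)] sum.insert[OF insert.hyps] .
  qed (simp add: e0)
  have "(\<integral>t. e (s t) \<partial>M) = (\<integral>t. (\<Sum>y\<in>s ` space M. indicator {t \<in> space M. s t = y} t *\<^sub>R e y) \<partial>M)"
  proof (rule Bochner_Integration.integral_cong)
    fix t assume t: "t \<in> space M"
    have "(\<Sum>y\<in>s ` space M. indicator {t \<in> space M. s t = y} t *\<^sub>R e y)
        = (\<Sum>y\<in>s ` space M. if y = s t then e y else 0)"
      using t by (intro sum.cong) (simp_all add: indicator_def)
    then show "e (s t) = (\<Sum>y\<in>s ` space M. indicator {t \<in> space M. s t = y} t *\<^sub>R e y)"
      using fin t by simp
  qed simp
  also have "\<dots> = (\<Sum>y\<in>s ` space M. measure M {t \<in> space M. s t = y} *\<^sub>R e y)"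
  proof -
    have level: "{t \<in> space M. s t = y} = s -` {y} \<inter> space M" for y by auto
    have "integrable M (indicator {t \<in> space M. s t = y} :: 'b \<Rightarrow> real)" for y
      unfolding level using M.emeasure_finite
      by (intro integrable_real_indicator simple_functionD(2)[OF s(1)]) (simp add: less_top[symmetric])
    moreover have "{t \<in> space M. s t = y} \<inter> space M = {t \<in> space M. s t = y}" for y by blast
    ultimately show ?thesis by simp
  qed
  also have "\<dots> = e (simple_integral_in M X s)"
    unfolding simple_integral_in_def sum[OF fin f]
    by (rule sum.cong) (use s(2) in \<open>auto simp: e_scale scaleR_conv_of_real\<close>)
  finally show "e (simple_integral_in M X s) = (\<integral>t. e (s t) \<partial>M)" by simp
qed

context weight
begin

lemma uniform_curve_wl2_iff:
  "uniform_curve (wl2 w) r \<longleftrightarrow> (\<forall>t. square_summable w (r t)) \<and>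
     (\<forall>e>0. \<exists>d>0. \<forall>s\<in>{0..1}. \<forall>t\<in>{0..1}. \<bar>s - t\<bar> < d \<longrightarrow> wnorm w (\<lambda>k. r t k - r s k) < e)"
proof (cases "\<forall>t. square_summable w (r t)")
  case True
  then have "\<bar>wnorm w (\<lambda>k. r t k - r s k)\<bar> = wnorm w (\<lambda>k. r t k - r s k)" for s t
    by (intro abs_of_nonneg wnorm_nonneg square_summable_diff) auto
  with True show ?thesis by (simp add: uniform_curve_def a_minus_wl2)
qed (auto simp: uniform_curve_def)

lemma uniform_curve_square_summable: "uniform_curve (wl2 w) r \<Longrightarrow> square_summable w (r t)"
  by (simp add: uniform_curve_def)

lemma uniform_curve_riesz:
  assumes r: "uniform_curve (wl2 w) r"
  shows "uniform_curve dual (\<lambda>t. riesz (r t))"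
  using r uniform_curve_square_summable[OF r]
  by (simp add: uniform_curve_def riesz_in_dual riesz_diff nrm_riesz square_summable_diff a_minus_wl2)

lemma wnorm_diff_ge:
  assumes "square_summable w x" "square_summable w y"
  shows "\<bar>wnorm w x - wnorm w y\<bar> \<le> wnorm w (\<lambda>k. x k - y k)"
proof -
  have "wnorm w (\<lambda>k. y k - x k) = wnorm w (\<lambda>k. -1 * (x k - y k))" by simp
  also have "\<dots> = wnorm w (\<lambda>k. x k - y k)"
    by (subst wnorm_scale) (use assms in auto)
  finally have "wnorm w (\<lambda>k. y k - x k) = wnorm w (\<lambda>k. x k - y k)" .
  with wnorm_triangle[OF square_summable_diff[OF assms] assms(2)]
    wnorm_triangle[OF square_summable_diff[OF assms(2,1)] assms(1)]
  show ?thesis by simp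
qed

lemma uniform_curve_bounded:
  assumes r: "uniform_curve (wl2 w) r"
  shows "\<exists>C. \<forall>t\<in>{0..1}. wnorm w (r t) \<le> C"
proof -
  have "continuous_on {0..1} (\<lambda>t. wnorm w (r t))"
    unfolding continuous_on_iff
  proof (intro ballI allI impI)
    fix t e :: real assume t: "t \<in> {0..1}" and "0 < e"
    with r obtain d where "0 < d"
      "\<And>s. s \<in> {0..1} \<Longrightarrow> \<bar>t - s\<bar> < d \<Longrightarrow> wnorm w (\<lambda>k. r s k - r t k) < e"
      unfolding uniform_curve_wl2_iff by blast
    moreover have "dist (wnorm w (r s)) (wnorm w (r t)) \<le> wnorm w (\<lambda>k. r s k - r t k)" for s
      unfolding dist_real_def by (intro wnorm_diff_ge uniform_curve_square_summable[OF r])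
    ultimately show "\<exists>d>0. \<forall>s\<in>{0..1}. dist s t < d \<longrightarrow> dist (wnorm w (r s)) (wnorm w (r t)) < e"
      by (metis dist_commute dist_real_def le_less_trans)
  qed
  then have "bounded ((\<lambda>t. wnorm w (r t)) ` {0..1})"
    by (intro compact_imp_bounded compact_continuous_image) auto
  then show ?thesis
    by (auto simp: bounded_iff) (meson abs_le_D1)
qed

lemma continuous_on_wip_curve:
  assumes r: "uniform_curve (wl2 w) r" and z: "square_summable w z"
  shows "continuous_on {0..1} (\<lambda>t. wip w (r t) z)"
  unfolding continuous_on_iff
proof (intro ballI allI impI)
  fix t e :: real assume t: "t \<in> {0..1}" and "0 < e"
  let ?C = "wnorm w z + 1"
  have "0 < ?C" using wnorm_nonneg[OF z] by linarith
  with \<open>0 < e\<close> have "0 < e / ?C" by simp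
  with r t obtain d where "0 < d" and
    d: "\<And>s. s \<in> {0..1} \<Longrightarrow> \<bar>t - s\<bar> < d \<Longrightarrow> wnorm w (\<lambda>k. r s k - r t k) < e / ?C"
    unfolding uniform_curve_wl2_iff by blast
  have "dist (wip w (r s) z) (wip w (r t) z) < e" if "s \<in> {0..1}" "\<bar>t - s\<bar> < d" for s
  proof -
    note ss = uniform_curve_square_summable[OF r]
    have "dist (wip w (r s) z) (wip w (r t) z) = cmod (wip w (\<lambda>k. r s k - r t k) z)"
      by (simp add: dist_norm wip_diff_left ss z)
    also have "\<dots> \<le> wnorm w (\<lambda>k. r s k - r t k) * wnorm w z"
      by (intro cauchy_schwarz square_summable_diff ss z)
    also have "\<dots> \<le> wnorm w (\<lambda>k. r s k - r t k) * ?C"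
      by (intro mult_left_mono wnorm_nonneg square_summable_diff ss) simp
    also have "\<dots> < e" using d[OF that] \<open>0 < ?C\<close> by (simp add: pos_less_divide_eq)
    finally show ?thesis .
  qed
  with \<open>0 < d\<close> show "\<exists>d>0. \<forall>s\<in>{0..1}. dist s t < d \<longrightarrow> dist (wip w (r s) z) (wip w (r t) z) < e"
    by (intro exI[of _ d]) (auto simp: dist_real_def abs_minus_commute)
qed

lemma uniform_curve_add:
  assumes r: "uniform_curve (wl2 w) r" and s: "uniform_curve (wl2 w) s"
  shows "uniform_curve (wl2 w) (\<lambda>t k. r t k + s t k)"
  unfolding uniform_curve_wl2_iff
proof (intro conjI allI impI)
  note ss = uniform_curve_square_summable[OF r] uniform_curve_square_summable[OF s]
  show "square_summable w (\<lambda>k. r t k + s t k)" for t by (intro square_summable_add ss)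
  fix e :: real assume "0 < e"
  then have "0 < e / 2" by simp
  with r obtain d1 where "0 < d1" and
    d1: "\<forall>a\<in>{0..1}. \<forall>b\<in>{0..1}. \<bar>a - b\<bar> < d1 \<longrightarrow> wnorm w (\<lambda>k. r b k - r a k) < e / 2"
    unfolding uniform_curve_wl2_iff by blast
  from \<open>0 < e / 2\<close> s obtain d2 where "0 < d2" and
    d2: "\<forall>a\<in>{0..1}. \<forall>b\<in>{0..1}. \<bar>a - b\<bar> < d2 \<longrightarrow> wnorm w (\<lambda>k. s b k - s a k) < e / 2"
    unfolding uniform_curve_wl2_iff by blast
  have "wnorm w (\<lambda>k. r b k + s b k - (r a k + s a k)) < e"
    if "a \<in> {0..1}" "b \<in> {0..1}" "\<bar>a - b\<bar> < min d1 d2" for a b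
  proof -
    have "wnorm w (\<lambda>k. (r b k - r a k) + (s b k - s a k))
        \<le> wnorm w (\<lambda>k. r b k - r a k) + wnorm w (\<lambda>k. s b k - s a k)"
      by (intro wnorm_triangle square_summable_diff ss)
    also have "\<dots> < e / 2 + e / 2"
      using that by (intro add_strict_mono d1[rule_format] d2[rule_format]) simp_all
    finally show ?thesis by (simp add: algebra_simps)
  qed
  then show "\<exists>d>0. \<forall>a\<in>{0..1}. \<forall>b\<in>{0..1}. \<bar>a - b\<bar> < d \<longrightarrow>
      wnorm w (\<lambda>k. r b k + s b k - (r a k + s a k)) < e"
    using \<open>0 < d1\<close> \<open>0 < d2\<close> by (intro exI[of _ "min d1 d2"]) simp
qed

lemma uniform_curve_scale:
  assumes r: "uniform_curve (wl2 w) r" and c: "continuous_on {0..1} c"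
  shows "uniform_curve (wl2 w) (\<lambda>t k. c t * r t k)"
  unfolding uniform_curve_wl2_iff
proof (intro conjI allI impI)
  note ss = uniform_curve_square_summable[OF r]
  show "square_summable w (\<lambda>k. c t * r t k)" for t by (intro square_summable_scale ss)
  fix e :: real assume "0 < e"
  obtain C where C: "\<And>t. t \<in> {0..1} \<Longrightarrow> wnorm w (r t) \<le> C" using uniform_curve_bounded[OF r] by blast
  then have "0 \<le> C" using wnorm_nonneg[OF ss[of 0]] by (meson atLeastAtMost_iff order_trans zero_le_one order_refl)
  have "bounded (c ` {0..1})"
    by (intro compact_imp_bounded compact_continuous_image c) auto
  then obtain B where "0 < B" and B: "\<And>t. t \<in> {0..1} \<Longrightarrow> cmod (c t) \<le> B"
    by (auto simp: bounded_pos)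
  have "0 < e / (2 * B)" using \<open>0 < e\<close> \<open>0 < B\<close> by simp
  with r obtain d1 where "0 < d1" and
    d1: "\<forall>a\<in>{0..1}. \<forall>b\<in>{0..1}. \<bar>a - b\<bar> < d1 \<longrightarrow> wnorm w (\<lambda>k. r b k - r a k) < e / (2 * B)"
    unfolding uniform_curve_wl2_iff by blast
  have "uniformly_continuous_on {0..1} c" using c by (intro compact_uniformly_continuous) auto
  moreover have "0 < e / (2 * (C + 1))" using \<open>0 < e\<close> \<open>0 \<le> C\<close> by simp
  ultimately obtain d2 where "0 < d2" and
    d2: "\<forall>a\<in>{0..1}. \<forall>b\<in>{0..1}. dist b a < d2 \<longrightarrow> dist (c b) (c a) < e / (2 * (C + 1))"
    unfolding uniformly_continuous_on_def by blast
  have "wnorm w (\<lambda>k. c b * r b k - c a * r a k) < e"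
    if ab: "a \<in> {0..1}" "b \<in> {0..1}" "\<bar>a - b\<bar> < min d1 d2" for a b
  proof -
    have "wnorm w (\<lambda>k. c b * (r b k - r a k) + (c b - c a) * r a k)
        \<le> wnorm w (\<lambda>k. c b * (r b k - r a k)) + wnorm w (\<lambda>k. (c b - c a) * r a k)"
      by (intro wnorm_triangle square_summable_diff square_summable_scale ss)
    also have "\<dots> = cmod (c b) * wnorm w (\<lambda>k. r b k - r a k) + cmod (c b - c a) * wnorm w (r a)"
      by (simp add: wnorm_scale square_summable_diff ss)
    also have "\<dots> \<le> B * wnorm w (\<lambda>k. r b k - r a k) + e / (2 * (C + 1)) * (C + 1)"
      using ab B[of b] C[of a] d2 \<open>0 \<le> C\<close> \<open>0 < e\<close>
      by (intro add_mono mult_right_mono mult_mono wnorm_nonneg square_summable_diff ss)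
        (auto simp: dist_norm abs_minus_commute intro: less_imp_le)
    also have "\<dots> < B * (e / (2 * B)) + e / (2 * (C + 1)) * (C + 1)"
      using d1 ab \<open>0 < B\<close> by (intro add_strict_right_mono mult_strict_left_mono) auto
    also have "\<dots> = e" using \<open>0 < B\<close> \<open>0 \<le> C\<close> by (simp add: field_simps)
    finally show ?thesis by (simp add: algebra_simps)
  qed
  then show "\<exists>d>0. \<forall>a\<in>{0..1}. \<forall>b\<in>{0..1}. \<bar>a - b\<bar> < d \<longrightarrow>
      wnorm w (\<lambda>k. c b * r b k - c a * r a k) < e"
    using \<open>0 < d1\<close> \<open>0 < d2\<close> by (intro exI[of _ "min d1 d2"]) simp
qed

lemma L2_wl2_curve:
  assumes r: "uniform_curve (wl2 w) r"
  shows "r \<in> L2 1 (wl2 w)"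
proof -
  obtain C where "\<And>t. t \<in> {0..1} \<Longrightarrow> wnorm w (r t) \<le> C" using uniform_curve_bounded[OF r] by blast
  then show ?thesis
    using uniform_curve_square_summable[OF r] by (intro L2_curve[OF r, of C]) simp
qed

lemma L2_dual_curve:
  assumes r: "uniform_curve (wl2 w) r"
  shows "(\<lambda>t. riesz (r t)) \<in> L2 1 dual"
proof -
  obtain C where "\<And>t. t \<in> {0..1} \<Longrightarrow> wnorm w (r t) \<le> C" using uniform_curve_bounded[OF r] by blast
  then show ?thesis
    using uniform_curve_square_summable[OF r]
    by (intro L2_curve[OF uniform_curve_riesz[OF r], of C]) (simp add: nrm_riesz)
qed

text \<open>
  The integral of a curve of functionals is computed pointwise: for \<open>z\<close> in the unit ball,
  evaluation at \<open>z\<close> turns the vector-valued integral of a step function into a scalar integral, and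
  the uniform error of the step function bounds the difference of the scalar integrals uniformly
  in \<open>z\<close>.
\<close>

lemma has_integral_riesz:
  assumes r: "uniform_curve (wl2 w) r"
  shows "has_integral_in (lebesgue_on {0..1}) dual (\<lambda>t. riesz (r t))
    (\<lambda>z\<in>carrier (wl2 w). \<integral>t. wip w (r t) z \<partial>lebesgue_on {0..1})"
proof -
  let ?M = "lebesgue_on {0..1::real}"
  interpret finite_measure ?M by (rule finite_measure_unit_interval)
  note ss = uniform_curve_square_summable[OF r]
  define x where "x = (\<lambda>z\<in>carrier (wl2 w). \<integral>t. wip w (r t) z \<partial>?M)"
  define s where "s = sampled (\<lambda>t. riesz (r t))"
  have int: "integrable ?M (\<lambda>t. wip w (r t) z)" if "square_summable w z" for z
    by (rule continuous_imp_integrable_real[OF continuous_on_wip_curve[OF r that]])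
  obtain C where C: "\<And>t. t \<in> {0..1} \<Longrightarrow> wnorm w (r t) \<le> C" using uniform_curve_bounded[OF r] by blast
  have bound: "cmod (x z) \<le> C * wnorm w z" if z: "square_summable w z" for z
  proof -
    have "cmod (wip w (r t) z) \<le> C * wnorm w z" if "t \<in> {0..1}" for t
      using cauchy_schwarz[OF ss z, of t] mult_right_mono[OF C[OF that] wnorm_nonneg[OF z]] by linarith
    from integral_unit_interval_le[OF int[OF z] this] z show ?thesis by (simp add: x_def)
  qed
  have x: "x \<in> carrier dual"
    unfolding antidual_carrier_iff
  proof (intro conjI ballI allI)
    show "x \<in> extensional (carrier (wl2 w))" by (simp add: x_def)
    show "x (v \<oplus>\<^bsub>wl2 w\<^esub> u) = x v + x u" if "v \<in> carrier (wl2 w)" "u \<in> carrier (wl2 w)" for v u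
      using that int ss by (simp add: x_def square_summable_add wip_add_right)
    show "x (c \<odot>\<^bsub>wl2 w\<^esub> v) = cnj c * x v" if "v \<in> carrier (wl2 w)" for c v
      using that int ss by (simp add: x_def square_summable_scale wip_scale_right)
    show "\<exists>C. \<forall>v\<in>carrier (wl2 w). cmod (x v) \<le> C * nrm (wl2 w) v"
      using bound by (intro exI[of _ C]) simp
  qed
  note curve = uniform_curve_riesz[OF r]
  have s_closed: "s i t \<in> carrier dual" for i t
    unfolding s_def by (rule sampled_closed[OF curve])
  have simple: "simple_function ?M (s i)" for i
    unfolding s_def by (rule simple_function_sampled)
  have scale: "complex_of_real c \<odot>\<^bsub>dual\<^esub> \<phi> \<in> carrier dual" if "\<phi> \<in> carrier dual" for c \<phi>
    unfolding antidual_simps by (rule antidual_scale_closed) (use that in simp_all)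
  have eval: "simple_integral_in ?M dual (s i) \<in> carrier dual"
    "simple_integral_in ?M dual (s i) z = (\<integral>t. s i t z \<partial>?M)" if z: "square_summable w z" for i z
  proof -
    note * = simple_integral_eval[OF abelian_group_dual finite_measure_unit_interval simple s_closed scale,
        of "\<lambda>\<phi>. \<phi> z"]
    show "simple_integral_in ?M dual (s i) \<in> carrier dual"
      by (rule *(1)) (use z in simp_all)
    show "simple_integral_in ?M dual (s i) z = (\<integral>t. s i t z \<partial>?M)"
      by (rule *(2)) (use z in simp_all)
  qed
  have error: "\<exists>N. \<forall>n\<ge>N. \<forall>t\<in>{0..1}. \<bar>nrm dual (riesz (r t) \<ominus>\<^bsub>dual\<^esub> s n t)\<bar> < e" if "0 < e" for e
    unfolding s_def by (rule sampled_error[OF curve that])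
  have lim1: "(\<lambda>i. \<integral>\<^sup>+ t. ennreal (nrm dual (riesz (r t) \<ominus>\<^bsub>dual\<^esub> s i t)) \<partial>?M) \<longlonglongrightarrow> 0"
  proof (rule order_tendstoI)
    fix a :: ennreal assume "0 < a"
    then obtain b where b: "0 < b" "b < a" using dense by blast
    define e where "e = enn2real b"
    have "b = ennreal e" using b(2) by (cases b) (auto simp: e_def)
    with b have e: "0 < e" "ennreal e < a" by simp_all
    from error[OF e(1)] obtain N where
      N: "\<And>n t. n \<ge> N \<Longrightarrow> t \<in> {0..1} \<Longrightarrow> \<bar>nrm dual (riesz (r t) \<ominus>\<^bsub>dual\<^esub> s n t)\<bar> < e" by blast
    have "(\<integral>\<^sup>+ t. ennreal (nrm dual (riesz (r t) \<ominus>\<^bsub>dual\<^esub> s n t)) \<partial>?M) < a" if "n \<ge> N" for n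
    proof -
      have "(\<integral>\<^sup>+ t. ennreal (nrm dual (riesz (r t) \<ominus>\<^bsub>dual\<^esub> s n t)) \<partial>?M) \<le> (\<integral>\<^sup>+ t. ennreal e \<partial>?M)"
        using N[OF that] by (intro nn_integral_mono ennreal_leI) (simp add: abs_less_iff less_imp_le)
      then show ?thesis using e(2) by simp
    qed
    then show "\<forall>\<^sub>F i in sequentially. (\<integral>\<^sup>+ t. ennreal (nrm dual (riesz (r t) \<ominus>\<^bsub>dual\<^esub> s i t)) \<partial>?M) < a"
      by (auto simp: eventually_sequentially)
  qed simp
  have lim2: "(\<lambda>i. nrm dual (simple_integral_in ?M dual (s i) \<ominus>\<^bsub>dual\<^esub> x)) \<longlonglongrightarrow> 0"
  proof (rule LIMSEQ_I)
    fix e :: real assume "0 < e"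
    then have "0 < e / 2" by simp
    from error[OF this] obtain N where
      N: "\<And>n t. n \<ge> N \<Longrightarrow> t \<in> {0..1} \<Longrightarrow> \<bar>nrm dual (riesz (r t) \<ominus>\<^bsub>dual\<^esub> s n t)\<bar> < e / 2" by blast
    have "norm (nrm dual (simple_integral_in ?M dual (s n) \<ominus>\<^bsub>dual\<^esub> x) - 0) < e" if n: "n \<ge> N" for n
    proof -
      let ?D = "simple_integral_in ?M dual (s n) \<ominus>\<^bsub>dual\<^esub> x"
      have "nrm dual ?D \<le> e / 2"
      proof (rule nrm_dual_le)
        fix z assume z: "square_summable w z" "wnorm w z \<le> 1"
        have s_int: "integrable ?M (\<lambda>t. s n t z)"
          by (rule integrable_simple_function_eval[OF finite_measure_unit_interval simple, of "\<lambda>\<phi>. \<phi> z"])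
        have "cmod (s n t z - wip w (r t) z) \<le> e / 2" if t: "t \<in> {0..1}" for t
        proof -
          interpret D: abelian_group dual by (rule abelian_group_dual)
          have "(riesz (r t) \<ominus>\<^bsub>dual\<^esub> s n t) z = wip w (r t) z - s n t z"
            using z by (simp add: a_minus_dual[OF s_closed])
          moreover have "cmod ((riesz (r t) \<ominus>\<^bsub>dual\<^esub> s n t) z) \<le> nrm dual (riesz (r t) \<ominus>\<^bsub>dual\<^esub> s n t)"
            using z by (intro cmod_le_nrm_dual D.minus_closed riesz_in_dual ss s_closed)
          ultimately show ?thesis using N[OF n t] by (simp add: norm_minus_commute)
        qed
        then have "cmod (\<integral>t. s n t z - wip w (r t) z \<partial>?M) \<le> e / 2"
          by (intro integral_unit_interval_le Bochner_Integration.integrable_diff s_int int z)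
        moreover have "?D z = (\<integral>t. s n t z \<partial>?M) - (\<integral>t. wip w (r t) z \<partial>?M)"
          using z by (simp only: a_minus_dual[OF x] eval(2)[OF z(1)] restrict_apply wl2_simps if_True) (simp add: x_def)
        ultimately show "cmod (?D z) \<le> e / 2"
          using s_int int[OF z(1)] by simp
      qed
      moreover have "0 \<le> nrm dual ?D"
        using cmod_le_nrm_dual[of ?D "\<lambda>k. 0"] abelian_group.minus_closed[OF abelian_group_dual eval(1)[of "\<lambda>k. 0"] x]
        by (simp add: wnorm_def) (meson norm_ge_zero order_trans)
      ultimately show ?thesis using \<open>0 < e\<close> by simp
    qed
    then show "\<exists>no. \<forall>n\<ge>no. norm (nrm dual (simple_integral_in ?M dual (s n) \<ominus>\<^bsub>dual\<^esub> x) - 0) < e" by blast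
  qed
  show ?thesis
    unfolding has_integral_in_def x_def[symmetric]
    using strongly_measurable_curve[OF curve] x simple s_closed lim1 lim2
    by (intro conjI exI[of _ s]) auto
qed

end

section \<open>Weak derivatives\<close>

lemma integration_by_parts_unit_interval:
  fixes P P' U U' :: "real \<Rightarrow> complex"
  assumes P: "\<And>t. t \<in> {0..1} \<Longrightarrow> (P has_vector_derivative P' t) (at t within {0..1})"
    and U: "\<And>t. t \<in> {0..1} \<Longrightarrow> (U has_vector_derivative U' t) (at t within {0..1})"
    and "continuous_on {0..1} P'" "continuous_on {0..1} U'"
    and "P 0 = 0" "P 1 = 0"
  shows "(\<integral>t. P' t * U t \<partial>lebesgue_on {0..1}) = - (\<integral>t. P t * U' t \<partial>lebesgue_on {0..1})"
proof -
  have cont: "continuous_on {0..1} P" "continuous_on {0..1} U"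
    by (rule continuous_on_vector_derivative, rule P, assumption, rule continuous_on_vector_derivative, rule U)
  have int: "integrable (lebesgue_on {0..1}) (\<lambda>t. P' t * U t)"
    "integrable (lebesgue_on {0..1}) (\<lambda>t. P t * U' t)"
    by (intro continuous_imp_integrable_real continuous_intros cont assms)+
  have "((\<lambda>t. P t * U' t + P' t * U t) has_integral (P 1 * U 1 - P 0 * U 0)) {0..1}"
    by (intro fundamental_theorem_of_calculus has_vector_derivative_mult P U) simp_all
  then have "integral {0..1} (\<lambda>t. P t * U' t + P' t * U t) = 0"
    using assms by (simp add: integral_unique)
  then have "(\<integral>t. P t * U' t + P' t * U t \<partial>lebesgue_on {0..1}) = 0"
    using int by (subst lebesgue_integral_eq_integral) simp_all
  with int have "(\<integral>t. P t * U' t \<partial>lebesgue_on {0..1}) + (\<integral>t. P' t * U t \<partial>lebesgue_on {0..1}) = 0"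
    by simp
  then show ?thesis by (metis add.inverse_inverse add_eq_0_iff)
qed

lemma test_functionD:
  assumes "\<phi> \<in> test_functions T"
  shows "(\<phi> has_real_derivative deriv \<phi> t) (at t)"
    and "continuous_on UNIV (deriv \<phi>)" and "\<phi> 0 = 0" and "\<phi> T = 0"
proof -
  have "\<phi> differentiable (at t)"
    using assms by (simp add: test_functions_def differentiable_on_def)
  then show "(\<phi> has_real_derivative deriv \<phi> t) (at t)"
    by (metis DERIV_deriv_iff_real_differentiable)
qed (use assms in \<open>force simp: test_functions_def\<close>)+

context weight
begin

text \<open>
  Integrals of functionals are pointwise, so integration by parts is needed only for the scalar
  functions obtained by testing with a fixed \<open>z\<close>.
\<close>

lemma has_weak_derivative_riesz:
  assumes r: "uniform_curve (wl2 w) r" and s: "uniform_curve (wl2 w) s"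
    and deriv: "\<And>z t. square_summable w z \<Longrightarrow> t \<in> {0..1} \<Longrightarrow>
      ((\<lambda>t. wip w (r t) z) has_vector_derivative wip w (s t) z) (at t within {0..1})"
  shows "has_weak_derivative 1 dual (\<lambda>t. riesz (r t)) (\<lambda>t. riesz (s t))"
  unfolding has_weak_derivative_def
proof
  fix \<phi> assume \<phi>: "\<phi> \<in> test_functions 1"
  note \<phi>D = test_functionD[OF \<phi>]
  let ?M = "lebesgue_on {0..1::real}"
  let ?P = "\<lambda>t. complex_of_real (\<phi> t)" and ?P' = "\<lambda>t. complex_of_real (deriv \<phi> t)"
  have P: "(?P has_vector_derivative ?P' t) (at t within {0..1})" for t
    using \<phi>D(1)[of t] by (intro has_vector_derivative_of_real has_vector_derivative_at_within)
      (simp add: has_real_derivative_iff_has_vector_derivative)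
  have contP: "continuous_on {0..1} ?P"
    by (rule continuous_on_vector_derivative) (rule P)
  have contP': "continuous_on {0..1} ?P'"
    by (intro continuous_intros continuous_on_subset[OF \<phi>D(2)]) simp
  note curves = uniform_curve_scale[OF r contP'] uniform_curve_scale[OF s contP]
  note ss = uniform_curve_square_summable[OF r] uniform_curve_square_summable[OF s]
  define x where "x = (\<lambda>z\<in>carrier (wl2 w). \<integral>t. wip w (\<lambda>k. ?P' t * r t k) z \<partial>?M)"
  have int1: "has_integral_in ?M dual (\<lambda>t. ?P' t \<odot>\<^bsub>dual\<^esub> riesz (r t)) x"
    using has_integral_riesz[OF curves(1)] by (simp only: riesz_scale[OF ss(1)] x_def)
  then have x: "x \<in> carrier dual" by (simp add: has_integral_in_def)
  have "(\<lambda>z\<in>carrier (wl2 w). \<integral>t. wip w (\<lambda>k. ?P t * s t k) z \<partial>?M) = (\<lambda>z\<in>carrier (wl2 w). - x z)"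
  proof (rule restrict_ext)
    fix z assume "z \<in> carrier (wl2 w)"
    then have z: "square_summable w z" by simp
    have "(\<integral>t. ?P' t * wip w (r t) z \<partial>?M) = - (\<integral>t. ?P t * wip w (s t) z \<partial>?M)"
      using P deriv[OF z] contP' continuous_on_wip_curve[OF s z] \<phi>D(3,4)
      by (intro integration_by_parts_unit_interval) simp_all
    then show "(\<integral>t. wip w (\<lambda>k. ?P t * s t k) z \<partial>?M) = - x z"
      using z ss by (simp add: x_def wip_scale_left)
  qed
  also have "\<dots> = \<ominus>\<^bsub>dual\<^esub> x"
  proof -
    interpret D: abelian_group dual by (rule abelian_group_dual)
    have "\<zero>\<^bsub>dual\<^esub> \<ominus>\<^bsub>dual\<^esub> x = \<ominus>\<^bsub>dual\<^esub> x" using x by (simp only: a_minus_def D.l_zero D.a_inv_closed)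
    moreover have "\<zero>\<^bsub>dual\<^esub> \<ominus>\<^bsub>dual\<^esub> x = (\<lambda>z\<in>carrier (wl2 w). - x z)"
      unfolding a_minus_dual[OF x] by (rule restrict_ext) simp
    ultimately show ?thesis by simp
  qed
  finally have "has_integral_in ?M dual (\<lambda>t. ?P t \<odot>\<^bsub>dual\<^esub> riesz (s t)) (\<ominus>\<^bsub>dual\<^esub> x)"
    using has_integral_riesz[OF curves(2)] by (simp only: riesz_scale[OF ss(2)])
  with int1 x show "\<exists>x\<in>carrier dual. has_integral_in ?M dual (\<lambda>t. ?P' t \<odot>\<^bsub>dual\<^esub> riesz (r t)) x \<and>
      has_integral_in ?M dual (\<lambda>t. ?P t \<odot>\<^bsub>dual\<^esub> riesz (s t)) (\<ominus>\<^bsub>dual\<^esub> x)" by blast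
qed

text \<open>
  The \<open>k\<close>-th coordinate is continuous with constant \<open>1 / sqrt (w k)\<close> and commutes with integrals of
  simple functions; both terms of the definition of the integral then control the error.
\<close>

lemma has_integral_coordinate:
  fixes u :: "real \<Rightarrow> nat \<Rightarrow> complex"
  assumes u: "has_integral_in (lebesgue_on {0..1}) (wl2 w) u x"
    and int: "integrable (lebesgue_on {0..1}) (\<lambda>t. u t k)"
  shows "x k = (\<integral>t. u t k \<partial>lebesgue_on {0..1})"
proof -
  let ?M = "lebesgue_on {0..1::real}" and ?c = "sqrt (w k)"
  interpret A: abelian_group "wl2 w" by (rule abelian_group_wl2)
  from u obtain s where
    simple: "\<And>i. simple_function ?M (s i)" and s: "\<And>i t. t \<in> {0..1} \<Longrightarrow> square_summable w (s i t)"
    and lim1: "(\<lambda>i. \<integral>\<^sup>+ t. ennreal (nrm (wl2 w) (u t \<ominus>\<^bsub>wl2 w\<^esub> s i t)) \<partial>?M) \<longlonglongrightarrow> 0"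
    and lim2: "(\<lambda>i. nrm (wl2 w) (simple_integral_in ?M (wl2 w) (s i) \<ominus>\<^bsub>wl2 w\<^esub> x)) \<longlonglongrightarrow> 0"
    unfolding has_integral_in_def Pi_iff wl2_simps(1) space_lebesgue_on by blast
  from u have x: "square_summable w x" and u_ss: "\<And>t. t \<in> {0..1} \<Longrightarrow> square_summable w (u t)"
    by (auto simp: has_integral_in_def strongly_measurable_def)
  have eval: "square_summable w (simple_integral_in ?M (wl2 w) (s i))"
    "simple_integral_in ?M (wl2 w) (s i) k = (\<integral>t. s i t k \<partial>?M)" for i
    using simple_integral_eval[OF abelian_group_wl2 finite_measure_unit_interval simple, of i "\<lambda>x. x k"] s
    by simp_all
  have "?c * cmod ((\<integral>t. u t k \<partial>?M) - x k) \<le> 0 + e" if "0 < e" for e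
  proof -
    have "0 < ennreal (e / 2)" "0 < e / 2" using that by simp_all
    from order_tendstoD(2)[OF lim1 this(1)] order_tendstoD(2)[OF lim2 this(2)]
    have "\<forall>\<^sub>F i in sequentially.
        (\<integral>\<^sup>+ t. ennreal (nrm (wl2 w) (u t \<ominus>\<^bsub>wl2 w\<^esub> s i t)) \<partial>?M) < ennreal (e / 2) \<and>
        nrm (wl2 w) (simple_integral_in ?M (wl2 w) (s i) \<ominus>\<^bsub>wl2 w\<^esub> x) < e / 2"
      by (rule eventually_conj)
    then obtain i where
      i: "(\<integral>\<^sup>+ t. ennreal (nrm (wl2 w) (u t \<ominus>\<^bsub>wl2 w\<^esub> s i t)) \<partial>?M) < ennreal (e / 2)"
        "nrm (wl2 w) (simple_integral_in ?M (wl2 w) (s i) \<ominus>\<^bsub>wl2 w\<^esub> x) < e / 2"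
      unfolding eventually_sequentially by blast
    have s_int: "integrable ?M (\<lambda>t. s i t k)"
      by (rule integrable_simple_function_eval[OF finite_measure_unit_interval simple, of "\<lambda>x. x k"])
    have d_int: "integrable ?M (\<lambda>t. ?c * cmod (u t k - s i t k))"
      using int s_int by simp
    have "ennreal (\<integral>t. ?c * cmod (u t k - s i t k) \<partial>?M) = (\<integral>\<^sup>+t. ennreal (?c * cmod (u t k - s i t k)) \<partial>?M)"
      by (rule nn_integral_eq_integral[symmetric, OF d_int]) simp
    also have "\<dots> \<le> (\<integral>\<^sup>+ t. ennreal (nrm (wl2 w) (u t \<ominus>\<^bsub>wl2 w\<^esub> s i t)) \<partial>?M)"
    proof (intro nn_integral_mono ennreal_leI)
      fix t assume "t \<in> space ?M"
      then have t: "t \<in> {0..1}" by simp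
      show "?c * cmod (u t k - s i t k) \<le> nrm (wl2 w) (u t \<ominus>\<^bsub>wl2 w\<^esub> s i t)"
        using coordinate_le_wnorm[of "\<lambda>k. u t k - s i t k" k] s[OF t] u_ss[OF t] by (simp add: a_minus_wl2)
    qed
    also note i(1)
    finally have "(\<integral>t. ?c * cmod (u t k - s i t k) \<partial>?M) < e / 2"
      using that by (simp add: ennreal_less_iff)
    moreover have "cmod ((\<integral>t. u t k \<partial>?M) - (\<integral>t. s i t k \<partial>?M)) \<le> (\<integral>t. cmod (u t k - s i t k) \<partial>?M)"
      using integral_norm_bound[of ?M "\<lambda>t. u t k - s i t k"] int s_int by simp
    then have "?c * cmod ((\<integral>t. u t k \<partial>?M) - (\<integral>t. s i t k \<partial>?M)) \<le> (\<integral>t. ?c * cmod (u t k - s i t k) \<partial>?M)"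
      by (simp add: mult_left_mono)
    moreover have "?c * cmod (simple_integral_in ?M (wl2 w) (s i) k - x k) < e / 2"
      using coordinate_le_wnorm[of "\<lambda>k. simple_integral_in ?M (wl2 w) (s i) k - x k" k] eval(1) x i(2)
      by (simp add: a_minus_wl2)
    moreover have "?c * cmod ((\<integral>t. u t k \<partial>?M) - x k) \<le> ?c * (cmod ((\<integral>t. u t k \<partial>?M) - (\<integral>t. s i t k \<partial>?M))
        + cmod (simple_integral_in ?M (wl2 w) (s i) k - x k))"
      using norm_triangle_ineq[of "(\<integral>t. u t k \<partial>?M) - (\<integral>t. s i t k \<partial>?M)" "(\<integral>t. s i t k \<partial>?M) - x k"]
      unfolding eval(2) by (intro mult_left_mono) simp_all
    ultimately show ?thesis by (simp add: distrib_left)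
  qed
  then have "?c * cmod ((\<integral>t. u t k \<partial>?M) - x k) \<le> 0" by (rule field_le_epsilon)
  then show ?thesis using weight_pos[of k] by (simp add: mult_le_0_iff)
qed

text \<open>
  Strong measurability gives convergence of simple functions only almost everywhere. The
  pointwise \<open>lim\<close> of the coordinates is a measurable function that agrees with the coordinate of \<open>u\<close>
  almost everywhere, and completeness of Lebesgue measure does the rest.
\<close>

lemma borel_measurable_coordinate:
  fixes u :: "real \<Rightarrow> nat \<Rightarrow> complex"
  assumes u: "strongly_measurable (lebesgue_on {0..1}) (wl2 w) u"
  shows "(\<lambda>t. u t k) \<in> borel_measurable (lebesgue_on {0..1})"
proof -
  let ?M = "lebesgue_on {0..1::real}"
  from u obtain s where simple: "\<And>i. simple_function ?M (s i)"
    and s: "\<And>i t. t \<in> {0..1} \<Longrightarrow> square_summable w (s i t)"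
    and lim: "AE t in ?M. (\<lambda>i. nrm (wl2 w) (u t \<ominus>\<^bsub>wl2 w\<^esub> s i t)) \<longlonglongrightarrow> 0"
    and u_ss: "\<And>t. t \<in> {0..1} \<Longrightarrow> square_summable w (u t)"
    unfolding strongly_measurable_def Pi_iff wl2_simps(1) space_lebesgue_on by blast
  have s_meas: "(\<lambda>t. s i t k) \<in> borel_measurable ?M" for i
    using measurable_compose[OF measurable_simple_function[OF simple], of "\<lambda>x. x k" borel] by simp
  let ?s = "\<lambda>i t. if t \<in> {0..1} then s i t k else 0"
  have "?s i \<in> borel_measurable lebesgue" for i
    by (rule borel_measurable_if_I[OF s_meas]) simp
  then have "(\<lambda>t. lim (\<lambda>i. ?s i t)) \<in> borel_measurable lebesgue"
    by (rule borel_measurable_lim_metric)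
  moreover have "AE t in lebesgue. lim (\<lambda>i. ?s i t) = (if t \<in> {0..1} then u t k else 0)"
  proof -
    have "(\<lambda>i. s i t k) \<longlonglongrightarrow> u t k" if t: "t \<in> {0..1}"
      and l: "(\<lambda>i. nrm (wl2 w) (u t \<ominus>\<^bsub>wl2 w\<^esub> s i t)) \<longlonglongrightarrow> 0" for t
    proof -
      have "cmod (s i t k - u t k) \<le> nrm (wl2 w) (u t \<ominus>\<^bsub>wl2 w\<^esub> s i t) / sqrt (w k)" for i
        using coordinate_le_wnorm[of "\<lambda>k. u t k - s i t k" k] s[OF t] u_ss[OF t] weight_pos[of k]
        by (simp add: a_minus_wl2 pos_le_divide_eq mult.commute norm_minus_commute)
      moreover have "(\<lambda>i. nrm (wl2 w) (u t \<ominus>\<^bsub>wl2 w\<^esub> s i t) / sqrt (w k)) \<longlonglongrightarrow> 0"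
        using tendsto_divide[OF l tendsto_const, of "sqrt (w k)"] weight_pos[of k] by simp
      ultimately have "(\<lambda>i. s i t k - u t k) \<longlonglongrightarrow> 0"
        by (rule Lim_null_comparison[OF always_eventually[OF allI]])
      then show ?thesis by (simp add: LIM_zero_iff)
    qed
    moreover from lim have "AE t in lebesgue. t \<in> {0..1} \<longrightarrow> (\<lambda>i. nrm (wl2 w) (u t \<ominus>\<^bsub>wl2 w\<^esub> s i t)) \<longlonglongrightarrow> 0"
      by (subst (asm) AE_restrict_space_iff) simp_all
    ultimately show ?thesis
      by (auto elim!: eventually_mono simp: limI)
  qed
  ultimately have "(\<lambda>t. if t \<in> {0..1} then u t k else 0) \<in> borel_measurable lebesgue"
    by (rule borel_measurable_AE)
  then show ?thesis by (rule borel_measurable_if_D)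
qed

text \<open>
  The second part is Bessel's inequality integrated over time, weakened to \<open>L\<^sup>1\<close> norms of the
  coordinates, which are easier to bound from below by testing.
\<close>

lemma L2_coordinates:
  assumes u: "u \<in> L2 1 (wl2 w)"
  shows "integrable (lebesgue_on {0..1}) (\<lambda>t. u t k)"
    and "\<exists>C. \<forall>N. (\<Sum>k<N. w k * (\<integral>t. cmod (u t k) \<partial>lebesgue_on {0..1})\<^sup>2) \<le> C"
proof -
  let ?M = "lebesgue_on {0..1::real}"
  interpret finite_measure ?M by (rule finite_measure_unit_interval)
  from u have sm: "strongly_measurable ?M (wl2 w) u"
    and fin: "(\<integral>\<^sup>+ t. ennreal ((wnorm w (u t))\<^sup>2) \<partial>?M) < \<infinity>"
    unfolding L2_def by auto
  then have ss: "\<And>t. t \<in> {0..1} \<Longrightarrow> square_summable w (u t)"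
    by (auto simp: strongly_measurable_def)
  have meas[measurable]: "(\<lambda>t. u t k) \<in> borel_measurable ?M" for k
    by (rule borel_measurable_coordinate[OF sm])
  have sum_le: "(\<integral>\<^sup>+ t. ennreal (\<Sum>k\<in>A. w k * (cmod (u t k))\<^sup>2) \<partial>?M)
      \<le> (\<integral>\<^sup>+ t. ennreal ((wnorm w (u t))\<^sup>2) \<partial>?M)" if "finite A" for A
  proof (intro nn_integral_mono ennreal_leI)
    fix t assume "t \<in> space ?M"
    then show "(\<Sum>k\<in>A. w k * (cmod (u t k))\<^sup>2) \<le> (wnorm w (u t))\<^sup>2"
      using sum_le_wnorm[OF ss that, of t] by simp
  qed
  have int2: "integrable ?M (\<lambda>t. w k * (cmod (u t k))\<^sup>2)" for k
  proof (rule integrableI_bounded)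
    show "(\<integral>\<^sup>+ t. ennreal (norm (w k * (cmod (u t k))\<^sup>2)) \<partial>?M) < \<infinity>"
      using le_less_trans[OF sum_le[of "{k}"] fin] by simp
  qed measurable
  have int2': "integrable ?M (\<lambda>t. (cmod (u t k))\<^sup>2)" for k
    using int2[of k] weight_pos[of k] by simp
  have int1: "integrable ?M (\<lambda>t. u t k)" for k
  proof (rule Bochner_Integration.integrable_bound)
    show "integrable ?M (\<lambda>t. 1 + (cmod (u t k))\<^sup>2)"
      using int2' by (intro Bochner_Integration.integrable_add) simp_all
    have "cmod z \<le> 1 + (cmod z)\<^sup>2" for z
    proof -
      have "cmod z \<le> 2 * 1 * cmod z" by simp
      also have "\<dots> \<le> 1\<^sup>2 + (cmod z)\<^sup>2" by (rule sum_squares_bound)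
      finally show ?thesis by simp
    qed
    then show "AE t in ?M. cmod (u t k) \<le> norm (1 + (cmod (u t k))\<^sup>2)"
      by (intro AE_I2) (simp add: add_nonneg_nonneg)
  qed measurable
  then show "integrable ?M (\<lambda>t. u t k)" .
  \<comment> \<open>Integrating \<open>2 a |u| \<le> a\<^sup>2 + |u|\<^sup>2\<close> with \<open>a = \<integral> |u|\<close> gives the Cauchy-Schwarz inequality.\<close>
  have cs: "(\<integral>t. cmod (u t k) \<partial>?M)\<^sup>2 \<le> (\<integral>t. (cmod (u t k))\<^sup>2 \<partial>?M)" for k
  proof -
    define a where "a = (\<integral>t. cmod (u t k) \<partial>?M)"
    have "(\<integral>t. 2 * a * cmod (u t k) \<partial>?M) \<le> (\<integral>t. a\<^sup>2 + (cmod (u t k))\<^sup>2 \<partial>?M)"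
      using int1[of k] int2'[of k]
      by (intro Bochner_Integration.integral_mono) (auto simp: sum_squares_bound)
    also have "\<dots> = a\<^sup>2 + (\<integral>t. (cmod (u t k))\<^sup>2 \<partial>?M)"
      using int2'[of k] by (subst Bochner_Integration.integral_add) simp_all
    finally show ?thesis by (simp add: a_def[symmetric] power2_eq_square)
  qed
  have "(\<Sum>k<N. w k * (\<integral>t. cmod (u t k) \<partial>?M)\<^sup>2) \<le> enn2real (\<integral>\<^sup>+ t. ennreal ((wnorm w (u t))\<^sup>2) \<partial>?M)" for N
  proof -
    have "(\<Sum>k<N. w k * (\<integral>t. cmod (u t k) \<partial>?M)\<^sup>2) \<le> (\<Sum>k<N. \<integral>t. w k * (cmod (u t k))\<^sup>2 \<partial>?M)"
      using cs by (intro sum_mono) (simp add: mult_left_mono)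
    also have "\<dots> = (\<integral>t. (\<Sum>k<N. w k * (cmod (u t k))\<^sup>2) \<partial>?M)"
      by (rule Bochner_Integration.integral_sum[symmetric]) (rule int2)
    also have "\<dots> = enn2real (\<integral>\<^sup>+ t. ennreal (\<Sum>k<N. w k * (cmod (u t k))\<^sup>2) \<partial>?M)"
    proof (rule integral_eq_nn_integral)
      show "AE t in ?M. 0 \<le> (\<Sum>k<N. w k * (cmod (u t k))\<^sup>2)" by (intro AE_I2 sum_nonneg) simp
    qed measurable
    also have "\<dots> \<le> enn2real (\<integral>\<^sup>+ t. ennreal ((wnorm w (u t))\<^sup>2) \<partial>?M)"
      using sum_le fin by (intro enn2real_mono) simp_all
    finally show ?thesis .
  qed
  then show "\<exists>C. \<forall>N. (\<Sum>k<N. w k * (\<integral>t. cmod (u t k) \<partial>?M)\<^sup>2) \<le> C" by blast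
qed

end

section \<open>A lacunary oscillation\<close>

definition freq :: "nat \<Rightarrow> real" where "freq k = 4 ^ k"

definition amp :: "nat \<Rightarrow> real" where "amp k = 1 / (8 * freq k * sqrt (real k))"

text \<open>
  Coordinate \<open>k\<close> oscillates with the frequency \<open>freq k\<close>, which is also its weight in \<open>V\<close>. The
  coefficients satisfy \<open>freq k * amp k = 1 / (8 * sqrt k)\<close>: the formal time derivative of the
  oscillation has coordinates of this size, and they barely fail to be square summable, while their
  \<open>q\<close>-th powers are summable for every \<open>q > 2\<close>. The factor \<open>8\<close> makes the oscillation small enough
  for coercivity, and \<open>amp 0 = 0\<close> by the convention for division by zero, which leaves coordinate
  \<open>0\<close> free.
\<close>

definition osc :: "real \<Rightarrow> nat \<Rightarrow> complex" where
  "osc t k = complex_of_real (amp k) * cis (freq k * t)"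

text \<open>
  The square of the distance in \<open>V\<close> between the oscillation at times \<open>t\<close> and \<open>t + h\<close>. A time shift
  multiplies each coordinate by a number of modulus \<open>1\<close>, so the distance does not depend on \<open>t\<close>.
\<close>

definition modulus :: "real \<Rightarrow> real" where
  "modulus h = (\<Sum>k. freq k * (amp k)\<^sup>2 * (cmod (cis (freq k * h) - 1))\<^sup>2)"

lemma freq_pos [simp]: "0 < freq k" and freq_ge_1 [simp]: "1 \<le> freq k"
  by (simp_all add: freq_def)

lemma weight_freq: "weight freq"
  by unfold_locales simp

lemma weight_one: "weight (\<lambda>_. 1)"
  by unfold_locales simp

interpretation V: weight freq by (rule weight_freq)
interpretation H: weight "\<lambda>_. 1" by (rule weight_one)

lemma amp_0 [simp]: "amp 0 = 0"
  by (simp add: amp_def)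

lemma freq_amp_power2: "freq k * (amp k)\<^sup>2 = (1 / 4) ^ k / (64 * real k)"
  by (simp add: amp_def freq_def power_mult_distrib power_divide power2_eq_square field_simps)

lemma freq_amp_le: "freq k * (amp k)\<^sup>2 \<le> (1 / 4) ^ k / 64"
  unfolding freq_amp_power2 by (cases "k = 0") (auto simp: field_simps)

lemma summable_freq_amp: "summable (\<lambda>k. freq k * (amp k)\<^sup>2)"
proof (rule summable_comparison_test')
  show "summable (\<lambda>k. (1 / 4) ^ k / 64 :: real)" by (intro summable_divide summable_geometric) simp
  show "norm (freq k * (amp k)\<^sup>2) \<le> (1 / 4) ^ k / 64" for k
    using freq_amp_le[of k] by (simp add: less_imp_le)
qed

lemma cmod_osc [simp]: "cmod (osc t k) = \<bar>amp k\<bar>"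
  by (simp add: osc_def norm_mult)

lemma osc_0 [simp]: "osc t 0 = 0"
  by (simp add: osc_def)

lemma square_summable_osc [simp]: "square_summable freq (osc t)"
  using summable_freq_amp by (simp add: square_summable_def)

definition osc_norm2 :: real where "osc_norm2 = (\<Sum>k. freq k * (amp k)\<^sup>2)"

lemma wnorm_osc_power2: "(wnorm freq (osc t))\<^sup>2 = osc_norm2"
  by (simp add: V.wnorm_power2 osc_norm2_def)

lemma wnorm_osc_le: "wnorm freq (osc t) \<le> 1 / 6"
proof (rule power2_le_imp_le)
  have "osc_norm2 \<le> (\<Sum>k. (1 / 4) ^ k / 64)"
    unfolding osc_norm2_def
    by (intro suminf_le freq_amp_le summable_freq_amp summable_divide summable_geometric) simp
  also have "\<dots> = 1 / 48"
    by (subst suminf_divide) (simp_all add: summable_geometric suminf_geometric)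
  finally show "(wnorm freq (osc t))\<^sup>2 \<le> (1 / 6)\<^sup>2"
    unfolding wnorm_osc_power2 by (simp add: power2_eq_square)
qed simp

lemma osc_diff: "cmod (osc (t + h) k - osc t k) = \<bar>amp k\<bar> * cmod (cis (freq k * h) - 1)"
proof -
  have "osc (t + h) k - osc t k = complex_of_real (amp k) * (cis (freq k * t) * (cis (freq k * h) - 1))"
    by (simp add: osc_def distrib_left right_diff_distrib flip: cis_mult)
  then show ?thesis by (simp add: norm_mult)
qed

lemma wnorm_osc_diff: "(wnorm freq (\<lambda>k. osc (t + h) k - osc t k))\<^sup>2 = modulus h"
  by (simp add: V.wnorm_power2 osc_diff modulus_def power_mult_distrib mult.assoc)

lemma wnorm_osc_diff_eq_sqrt: "wnorm freq (\<lambda>k. osc (t + h) k - osc t k) = sqrt (modulus h)"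
  unfolding wnorm_osc_diff[symmetric, of _ t] by simp

lemma modulus_nonneg [simp]: "0 \<le> modulus h"
  unfolding wnorm_osc_diff[symmetric, of _ 0] by simp

lemma cmod_cis_minus_1: "cmod (cis x - 1) = 2 * \<bar>sin (x / 2)\<bar>"
  unfolding cis_conv_exp by (rule dist_exp_i_1)

lemma modulus_minus [simp]: "modulus (- h) = modulus h"
  by (simp add: modulus_def cmod_cis_minus_1)

lemma borel_measurable_modulus [measurable]: "modulus \<in> borel_measurable borel"
  unfolding modulus_def cmod_cis_minus_1 by measurable

lemma dyadic_scale:
  fixes h :: real
  assumes "0 < h" "h \<le> 1"
  shows "\<exists>n. (1 / 4) ^ Suc n < h \<and> h \<le> (1 / 4) ^ n"
proof -
  obtain N where N: "(1 / 4) ^ N < h" using real_arch_pow_inv[of h "1 / 4"] assms by auto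
  define m where "m = (LEAST N. (1 / 4) ^ N < h)"
  have m: "(1 / 4) ^ m < h" unfolding m_def using N by (rule LeastI)
  then have "m \<noteq> 0" using assms by (intro notI) simp
  then obtain n where n: "m = Suc n" by (cases m) auto
  then have "\<not> (1 / 4) ^ n < h" using not_less_Least[of n "\<lambda>N. (1 / 4) ^ N < h"] by (simp add: m_def)
  with m n show ?thesis by auto
qed

lemma geometric_distance_sums:
  fixes n :: nat
  shows "summable (\<lambda>k. if k \<le> n then (1 / 2) ^ (n - k) else (1 / 2) ^ (k - n) :: real)" (is "summable ?b")
    and "(\<Sum>k. if k \<le> n then (1 / 2) ^ (n - k) else (1 / 2) ^ (k - n) :: real) \<le> 4"
proof -
  have shift: "?b (k + Suc n) = (1 / 2) * (1 / 2) ^ k" for k by simp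
  have "summable (\<lambda>k. ?b (k + Suc n))"
    unfolding shift by (intro summable_mult summable_geometric) simp
  then show sum: "summable ?b" by (subst (asm) summable_iff_shift)
  have "(\<Sum>k<Suc n. ?b k) = (\<Sum>k<Suc n. (1 / 2) ^ (n - k))"
    by (rule sum.cong) auto
  also have "\<dots> = (\<Sum>k<Suc n. (1 / 2) ^ k)"
    using sum.nat_diff_reindex[of "\<lambda>k. (1 / 2) ^ k :: real" "Suc n"] by simp
  also have "\<dots> \<le> (\<Sum>k. (1 / 2) ^ k :: real)"
    by (intro sum_le_suminf summable_geometric) auto
  also have "\<dots> = 2" by (simp add: suminf_geometric)
  finally have "(\<Sum>k<Suc n. ?b k) \<le> 2" .
  moreover have "(\<Sum>k. ?b (k + Suc n)) = 1"
    unfolding shift by (subst suminf_mult) (simp_all add: summable_geometric suminf_geometric)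
  moreover have "suminf ?b = (\<Sum>k. ?b (k + Suc n)) + (\<Sum>k<Suc n. ?b k)"
    by (rule suminf_split_initial_segment[OF sum])
  ultimately show "suminf ?b \<le> 4" by linarith
qed

text \<open>
  At the scale \<open>h\<close> of about \<open>4 ^ (-n)\<close> the term with index \<open>k\<close> is estimated by \<open>|e\<^sup>i\<^sup>x - 1| \<le> |x|\<close> if
  \<open>k \<le> n\<close> and by \<open>|e\<^sup>i\<^sup>x - 1| \<le> 2\<close> if \<open>k > n\<close>. Either way it is at most a constant times
  \<open>(h / k) * 4 ^ (-|k - n|)\<close>. A factor \<open>2 ^ (-|k - n|)\<close> of this decay is spent on
  replacing \<open>1 / k\<close> by \<open>1 / (n + 1)\<close>; the other one makes the sum over \<open>k\<close> converge.
\<close>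

lemma modulus_term_le:
  assumes h: "(1 / 4) ^ Suc n < h" "h \<le> (1 / 4) ^ n"
  shows "freq k * (amp k)\<^sup>2 * (cmod (cis (freq k * h) - 1))\<^sup>2
    \<le> (if k \<le> n then (1 / 2) ^ (n - k) else (1 / 2) ^ (k - n)) * (h / (2 * real (Suc n)))"
proof (cases "k = 0")
  case True
  have "0 < h" using h(1) by (rule less_trans[rotated]) simp
  with True show ?thesis by simp
next
  case False
  then have k: "1 \<le> real k" by simp
  have h0: "0 < h" using h(1) by (rule less_trans[rotated]) simp
  have four: "(1 / 4 :: real) ^ d = (1 / 2) ^ d * (1 / 2) ^ d" for d
    by (simp flip: power_mult_distrib)
  show ?thesis
  proof (cases "k \<le> n")
    case True
    define d where "d = n - k"
    then have n: "n = k + d" using True by simp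
    have "cmod (cis (freq k * h) - 1) \<le> freq k * h"
      using abs_sin_x_le_abs_x[of "freq k * h / 2"] h0 by (simp add: cmod_cis_minus_1 abs_mult)
    then have "(cmod (cis (freq k * h) - 1))\<^sup>2 \<le> (freq k * h)\<^sup>2" by (intro power_mono) auto
    then have "freq k * (amp k)\<^sup>2 * (cmod (cis (freq k * h) - 1))\<^sup>2 \<le> freq k * (amp k)\<^sup>2 * (freq k * h)\<^sup>2"
      by (intro mult_left_mono) (auto simp: less_imp_le)
    also have "\<dots> = ((1 / 4) ^ k / (64 * real k)) * (4 ^ k * h * (4 ^ k * h))"
      by (simp only: freq_amp_power2) (simp only: freq_def power2_eq_square)
    also have "\<dots> = ((1 / 4) ^ k * 4 ^ k) * (4 ^ k * h * h / (64 * real k))"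
      by (simp only: times_divide_eq_left times_divide_eq_right mult_ac)
    also have "\<dots> = 4 ^ k * h * h / (64 * real k)"
      by (simp flip: power_mult_distrib)
    also have "\<dots> \<le> 4 ^ k * (1 / 4) ^ n * h / (64 * real k)"
      using h h0 by (intro divide_right_mono mult_right_mono mult_left_mono) auto
    also have "\<dots> = (1 / 4) ^ d * h / (64 * real k)"
      by (simp add: n power_add field_simps flip: power_mult_distrib)
    also have "\<dots> \<le> (1 / 2) ^ d * (h / (2 * real (Suc n)))"
    proof -
      have "real (Suc n) \<le> real k * (2 * 2 ^ d)"
      proof -
        have "real d + 1 \<le> 2 ^ d" using less_exp[of d] by (metis Suc_leI add.commute of_nat_Suc of_nat_le_iff of_nat_numeral of_nat_power)
        then have "real k * (2 + real d) \<le> real k * (2 * 2 ^ d)" using k by (intro mult_left_mono) auto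
        moreover have "real k + (1 + real d) \<le> real k + real k * (1 + real d)"
          using mult_right_mono[OF k, of "1 + real d"] by simp
        ultimately show ?thesis by (simp add: n algebra_simps)
      qed
      then have "(1 / 2) ^ d * real (Suc n) \<le> 2 * real k" by (simp add: power_divide field_simps)
      then have "(1 / 2) ^ d / (64 * real k) \<le> 1 / (2 * real (Suc n))"
        using k by (simp add: field_simps)
      then have "(1 / 2) ^ d * h * ((1 / 2) ^ d / (64 * real k)) \<le> (1 / 2) ^ d * h * (1 / (2 * real (Suc n)))"
        using h0 by (intro mult_left_mono) auto
      then show ?thesis unfolding four by (simp add: mult_ac)
    qed
    finally show ?thesis using True by (simp add: d_def)
  next
    case False
    define d where "d = k - n"
    then have kd: "k = n + d" using False by simp
    have "cmod (cis (freq k * h) - 1) \<le> 2" by (simp add: cmod_cis_minus_1)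
    then have "(cmod (cis (freq k * h) - 1))\<^sup>2 \<le> 2\<^sup>2" by (intro power_mono) auto
    then have "freq k * (amp k)\<^sup>2 * (cmod (cis (freq k * h) - 1))\<^sup>2 \<le> freq k * (amp k)\<^sup>2 * 2\<^sup>2"
      by (intro mult_left_mono) (auto simp: less_imp_le)
    also have "\<dots> = (1 / 4) ^ d * (1 / 4) ^ Suc n * (1 / (4 * real k))"
    proof -
      have "(1 / 4 :: real) ^ k = (1 / 4) ^ d * (1 / 4) ^ n" by (simp add: kd power_add)
      then show ?thesis unfolding freq_amp_power2 by simp
    qed
    also have "\<dots> \<le> (1 / 2) ^ d * h * (1 / (2 * real (Suc n)))"
    proof (intro mult_mono)
      show "(1 / 4 :: real) ^ d \<le> (1 / 2) ^ d" by (intro power_mono) auto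
      show "(1 / 4) ^ Suc n \<le> h" using h by simp
      show "1 / (4 * real k) \<le> 1 / (2 * real (Suc n))"
        using False by (simp add: field_simps)
    qed (use h0 in auto)
    finally show ?thesis using False by (simp add: d_def)
  qed
qed

text \<open>
  Lacunarity: by the geometric decay away from \<open>k = n\<close>, the sum over all \<open>k\<close> is, up to a constant, as
  small as the single term \<open>k = n\<close>. The gain of \<open>1 / (n + 1)\<close>, which is about \<open>1 / log (1 / h)\<close>, over plain
  Hoelder continuity of exponent \<open>1 / 2\<close> is what the Besov norm detects.
\<close>

lemma modulus_le:
  assumes h: "(1 / 4) ^ Suc n < h" "h \<le> (1 / 4) ^ n"
  shows "modulus h \<le> 2 * h / real (Suc n)"
proof -
  let ?c = "h / (2 * real (Suc n))"
  have "0 < h" using h(1) by (rule less_trans[rotated]) simp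
  have "summable (\<lambda>k. freq k * (amp k)\<^sup>2 * (cmod (cis (freq k * h) - 1))\<^sup>2)"
    using V.square_summable_diff[OF square_summable_osc square_summable_osc, of "0 + h" 0]
    by (simp only: square_summable_def osc_diff power_mult_distrib power2_abs mult.assoc)
  then have "modulus h \<le> (\<Sum>k. (if k \<le> n then (1 / 2) ^ (n - k) else (1 / 2) ^ (k - n)) * ?c)"
    unfolding modulus_def
    by (intro suminf_le modulus_term_le[OF h] summable_mult2 geometric_distance_sums)
  also have "\<dots> \<le> 4 * ?c"
    unfolding suminf_mult2[OF geometric_distance_sums(1), symmetric]
    using \<open>0 < h\<close> by (intro mult_right_mono geometric_distance_sums) auto
  also have "\<dots> = 2 * h / real (Suc n)" by (simp only: times_divide_eq_right mult_2 times_divide_eq_left) (simp add: field_simps)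
  finally show ?thesis .
qed

lemma modulus_le_2:
  assumes "\<bar>h\<bar> \<le> 1"
  shows "modulus h \<le> 2 * \<bar>h\<bar>"
proof (cases "h = 0")
  case True
  then show ?thesis by (simp add: modulus_def)
next
  case False
  then obtain n where n: "(1 / 4) ^ Suc n < \<bar>h\<bar>" "\<bar>h\<bar> \<le> (1 / 4) ^ n"
    using dyadic_scale[of "\<bar>h\<bar>"] assms by auto
  have "modulus h = modulus \<bar>h\<bar>" by (cases "0 \<le> h") auto
  also have "\<dots> \<le> 2 * \<bar>h\<bar> / real (Suc n)" by (rule modulus_le[OF n])
  also have "\<dots> \<le> 2 * \<bar>h\<bar>" by (rule divide_left_mono[of 1, simplified]) auto
  finally show ?thesis .
qed

lemma uniform_curve_osc: "uniform_curve (wl2 freq) osc"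
  unfolding V.uniform_curve_wl2_iff
proof (intro conjI allI impI)
  fix e :: real assume "0 < e"
  have "wnorm freq (\<lambda>k. osc t k - osc s k) < e"
    if st: "s \<in> {0..1}" "t \<in> {0..1}" "\<bar>s - t\<bar> < e\<^sup>2 / 2" for s t
  proof -
    have "modulus (t - s) \<le> 2 * \<bar>t - s\<bar>" using st by (intro modulus_le_2) auto
    also have "\<dots> < e\<^sup>2" using st by (simp add: abs_minus_commute)
    finally have "sqrt (modulus (t - s)) < e" using \<open>0 < e\<close> by (simp add: real_less_lsqrt)
    then show ?thesis using wnorm_osc_diff_eq_sqrt[of s "t - s"] by simp
  qed
  then show "\<exists>d>0. \<forall>s\<in>{0..1}. \<forall>t\<in>{0..1}. \<bar>s - t\<bar> < d \<longrightarrow> wnorm freq (\<lambda>k. osc t k - osc s k) < e"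
    using \<open>0 < e\<close> by (intro exI[of _ "e\<^sup>2 / 2"]) simp
qed simp

lemma has_vector_derivative_series:
  fixes f f' :: "nat \<Rightarrow> real \<Rightarrow> 'b::banach"
  assumes deriv: "\<And>n x. (f n has_vector_derivative f' n x) (at x)"
    and bound: "\<And>n x. norm (f' n x) \<le> M n" and M: "summable M"
    and sum: "\<And>x. summable (\<lambda>n. f n x)"
  shows "((\<lambda>x. \<Sum>n. f n x) has_vector_derivative (\<Sum>n. f' n x)) (at x)"
proof -
  have lim: "uniform_limit UNIV (\<lambda>n x. \<Sum>i<n. f' i x) (\<lambda>x. \<Sum>i. f' i x) sequentially"
    by (rule Weierstrass_m_test[OF bound M])
  have "\<exists>g. \<forall>x\<in>UNIV. (\<lambda>n. f n x) sums g x \<and> (g has_derivative (\<lambda>h. h *\<^sub>R (\<Sum>n. f' n x))) (at x)"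
  proof (rule has_derivative_series)
    show "(f n has_derivative (\<lambda>h. h *\<^sub>R f' n x)) (at x)" for n x
      using deriv by (simp add: has_vector_derivative_def)
    show "(\<lambda>n. f n 0) sums (\<Sum>n. f n 0)" using sum by (rule summable_sums)
    fix e :: real assume "0 < e"
    from uniform_limitD[OF lim this]
    show "\<forall>\<^sub>F n in sequentially. \<forall>x\<in>UNIV. \<forall>h. norm ((\<Sum>i<n. h *\<^sub>R f' i x) - h *\<^sub>R (\<Sum>n. f' n x)) \<le> e * norm h"
    proof eventually_elim
      case (elim n)
      show ?case
      proof (intro ballI allI)
        fix x h
        have "norm ((\<Sum>i<n. h *\<^sub>R f' i x) - h *\<^sub>R (\<Sum>n. f' n x)) = \<bar>h\<bar> * norm ((\<Sum>i<n. f' i x) - (\<Sum>n. f' n x))"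
          by (simp flip: scaleR_sum_right scaleR_diff_right)
        also have "\<dots> \<le> \<bar>h\<bar> * e"
          using elim by (intro mult_left_mono) (auto simp: dist_norm less_imp_le)
        finally show "norm ((\<Sum>i<n. h *\<^sub>R f' i x) - h *\<^sub>R (\<Sum>n. f' n x)) \<le> e * norm h"
          by (simp add: mult.commute)
      qed
    qed
  qed simp_all
  then obtain g where g: "\<And>x. (\<lambda>n. f n x) sums g x" "(g has_derivative (\<lambda>h. h *\<^sub>R (\<Sum>n. f' n x))) (at x)"
    by auto
  have "g = (\<lambda>x. \<Sum>n. f n x)" using g(1) by (auto simp: sums_iff)
  with g(2) show ?thesis by (simp add: has_vector_derivative_def)
qed

text \<open>
  Since frequency and weight coincide, differentiation in time replaces the inner product of \<open>H\<close> by
  \<open>\<i>\<close> times that of \<open>V\<close>; the differentiated series converges absolutely for \<open>z\<close> in \<open>V\<close>.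
\<close>

lemma has_vector_derivative_wip_osc:
  assumes z: "square_summable freq z"
  shows "((\<lambda>t. wip (\<lambda>_. 1) (osc t) z) has_vector_derivative \<i> * wip freq (osc t) z) (at t)"
proof -
  define f where "f k t = osc t k * cnj (z k)" for k t
  define f' where "f' k t = \<i> * (complex_of_real (freq k) * osc t k * cnj (z k))" for k t
  have deriv: "(f k has_vector_derivative f' k t) (at t)" for k t
  proof -
    have "((\<lambda>t. cis (freq k * t)) has_vector_derivative (\<i> * complex_of_real (freq k) * cis (freq k * t))) (at t)"
      unfolding cis_conv_exp of_real_mult
      by (rule has_vector_derivative_real_field[of "\<lambda>s. exp (\<i> * (complex_of_real (freq k) * s))"])
        (auto intro!: derivative_eq_intros)
    from has_vector_derivative_mult_right[OF has_vector_derivative_mult_left[OF this, of "cnj (z k)"], of "complex_of_real (amp k)"]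
    show ?thesis by (simp add: f_def[abs_def] f'_def osc_def mult_ac)
  qed
  have bound: "norm (f' k t) \<le> cmod (complex_of_real (freq k) * osc 0 k * cnj (z k))" for k t
    by (simp add: f'_def norm_mult)
  have sum: "summable (\<lambda>k. f k t)" for t
  proof (rule summable_comparison_test'[OF V.summable_wip_norm[OF square_summable_osc z]])
    show "norm (f k t) \<le> cmod (complex_of_real (freq k) * osc t k * cnj (z k))" for k
      using mult_right_mono[OF freq_ge_1[of k], of "\<bar>amp k\<bar> * cmod (z k)"]
      by (simp add: f_def norm_mult less_imp_le mult.assoc)
  qed
  have "((\<lambda>t. \<Sum>k. f k t) has_vector_derivative (\<Sum>k. f' k t)) (at t)"
    by (rule has_vector_derivative_series[OF deriv bound V.summable_wip_norm[OF square_summable_osc z] sum])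
  moreover have "(\<Sum>k. f' k t) = \<i> * wip freq (osc t) z"
    unfolding f'_def wip_def by (rule suminf_mult[OF V.summable_wip[OF square_summable_osc z]])
  ultimately show ?thesis by (simp add: f_def wip_def)
qed

section \<open>The form\<close>

definition unit0 :: "nat \<Rightarrow> complex" where "unit0 k = (if k = 0 then 1 else 0)"

text \<open>
  For \<open>u t = t * (unit0 + osc t)\<close> the derivative of the oscillation contributes \<open>\<i> t (osc t | z)\<close> and
  the inner product contributes \<open>t (osc t | z)\<close>, both in \<open>V\<close>. Neither is controlled in \<open>H\<close>, and the
  factor \<open>- (1 + \<i>)\<close> cancels their sum.
\<close>

definition gam :: complex where "gam = - (1 + \<i>)"

text \<open>
  The inner product of \<open>V\<close> plus a coupling of coordinate \<open>0\<close> with the oscillation. The last summand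
  is the adjoint of the coupling and makes the form symmetric.
\<close>

definition form :: "real \<Rightarrow> (nat \<Rightarrow> complex) \<Rightarrow> (nat \<Rightarrow> complex) \<Rightarrow> complex" where
  "form t v z = wip freq v z + gam * v 0 * wip freq (osc t) z + cnj gam * cnj (z 0) * wip freq v (osc t)"

lemma square_summable_unit0 [simp]: "square_summable w unit0"
  unfolding square_summable_def by (rule summable_finite[of "{0}"]) (auto simp: unit0_def)

lemma wip_unit0_left [simp]: "wip w unit0 z = complex_of_real (w 0) * cnj (z 0)"
  unfolding wip_def by (subst suminf_finite[of "{0}"]) (auto simp: unit0_def)

lemma wip_unit0_right [simp]: "wip w v unit0 = complex_of_real (w 0) * v 0"
  unfolding wip_def by (subst suminf_finite[of "{0}"]) (auto simp: unit0_def)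

lemma wnorm_unit0 [simp]: "wnorm freq unit0 = 1"
  unfolding wnorm_def by (subst suminf_finite[of "{0}"]) (auto simp: unit0_def freq_def)

lemma freq_0 [simp]: "freq 0 = 1"
  by (simp add: freq_def)

lemma cmod_gam: "cmod gam = sqrt 2"
  by (simp add: gam_def norm_complex_def)

lemma cmod_gam_le: "cmod gam \<le> 3 / 2"
  unfolding cmod_gam by (rule real_le_lsqrt) (simp_all add: power2_eq_square)

lemma first_coordinate_le: "square_summable freq v \<Longrightarrow> cmod (v 0) \<le> wnorm freq v"
  using V.coordinate_le_wnorm[of v 0] by simp

text \<open>
  Each of the two coupling terms costs at most a quarter of the square of the norm, which leaves half
  of it for coercivity.
\<close>

lemma coupling_le:
  assumes v: "square_summable freq v" and z: "square_summable freq z"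
  shows "cmod (gam * v 0 * wip freq (osc t) z) \<le> wnorm freq v * wnorm freq z / 4"
proof -
  have "cmod (wip freq (osc t) z) \<le> wnorm freq (osc t) * wnorm freq z"
    by (rule V.cauchy_schwarz[OF square_summable_osc z])
  also have "\<dots> \<le> 1 / 6 * wnorm freq z"
    using z by (intro mult_right_mono wnorm_osc_le) simp
  finally have "cmod gam * cmod (v 0) * cmod (wip freq (osc t) z) \<le> 3 / 2 * wnorm freq v * (1 / 6 * wnorm freq z)"
    using v z by (intro mult_mono first_coordinate_le cmod_gam_le) auto
  then show ?thesis by (simp add: norm_mult)
qed

lemma form_symmetric:
  assumes "square_summable freq v" "square_summable freq z"
  shows "form t z v = cnj (form t v z)"
  using assms V.wip_commute[of v z] V.wip_commute[of "osc t" z] V.wip_commute[of v "osc t"]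
  by (simp add: form_def)

lemma form_add_left:
  assumes "square_summable freq u" "square_summable freq v" "square_summable freq z"
  shows "form t (\<lambda>k. u k + v k) z = form t u z + form t v z"
  using assms by (simp add: form_def V.wip_add_left algebra_simps)

lemma form_add_right:
  assumes "square_summable freq u" "square_summable freq v" "square_summable freq z"
  shows "form t z (\<lambda>k. u k + v k) = form t z u + form t z v"
  using assms by (simp add: form_def V.wip_add_right algebra_simps)

lemma form_scale_left:
  assumes "square_summable freq v" "square_summable freq z"
  shows "form t (\<lambda>k. c * v k) z = c * form t v z"
  using assms by (simp add: form_def V.wip_scale_left algebra_simps)

lemma form_scale_right:
  assumes "square_summable freq v" "square_summable freq z"
  shows "form t v (\<lambda>k. c * z k) = cnj c * form t v z"
  using assms by (simp add: form_def V.wip_scale_right algebra_simps)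

lemma form_bounded:
  assumes v: "square_summable freq v" and z: "square_summable freq z"
  shows "cmod (form t v z) \<le> 2 * wnorm freq v * wnorm freq z"
proof -
  have "cnj gam * cnj (z 0) * wip freq v (osc t) = cnj (gam * z 0 * wip freq (osc t) v)"
    using v by (simp add: V.wip_commute[of "osc t" v])
  then have "cmod (cnj gam * cnj (z 0) * wip freq v (osc t)) \<le> wnorm freq z * wnorm freq v / 4"
    using coupling_le[OF z v, of t] by (simp only: complex_mod_cnj)
  with coupling_le[OF v z, of t] V.cauchy_schwarz[OF v z]
  have "cmod (form t v z) \<le> wnorm freq v * wnorm freq z + wnorm freq v * wnorm freq z / 4 + wnorm freq z * wnorm freq v / 4"
    unfolding form_def by (intro norm_add_rule_thm) assumption+
  also have "\<dots> \<le> 2 * wnorm freq v * wnorm freq z" using v z by (simp add: mult.commute)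
  finally show ?thesis .
qed

lemma form_coercive:
  assumes v: "square_summable freq v"
  shows "Re (form t v v) \<ge> 1 / 2 * (wnorm freq v)\<^sup>2"
proof -
  let ?c = "gam * v 0 * wip freq (osc t) v"
  have "form t v v = complex_of_real ((wnorm freq v)\<^sup>2) + (?c + cnj ?c)"
    using v by (simp add: form_def V.wip_self V.wip_commute[of "osc t" v])
  then have "Re (form t v v) = (wnorm freq v)\<^sup>2 + 2 * Re ?c"
    unfolding complex_add_cnj by simp
  moreover have "\<bar>Re ?c\<bar> \<le> (wnorm freq v)\<^sup>2 / 4"
    using order_trans[OF abs_Re_le_cmod coupling_le[OF v v, of t]] by (simp add: power2_eq_square)
  ultimately show ?thesis by linarith
qed

lemma nonautonomous_form_form: "nonautonomous_form UNIV (wl2 freq) 1 form"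
  unfolding nonautonomous_form_def
proof (intro conjI ballI)
  show "sesquilinear_form UNIV (wl2 freq) (form t)" for t
    by (simp add: sesquilinear_form_def form_add_left form_add_right form_scale_left form_scale_right)
  show "\<exists>M\<ge>0. \<forall>t\<in>{0..1}. \<forall>v\<in>carrier (wl2 freq). \<forall>w\<in>carrier (wl2 freq).
      cmod (form t v w) \<le> M * nrm (wl2 freq) v * nrm (wl2 freq) w"
    by (intro exI[of _ 2]) (simp add: form_bounded)
  fix v z assume "v \<in> carrier (wl2 freq)" "z \<in> carrier (wl2 freq)"
  then have v: "square_summable freq v" and z: "square_summable freq z" by simp_all
  have "continuous_on {0..1} (\<lambda>t. wip freq v z + gam * v 0 * wip freq (osc t) z
      + cnj gam * cnj (z 0) * cnj (wip freq (osc t) v))"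
    by (intro continuous_intros V.continuous_on_wip_curve[OF uniform_curve_osc] v z)
  then have "continuous_on {0..1} (\<lambda>t. form t v z)"
    using v by (simp add: form_def V.wip_commute[of "osc _" v])
  then show "(\<lambda>t. form t v z) \<in> borel_measurable (lebesgue_on {0..1})"
    by (rule continuous_imp_measurable_on_sets_lebesgue) simp
qed

lemma coercive_form_form: "coercive_form (wl2 freq) 1 form"
  unfolding coercive_form_def using form_coercive by (intro exI[of _ "1 / 2"]) simp

lemma symmetric_form_form: "symmetric_form (wl2 freq) 1 form"
  unfolding symmetric_form_def by (simp add: form_symmetric[symmetric])

section \<open>Besov regularity\<close>

lemma wip_orthogonal_unit0_le:
  assumes d: "square_summable freq d" "d 0 = 0" and z: "square_summable freq z"
  shows "cmod (wip freq d z) \<le> wnorm freq d * sqrt ((wnorm freq z)\<^sup>2 - (cmod (z 0))\<^sup>2)"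
proof -
  define z' where "z' k = (if k = 0 then 0 else z k)" for k
  have z': "square_summable freq z'"
    using z unfolding square_summable_def
    by (rule summable_comparison_test') (auto simp: z'_def less_imp_le)
  have "(wnorm freq z')\<^sup>2 = (\<Sum>k. freq (Suc k) * (cmod (z' (Suc k)))\<^sup>2)"
    unfolding V.wnorm_power2[OF z'] using z'[unfolded square_summable_def]
    by (subst suminf_split_head) (simp_all add: z'_def)
  also have "\<dots> = (wnorm freq z)\<^sup>2 - (cmod (z 0))\<^sup>2"
    unfolding V.wnorm_power2[OF z] using suminf_split_head[OF z[unfolded square_summable_def]]
    by (simp add: z'_def)
  finally have "wnorm freq z' = sqrt ((wnorm freq z)\<^sup>2 - (cmod (z 0))\<^sup>2)"
    using z' by (metis V.wnorm_nonneg real_sqrt_abs abs_of_nonneg)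
  moreover have "wip freq d z = wip freq d z'"
    unfolding wip_def by (rule suminf_cong) (simp add: z'_def d(2))
  ultimately show ?thesis using V.cauchy_schwarz[OF d(1) z'] by simp
qed

lemma form_in_dual:
  assumes v: "square_summable freq v"
  shows "(\<lambda>z\<in>carrier (wl2 freq). form t v z) \<in> carrier V.dual"
proof -
  have "\<exists>C. \<forall>z\<in>carrier (wl2 freq). cmod (form t v z) \<le> C * nrm (wl2 freq) z"
    using form_bounded[OF v] by (intro exI[of _ "2 * wnorm freq v"]) simp
  then show ?thesis
    using v by (simp add: antidual_carrier_iff form_add_right form_scale_right)
qed

lemma operator_difference:
  assumes v: "square_summable freq v"
  shows "associated_operator (wl2 freq) form (t + h) v \<ominus>\<^bsub>V.dual\<^esub> associated_operator (wl2 freq) form t v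
    = (\<lambda>z\<in>carrier (wl2 freq). gam * v 0 * wip freq (\<lambda>k. osc (t + h) k - osc t k) z
        + cnj gam * cnj (z 0) * cnj (wip freq (\<lambda>k. osc (t + h) k - osc t k) v))"
  unfolding associated_operator_def V.a_minus_dual[OF form_in_dual[OF v]]
proof (rule restrict_ext)
  fix z assume "z \<in> carrier (wl2 freq)"
  then have z: "square_summable freq z" by simp
  show "(\<lambda>z\<in>carrier (wl2 freq). form (t + h) v z) z - (\<lambda>z\<in>carrier (wl2 freq). form t v z) z
    = gam * v 0 * wip freq (\<lambda>k. osc (t + h) k - osc t k) z
        + cnj gam * cnj (z 0) * cnj (wip freq (\<lambda>k. osc (t + h) k - osc t k) v)"
    using v z by (simp add: form_def V.wip_diff_left V.wip_commute[of "osc _" v] algebra_simps)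
qed

text \<open>
  The difference of two operators has rank two and couples \<open>unit0\<close> with a vector \<open>d\<close> orthogonal to
  it. Orthogonality gives \<open>|(d | z)| \<le> \<parallel>d\<parallel> b z\<close>, where \<open>b z\<close> is the norm of \<open>z\<close> without its coordinate
  \<open>0\<close>, and then \<open>|v 0| b z + |z 0| b v \<le> 1\<close> on the unit ball. The bound is attained at \<open>unit0\<close>. The
  exact value is used because the seminorm is infinite for functions that are not measurable: an exact
  formula in \<open>h\<close> is visibly measurable.
\<close>

lemma op_nrm_difference:
  "op_nrm (wl2 freq) V.dual (\<lambda>v. associated_operator (wl2 freq) form (t + h) v
      \<ominus>\<^bsub>V.dual\<^esub> associated_operator (wl2 freq) form t v) = sqrt 2 * sqrt (modulus h)"
proof -
  define d where "d = (\<lambda>k. osc (t + h) k - osc t k)"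
  define D where "D v = associated_operator (wl2 freq) form (t + h) v
      \<ominus>\<^bsub>V.dual\<^esub> associated_operator (wl2 freq) form t v" for v
  have d: "square_summable freq d" "d 0 = 0" by (simp_all add: d_def)
  have norm_d: "wnorm freq d = sqrt (modulus h)" unfolding d_def by (rule wnorm_osc_diff_eq_sqrt)
  have D: "D v = (\<lambda>z\<in>carrier (wl2 freq). gam * v 0 * wip freq d z + cnj gam * cnj (z 0) * cnj (wip freq d v))"
    if "square_summable freq v" for v
    unfolding D_def d_def by (rule operator_difference[OF that])
  have upper: "nrm V.dual (D v) \<le> sqrt 2 * sqrt (modulus h)"
    if v: "square_summable freq v" "wnorm freq v \<le> 1" for v
  proof (rule V.nrm_dual_le)
    fix z assume z: "square_summable freq z" "wnorm freq z \<le> 1"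
    define b where "b x = sqrt ((wnorm freq x)\<^sup>2 - (cmod (x 0))\<^sup>2)" for x
    have b: "0 \<le> b x" "(cmod (x 0))\<^sup>2 + (b x)\<^sup>2 \<le> 1" if "square_summable freq x" "wnorm freq x \<le> 1" for x
    proof -
      have "(cmod (x 0))\<^sup>2 \<le> (wnorm freq x)\<^sup>2" using first_coordinate_le[OF that(1)] by (intro power_mono) auto
      moreover have "(wnorm freq x)\<^sup>2 \<le> 1" using that by (simp add: power_le_one)
      ultimately show "0 \<le> b x" "(cmod (x 0))\<^sup>2 + (b x)\<^sup>2 \<le> 1" by (simp_all add: b_def)
    qed
    have le: "cmod (wip freq d x) \<le> wnorm freq d * b x" if "square_summable freq x" for x
      unfolding b_def by (rule wip_orthogonal_unit0_le[OF d that])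
    have "cmod (D v z) \<le> cmod gam * cmod (v 0) * cmod (wip freq d z) + cmod gam * cmod (z 0) * cmod (wip freq d v)"
      using norm_triangle_ineq[of "gam * v 0 * wip freq d z" "cnj gam * cnj (z 0) * cnj (wip freq d v)"] v z
      by (simp add: D norm_mult)
    also have "\<dots> \<le> cmod gam * cmod (v 0) * (wnorm freq d * b z) + cmod gam * cmod (z 0) * (wnorm freq d * b v)"
      using v z by (intro add_mono mult_left_mono le) auto
    also have "\<dots> = cmod gam * wnorm freq d * (cmod (v 0) * b z + cmod (z 0) * b v)"
      by (simp add: algebra_simps)
    also have "\<dots> \<le> cmod gam * wnorm freq d * 1"
    proof (intro mult_left_mono)
      show "cmod (v 0) * b z + cmod (z 0) * b v \<le> 1"
        using sum_squares_bound[of "cmod (v 0)" "b z"] sum_squares_bound[of "cmod (z 0)" "b v"] b(2)[OF v] b(2)[OF z]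
        by linarith
    qed (use d in auto)
    finally show "cmod (D v z) \<le> sqrt 2 * sqrt (modulus h)" by (simp add: cmod_gam norm_d)
  qed
  have "D unit0 = V.riesz (\<lambda>k. gam * d k)"
    unfolding D[OF square_summable_unit0] V.riesz_def
    by (rule restrict_ext) (simp add: d V.wip_scale_left unit0_def)
  then have lower: "nrm V.dual (D unit0) = sqrt 2 * sqrt (modulus h)"
    using d by (simp add: V.nrm_riesz V.wnorm_scale cmod_gam norm_d)
  have mem: "unit0 \<in> {x \<in> carrier (wl2 freq). nrm (wl2 freq) x \<le> 1}" by simp
  have "op_nrm (wl2 freq) V.dual D = sqrt 2 * sqrt (modulus h)"
    unfolding op_nrm_def
  proof (rule antisym)
    show "(SUP x\<in>{x \<in> carrier (wl2 freq). nrm (wl2 freq) x \<le> 1}. nrm V.dual (D x)) \<le> sqrt 2 * sqrt (modulus h)"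
    proof (rule cSUP_least)
      show "{x \<in> carrier (wl2 freq). nrm (wl2 freq) x \<le> 1} \<noteq> {}" using mem by blast
    qed (simp add: upper)
    have "bdd_above ((\<lambda>x. nrm V.dual (D x)) ` {x \<in> carrier (wl2 freq). nrm (wl2 freq) x \<le> 1})"
      using upper by (intro bdd_aboveI2[of _ _ "sqrt 2 * sqrt (modulus h)"]) simp
    from cSUP_upper[OF mem this]
    show "sqrt 2 * sqrt (modulus h) \<le> (SUP x\<in>{x \<in> carrier (wl2 freq). nrm (wl2 freq) x \<le> 1}. nrm V.dual (D x))"
      by (simp add: lower)
  qed
  then show ?thesis by (simp add: D_def[abs_def])
qed

text \<open>
  The \<open>L\<^sup>p\<close> norm of the constant \<open>1\<close> on a space of measure \<open>m\<close>. For \<open>p = \<infinity>\<close> and \<open>m = 0\<close> the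
  essential supremum is the least element of the extended nonnegative reals.
\<close>

definition interval_factor :: "ennreal \<Rightarrow> real \<Rightarrow> real" where
  "interval_factor p m = (if p = \<infinity> then (if m = 0 then 0 else 1) else m powr (1 / enn2real p))"

lemma Lp_norm_const:
  assumes p: "1 \<le> p" and m: "emeasure M (space M) = ennreal m" "0 \<le> m" and c: "0 \<le> c"
  shows "Lp_norm M p (\<lambda>_. ennreal c) = ennreal (c * interval_factor p m)"
proof (cases "p = \<infinity>")
  case True
  show ?thesis
  proof (cases "m = 0")
    case True
    then have null: "ae_filter M = bot" using m by (simp add: ae_filter_eq_bot_iff)
    have "AE x in M. ennreal c \<le> 0" unfolding null by (rule eventually_bot)
    then have "esssup M (\<lambda>_. ennreal c) \<le> 0" by (intro esssup_I) simp_all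
    with True \<open>p = \<infinity>\<close> show ?thesis
      by (simp add: Lp_norm_def interval_factor_def)
  next
    case False
    then have "emeasure M (space M) \<noteq> 0" using m by simp
    with False \<open>p = \<infinity>\<close> show ?thesis by (simp add: Lp_norm_def esssup_const interval_factor_def)
  qed
next
  case False
  define r where "r = enn2real p"
  have r: "1 \<le> r" using p False by (cases p) (auto simp: r_def ennreal_le_iff2 simp flip: ennreal_1)
  have "Lp_norm M p (\<lambda>_. ennreal c) = ennreal_powr (ennreal (c powr r * m)) (1 / r)"
    using False c m by (simp add: Lp_norm_def ennreal_powr_def r_def[symmetric] ennreal_mult)
  also have "\<dots> = ennreal ((c powr r * m) powr (1 / r))"
    using c m by (simp add: ennreal_powr_def)
  also have "(c powr r * m) powr (1 / r) = c * m powr (1 / r)"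
    using c m r by (simp add: powr_mult powr_powr)
  finally show ?thesis using False by (simp add: interval_factor_def r_def)
qed

lemma Lp_norm_finite:
  assumes "f \<in> borel_measurable M"
    and "p = \<infinity> \<Longrightarrow> AE x in M. f x \<le> ennreal C"
    and "p \<noteq> \<infinity> \<Longrightarrow> (\<integral>\<^sup>+ x. ennreal_powr (f x) (enn2real p) \<partial>M) < \<infinity>"
  shows "Lp_norm M p f < \<infinity>"
proof (cases "p = \<infinity>")
  case True
  have "esssup M f \<le> ennreal C" using assms(1,2) True by (intro esssup_I) auto
  also have "\<dots> < \<infinity>" by simp
  finally show ?thesis using True by (simp add: Lp_norm_def)
next
  case False
  with assms show ?thesis by (auto simp: Lp_norm_def ennreal_powr_def)
qed

lemma emeasure_overlap:
  assumes "0 < h"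
  shows "emeasure (lebesgue_on {t \<in> {0..1}. t + h \<in> {0..1}}) (space (lebesgue_on {t \<in> {0..1}. t + h \<in> {0..1}}))
    = ennreal (max 0 (1 - h))"
proof -
  have "{t \<in> {0..1}. t + h \<in> {0..1}} = {0..1 - h}" using assms by auto
  then show ?thesis by (simp add: emeasure_restrict_space max_def)
qed

lemma interval_factor_bounds: "0 \<le> interval_factor p m" "0 \<le> m \<Longrightarrow> m \<le> 1 \<Longrightarrow> interval_factor p m \<le> 1"
  by (auto simp: interval_factor_def intro: powr_le1)

lemma interval_factor_0 [simp]: "interval_factor p 0 = 0"
  by (simp add: interval_factor_def)

text \<open>
  The inner norm is a norm of a constant over an interval of length at most \<open>1\<close>, so it is bounded by
  that constant for every \<open>p\<close>. On the shell \<open>4 ^ (-n-1) < h \<le> 4 ^ (-n)\<close>, whose measure with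
  respect to \<open>dh / h\<close> is bounded uniformly in \<open>n\<close>, the function under the outer norm is at most \<open>2 / sqrt (n + 1)\<close>. For finite \<open>q\<close>
  the integral of its \<open>q\<close>-th power is therefore dominated by a multiple of the series of
  \<open>(n + 1) powr (- q / 2)\<close>, which converges because \<open>q > 2\<close>.
\<close>

lemma besov_regular_form:
  assumes p: "1 \<le> p" and q: "2 < q"
  shows "besov_regular {0..1} (wl2 freq) V.dual (1 / 2) p q (associated_operator (wl2 freq) form)"
proof -
  define M where "M = lebesgue_on {0::real<..}"
  define N where "N = density M (\<lambda>h. ennreal (1 / h))"
  define f where "f h = ennreal (1 / h powr (1 / 2)) * Lp_norm (lebesgue_on {t \<in> {0..1}. t + h \<in> {0..1}}) p
      (\<lambda>t. ennreal (op_nrm (wl2 freq) V.dual (\<lambda>v. associated_operator (wl2 freq) form (t + h) v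
        \<ominus>\<^bsub>V.dual\<^esub> associated_operator (wl2 freq) form t v)))" for h
  define F where "F h = 1 / h powr (1 / 2) * (sqrt 2 * sqrt (modulus h) * interval_factor p (max 0 (1 - h)))" for h
  have f_eq: "f h = ennreal (F h)" if "0 < h" for h
  proof -
    have "Lp_norm (lebesgue_on {t \<in> {0..1}. t + h \<in> {0..1}}) p (\<lambda>t. ennreal (sqrt 2 * sqrt (modulus h)))
        = ennreal (sqrt 2 * sqrt (modulus h) * interval_factor p (max 0 (1 - h)))"
      by (rule Lp_norm_const[OF p emeasure_overlap[OF that]]) simp_all
    then show ?thesis
      unfolding f_def op_nrm_difference F_def
      by (simp only:) (rule ennreal_mult[symmetric], simp_all add: interval_factor_bounds)
  qed
  have F_nonneg: "0 \<le> F h" for h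
    by (simp add: F_def interval_factor_bounds)
  have F_zero: "F h = 0" if "1 \<le> h" for h
    using that by (simp add: F_def max_def)
  have F_le: "F h \<le> 2 / sqrt (real (Suc n))" if h: "(1 / 4) ^ Suc n < h" "h \<le> (1 / 4) ^ n" for h n
  proof -
    have "0 < h" using h(1) by (rule less_trans[rotated]) simp
    have "sqrt 2 * sqrt (modulus h) * interval_factor p (max 0 (1 - h)) \<le> sqrt 2 * sqrt (modulus h) * 1"
      using \<open>0 < h\<close> by (intro mult_left_mono interval_factor_bounds) auto
    also have "\<dots> \<le> sqrt 2 * sqrt (2 * h / real (Suc n))"
      using modulus_le[OF h] by simp
    also have "\<dots> = sqrt h * (2 / sqrt (real (Suc n)))"
      by (simp add: real_sqrt_mult real_sqrt_divide)
    finally have "F h \<le> 1 / h powr (1 / 2) * (sqrt h * (2 / sqrt (real (Suc n))))"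
      unfolding F_def using \<open>0 < h\<close> by (intro mult_left_mono) simp_all
    also have "\<dots> = 2 / sqrt (real (Suc n))"
      using \<open>0 < h\<close> by (simp add: powr_half_sqrt)
    finally show ?thesis .
  qed
  have F_le_2: "F h \<le> 2" if h: "0 < h" for h
  proof (cases "h \<le> 1")
    case True
    then obtain n where n: "(1 / 4) ^ Suc n < h" "h \<le> (1 / 4) ^ n" using dyadic_scale[OF h] by blast
    have "2 / sqrt (real (Suc n)) \<le> 2" by (simp add: divide_le_eq)
    with F_le[OF n] show ?thesis by linarith
  qed (use F_zero in auto)
  have [measurable]: "(\<lambda>h. interval_factor p (max 0 (1 - h))) \<in> borel_measurable borel"
    unfolding interval_factor_def by (cases "p = \<infinity>") simp_all
  have "F \<in> borel_measurable borel"
    unfolding F_def[abs_def] by measurable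
  then have F_M[measurable]: "F \<in> borel_measurable M"
    unfolding M_def by (intro measurable_restrict_space1 measurable_completion) simp
  have [measurable]: "(\<lambda>h. 1 / h :: real) \<in> borel_measurable M"
    unfolding M_def by (intro measurable_restrict_space1 measurable_completion) simp
  have space: "space M = {0<..}" "space N = {0<..}" by (simp_all add: M_def N_def)
  have f_meas: "f \<in> borel_measurable N"
  proof -
    have "(\<lambda>h. ennreal (F h)) \<in> borel_measurable N" unfolding N_def by simp
    then show ?thesis by (subst measurable_cong[where g = "\<lambda>h. ennreal (F h)"]) (simp_all add: space f_eq)
  qed
  have "Lp_norm N q f < \<infinity>"
  proof (rule Lp_norm_finite[OF f_meas])
    show "AE h in N. f h \<le> ennreal 2"
      by (rule AE_I2) (simp add: space f_eq F_le_2 del: ennreal_numeral)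
  next
    assume "q \<noteq> \<infinity>"
    define s where "s = enn2real q"
    have s: "2 < s" using q \<open>q \<noteq> \<infinity>\<close>
      by (cases q) (auto simp: s_def ennreal_less_iff simp flip: ennreal_numeral)
    define shell where "shell n = {(1 / 4 :: real) ^ Suc n <.. (1 / 4) ^ n}" for n
    define c where "c n = 4 ^ Suc n * (2 / sqrt (real (Suc n))) powr s" for n
    have c: "0 \<le> c n" for n by (simp add: c_def)
    have shell_sets: "shell n \<in> sets M" for n
      unfolding M_def sets_restrict_space
      by (rule image_eqI[of _ _ "shell n"]) (auto simp: shell_def intro: less_trans[rotated])
    have shell_measure: "emeasure M (shell n) \<le> ennreal ((1 / 4) ^ n)" for n
    proof -
      have "shell n \<subseteq> {0<..}" by (auto simp: shell_def intro: less_trans[rotated])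
      then have "emeasure M (shell n) = emeasure lborel (shell n)"
        unfolding M_def by (subst emeasure_restrict_space) (simp_all add: shell_def)
      also have "\<dots> = ennreal ((1 / 4) ^ n - (1 / 4) ^ Suc n)"
        unfolding shell_def by (intro emeasure_lborel_Ioc) simp
      also have "\<dots> \<le> ennreal ((1 / 4) ^ n)" by (intro ennreal_leI) simp
      finally show ?thesis .
    qed
    have pointwise: "ennreal (1 / h) * ennreal (F h powr s) \<le> (\<Sum>n. ennreal (c n) * indicator (shell n) h)"
      if h: "0 < h" for h
    proof (cases "h \<le> 1")
      case True
      then obtain n where n: "(1 / 4) ^ Suc n < h" "h \<le> (1 / 4) ^ n" using dyadic_scale[OF h] by blast
      have "1 / h \<le> 4 ^ Suc n"
        using n(1) h by (simp add: field_simps power_divide)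
      moreover have "F h powr s \<le> (2 / sqrt (real (Suc n))) powr s"
        using F_le[OF n] F_nonneg s by (intro powr_mono2) auto
      ultimately have "1 / h * F h powr s \<le> c n"
        unfolding c_def by (intro mult_mono) auto
      then have "ennreal (1 / h) * ennreal (F h powr s) \<le> ennreal (c n) * indicator (shell n) h"
        using n h by (simp add: shell_def ennreal_leI flip: ennreal_mult)
      also have "\<dots> \<le> (\<Sum>n. ennreal (c n) * indicator (shell n) h)"
        using sum_le_suminf[OF summableI, of "{n}" "\<lambda>n. ennreal (c n) * indicator (shell n) h"]
        by (simp only: sum.insert sum.empty finite.intros empty_iff not_False_eq_True add_0_right zero_le simp_thms)
      finally show ?thesis .
    qed (use s in \<open>simp add: F_zero\<close>)
    have "(\<integral>\<^sup>+ h. ennreal_powr (f h) s \<partial>N) = (\<integral>\<^sup>+ h. ennreal (F h powr s) \<partial>N)"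
      by (intro nn_integral_cong) (simp add: space f_eq ennreal_powr_def F_nonneg)
    also have "\<dots> = (\<integral>\<^sup>+ h. ennreal (1 / h) * ennreal (F h powr s) \<partial>M)"
      unfolding N_def by (rule nn_integral_density) measurable
    also have "\<dots> \<le> (\<integral>\<^sup>+ h. (\<Sum>n. ennreal (c n) * indicator (shell n) h) \<partial>M)"
      by (intro nn_integral_mono pointwise) (simp add: space)
    also have "\<dots> = (\<Sum>n. ennreal (c n) * emeasure M (shell n))"
      using shell_sets by (subst nn_integral_suminf) (simp_all add: nn_integral_cmult_indicator)
    also have "\<dots> \<le> (\<Sum>n. ennreal (c n) * ennreal ((1 / 4) ^ n))"
      by (intro suminf_le mult_left_mono shell_measure) simp_all
    also have "\<dots> = (\<Sum>n. ennreal (4 * 2 powr s * real (Suc n) powr (- s / 2)))"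
    proof (rule suminf_cong)
      fix n
      have "c n * (1 / 4) ^ n = (4 ^ n * (1 / 4) ^ n) * (4 * (2 / sqrt (real (Suc n))) powr s)"
        by (simp add: c_def)
      also have "4 ^ n * (1 / 4 :: real) ^ n = 1" by (simp flip: power_mult_distrib)
      also have "(2 / sqrt (real (Suc n))) powr s = 2 powr s * real (Suc n) powr (- s / 2)"
        by (simp add: powr_divide powr_minus_divide powr_half_sqrt[symmetric] powr_powr)
      finally show "ennreal (c n) * ennreal ((1 / 4) ^ n) = ennreal (4 * 2 powr s * real (Suc n) powr (- s / 2))"
        using c by (simp add: ennreal_mult[symmetric] mult.assoc)
    qed
    also have "\<dots> < \<infinity>"
    proof -
      have "summable (\<lambda>n. real n powr (- s / 2))" using s by (subst summable_real_powr_iff) simp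
      then have "summable (\<lambda>n. 4 * 2 powr s * real (Suc n) powr (- s / 2))"
        by (intro summable_mult) (subst summable_Suc_iff)
      then have "(\<Sum>n. ennreal (4 * 2 powr s * real (Suc n) powr (- s / 2))) \<noteq> \<infinity>"
        unfolding infinity_ennreal_def by (rule ennreal_suminf_neq_top) simp
      then show ?thesis unfolding infinity_ennreal_def by (simp only: less_top)
    qed
    finally show "(\<integral>\<^sup>+ h. ennreal_powr (f h) (enn2real q) \<partial>N) < \<infinity>" by (simp add: s_def)
  qed
  then show ?thesis
    unfolding besov_regular_def besov_seminorm_def N_def M_def f_def[abs_def] .
qed

section \<open>The solution\<close>

lemma uniform_curve_multiplier:
  assumes v: "weight v" and w: "weight w" and r: "uniform_curve (wl2 v) r"
    and le: "\<And>k. w k * (cmod (m k))\<^sup>2 \<le> v k"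
  shows "uniform_curve (wl2 w) (\<lambda>t k. m k * r t k)"
proof -
  interpret v: weight v by fact
  interpret w: weight w by fact
  note ss = v.uniform_curve_square_summable[OF r]
  have "wnorm w (\<lambda>k. m k * r t k - m k * r s k) \<le> wnorm v (\<lambda>k. r t k - r s k)" for s t
    using multiplier_bound(2)[OF v w v.square_summable_diff[OF ss ss] le, of t s] by (simp add: right_diff_distrib)
  moreover have "square_summable w (\<lambda>k. m k * r t k)" for t
    by (rule multiplier_bound(1)[OF v w ss le])
  ultimately show ?thesis
    using r unfolding w.uniform_curve_wl2_iff v.uniform_curve_wl2_iff by (meson le_less_trans)
qed

lemma uniform_curve_const:
  assumes "weight w" "square_summable w x"
  shows "uniform_curve (wl2 w) (\<lambda>t. x)"
proof -
  interpret weight w by fact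
  show ?thesis
    unfolding uniform_curve_wl2_iff using assms(2) by (auto simp: wnorm_def intro: exI[of _ 1])
qed

lemma uniform_curve_V_imp_H:
  assumes "uniform_curve (wl2 freq) r"
  shows "uniform_curve (wl2 (\<lambda>_. 1)) r"
  using uniform_curve_multiplier[OF weight_freq weight_one assms, of "\<lambda>_. 1"] by simp

lemma square_summable_V_imp_H:
  assumes "square_summable freq x"
  shows "square_summable (\<lambda>_. 1) x"
  using multiplier_bound(1)[OF weight_freq weight_one assms, of "\<lambda>_. 1"] by simp

lemma cmod_inverse_freq_le: "freq k * (cmod (1 / complex_of_real (freq k)))\<^sup>2 \<le> freq k"
proof -
  have "cmod (1 / complex_of_real (freq k)) \<le> 1" by (simp add: norm_divide less_imp_le)
  then have "(cmod (1 / complex_of_real (freq k)))\<^sup>2 \<le> 1" by (simp add: power_le_one)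
  then show ?thesis by (intro mult_left_le) (auto simp: less_imp_le)
qed

lemma uniform_curve_divide_freq:
  assumes "uniform_curve (wl2 freq) r"
  shows "uniform_curve (wl2 freq) (\<lambda>t k. r t k / complex_of_real (freq k))"
  using uniform_curve_multiplier[OF weight_freq weight_freq assms cmod_inverse_freq_le] by simp

lemma wip_divide_freq: "wip freq (\<lambda>k. x k / complex_of_real (freq k)) z = wip (\<lambda>_. 1) x z"
  unfolding wip_def by (rule suminf_cong) (simp add: less_imp_neq[OF freq_pos, symmetric])

lemma to_antidual_eq_riesz:
  "to_antidual (wl2 freq) (wl2 (\<lambda>_. 1)) x = V.riesz (\<lambda>k. x k / complex_of_real (freq k))"
  unfolding to_antidual_def V.riesz_def wip_divide_freq by simp

text \<open>
  Coordinate \<open>0\<close> of \<open>sol t\<close> is \<open>t\<close>, which is what lets the coupling reproduce \<open>t * osc t\<close>. The factor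
  \<open>t\<close> also gives the initial value \<open>0\<close>.
\<close>

definition sol :: "real \<Rightarrow> nat \<Rightarrow> complex" where
  "sol t k = complex_of_real t * (unit0 k + osc t k)"

definition rhs :: "real \<Rightarrow> nat \<Rightarrow> complex" where
  "rhs t k = unit0 k + osc t k + complex_of_real t * (1 + cnj gam * osc_norm2) * unit0 k"

text \<open>
  The vector representing the derivative of \<open>sol\<close> in the antidual of \<open>V\<close>. It is not the sequence of
  derivatives of the coordinates, but that sequence divided by \<open>freq\<close>, since functionals are
  represented by the inner product of \<open>V\<close>.
\<close>

definition sol_deriv :: "real \<Rightarrow> nat \<Rightarrow> complex" where
  "sol_deriv t k = (unit0 k + osc t k) / complex_of_real (freq k) + \<i> * complex_of_real t * osc t k"

lemma uniform_curve_unit0_osc: "uniform_curve (wl2 freq) (\<lambda>t k. unit0 k + osc t k)"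
  by (rule V.uniform_curve_add[OF uniform_curve_const[OF weight_freq square_summable_unit0] uniform_curve_osc])

lemma uniform_curve_sol: "uniform_curve (wl2 freq) sol"
  unfolding sol_def[abs_def] by (rule V.uniform_curve_scale[OF uniform_curve_unit0_osc]) (intro continuous_intros)

lemma uniform_curve_rhs: "uniform_curve (wl2 (\<lambda>_. 1)) rhs"
proof -
  have "uniform_curve (wl2 freq) (\<lambda>t k. complex_of_real t * (1 + cnj gam * osc_norm2) * unit0 k)"
    by (rule V.uniform_curve_scale[OF uniform_curve_const[OF weight_freq square_summable_unit0]]) (intro continuous_intros)
  from V.uniform_curve_add[OF uniform_curve_unit0_osc this]
  show ?thesis unfolding rhs_def[abs_def] by (rule uniform_curve_V_imp_H)
qed

lemma uniform_curve_sol_deriv: "uniform_curve (wl2 freq) sol_deriv"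
proof -
  have "uniform_curve (wl2 freq) (\<lambda>t k. \<i> * complex_of_real t * osc t k)"
    by (rule V.uniform_curve_scale[OF uniform_curve_osc]) (intro continuous_intros)
  from V.uniform_curve_add[OF uniform_curve_divide_freq[OF uniform_curve_unit0_osc] this]
  show ?thesis unfolding sol_deriv_def[abs_def] .
qed

lemma wip_H_unit0_osc:
  assumes z: "square_summable freq z"
  shows "wip (\<lambda>_. 1) (\<lambda>k. unit0 k + osc t k) z = cnj (z 0) + wip (\<lambda>_. 1) (osc t) z"
  using z by (simp add: H.wip_add_left square_summable_V_imp_H)

lemma wip_sol:
  assumes z: "square_summable freq z"
  shows "wip (\<lambda>_. 1) (sol t) z = complex_of_real t * (cnj (z 0) + wip (\<lambda>_. 1) (osc t) z)"
  unfolding sol_def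
  using z by (simp add: H.wip_scale_left square_summable_V_imp_H wip_H_unit0_osc)

lemma wip_sol_deriv:
  assumes z: "square_summable freq z"
  shows "wip freq (sol_deriv t) z
    = cnj (z 0) + wip (\<lambda>_. 1) (osc t) z + \<i> * complex_of_real t * wip freq (osc t) z"
proof -
  have "square_summable freq (\<lambda>k. (unit0 k + osc t k) / complex_of_real (freq k))"
    by (rule V.uniform_curve_square_summable[OF uniform_curve_divide_freq[OF uniform_curve_unit0_osc]])
  then show ?thesis
    unfolding sol_deriv_def using z
    by (simp add: V.wip_add_left V.wip_scale_left wip_divide_freq wip_H_unit0_osc)
qed

lemma has_weak_derivative_sol:
  "has_weak_derivative 1 V.dual (\<lambda>t. to_antidual (wl2 freq) (wl2 (\<lambda>_. 1)) (sol t)) (\<lambda>t. V.riesz (sol_deriv t))"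
  unfolding to_antidual_eq_riesz
proof (rule V.has_weak_derivative_riesz[OF uniform_curve_divide_freq[OF uniform_curve_sol] uniform_curve_sol_deriv])
  fix z and t :: real assume z: "square_summable freq z"
  have "((\<lambda>t. complex_of_real t) has_vector_derivative 1) (at t)"
    using has_vector_derivative_of_real[OF DERIV_ident, of "at t"] by simp
  moreover have "((\<lambda>t. cnj (z 0) + wip (\<lambda>_. 1) (osc t) z) has_vector_derivative 0 + \<i> * wip freq (osc t) z) (at t)"
    by (intro has_vector_derivative_add has_vector_derivative_const has_vector_derivative_wip_osc z)
  ultimately have "((\<lambda>t. complex_of_real t * (cnj (z 0) + wip (\<lambda>_. 1) (osc t) z)) has_vector_derivative
      complex_of_real t * (0 + \<i> * wip freq (osc t) z) + 1 * (cnj (z 0) + wip (\<lambda>_. 1) (osc t) z)) (at t)"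
    by (rule has_vector_derivative_mult)
  then have "((\<lambda>t. complex_of_real t * (cnj (z 0) + wip (\<lambda>_. 1) (osc t) z)) has_vector_derivative
      wip freq (sol_deriv t) z) (at t within {0..1})"
    by (rule has_vector_derivative_at_within[OF has_vector_derivative_eq_rhs]) (simp add: wip_sol_deriv[OF z] algebra_simps)
  then show "((\<lambda>t. wip freq (\<lambda>k. sol t k / complex_of_real (freq k)) z) has_vector_derivative
      wip freq (sol_deriv t) z) (at t within {0..1})"
    unfolding wip_divide_freq wip_sol[OF z] .
qed

text \<open>
  The terms with \<open>(osc t | z)\<close> in \<open>V\<close> have the coefficients \<open>\<i> t\<close> from the derivative, \<open>t\<close> from the
  inner product and \<open>gam t\<close> from the coupling, and cancel. The adjoint of the coupling pairs \<open>osc t\<close>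
  with itself and leaves a constant in coordinate \<open>0\<close>.
\<close>

lemma sol_equation:
  "V.riesz (sol_deriv t) \<oplus>\<^bsub>V.dual\<^esub> associated_operator (wl2 freq) form t (sol t)
    = to_antidual (wl2 freq) (wl2 (\<lambda>_. 1)) (rhs t)"
  unfolding associated_operator_def to_antidual_def antidual_simps wl2_simps(6)
proof (rule restrict_ext)
  fix z assume "z \<in> carrier (wl2 freq)"
  then have z: "square_summable freq z" by simp
  have "form t (sol t) z = complex_of_real t * form t (\<lambda>k. unit0 k + osc t k) z"
    unfolding sol_def by (rule form_scale_left) (simp_all add: z)
  also have "form t (\<lambda>k. unit0 k + osc t k) z = cnj (z 0) + wip freq (osc t) z + gam * wip freq (osc t) z
      + cnj gam * cnj (z 0) * osc_norm2"
    using z by (simp add: form_def V.wip_add_left V.wip_self wnorm_osc_power2 unit0_def[of 0])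
  finally have form: "form t (sol t) z = complex_of_real t * (cnj (z 0) + wip freq (osc t) z + gam * wip freq (osc t) z
      + cnj gam * cnj (z 0) * osc_norm2)" .
  have "wip (\<lambda>_. 1) (rhs t) z = cnj (z 0) + wip (\<lambda>_. 1) (osc t) z
      + complex_of_real t * (1 + cnj gam * osc_norm2) * cnj (z 0)"
    unfolding rhs_def using z
    by (simp add: H.wip_add_left H.wip_scale_left square_summable_V_imp_H)
  then show "V.riesz (sol_deriv t) z + (\<lambda>v\<in>carrier (wl2 freq). form t (sol t) v) z = wip (\<lambda>_. 1) (rhs t) z"
    using z by (simp add: form wip_sol_deriv gam_def algebra_simps)
qed

lemma uniform_curve_tendsto:
  assumes u: "uniform_curve X u" and t: "t \<in> {0..1}"
  shows "((\<lambda>r. nrm X (u r \<ominus>\<^bsub>X\<^esub> u t)) \<longlongrightarrow> 0) (at t within {0..1})"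
proof (rule tendstoI)
  fix e :: real assume "0 < e"
  with u t obtain d where "0 < d" and
    d: "\<And>r. r \<in> {0..1} \<Longrightarrow> \<bar>t - r\<bar> < d \<Longrightarrow> \<bar>nrm X (u r \<ominus>\<^bsub>X\<^esub> u t)\<bar> < e"
    unfolding uniform_curve_def by blast
  then show "\<forall>\<^sub>F r in at t within {0..1}. dist (nrm X (u r \<ominus>\<^bsub>X\<^esub> u t)) 0 < e"
    unfolding eventually_at by (intro exI[of _ d]) (auto simp: dist_real_def abs_minus_commute)
qed

lemma solves_sol:
  "solves UNIV (wl2 freq) (wl2 (\<lambda>_. 1)) 1 form (\<lambda>t. to_antidual (wl2 freq) (wl2 (\<lambda>_. 1)) (rhs t))
    \<zero>\<^bsub>wl2 (\<lambda>_. 1)\<^esub> sol"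
proof -
  let ?u = "\<lambda>t. to_antidual (wl2 freq) (wl2 (\<lambda>_. 1)) (sol t)" and ?w = "\<lambda>t. V.riesz (sol_deriv t)"
  have w: "?w \<in> L2 1 V.dual" by (rule V.L2_dual_curve[OF uniform_curve_sol_deriv])
  have "?u \<in> L2 1 V.dual"
    unfolding to_antidual_eq_riesz
    by (rule V.L2_dual_curve[OF uniform_curve_divide_freq[OF uniform_curve_sol]])
  then have "sol \<in> MR UNIV (wl2 freq) (wl2 (\<lambda>_. 1)) 1"
    unfolding MR_def H1_def mem_Collect_eq
    by (intro conjI bexI[of _ ?w] V.L2_wl2_curve[OF uniform_curve_sol] w has_weak_derivative_sol)
  moreover have "has_initial_value (wl2 (\<lambda>_. 1)) 1 sol \<zero>\<^bsub>wl2 (\<lambda>_. 1)\<^esub>"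
    unfolding has_initial_value_def
  proof (intro exI[of _ sol] conjI ballI)
    note u = uniform_curve_V_imp_H[OF uniform_curve_sol]
    show "sol \<in> {0..1} \<rightarrow> carrier (wl2 (\<lambda>_. 1))" using u by (simp add: uniform_curve_def)
    show "((\<lambda>r. nrm (wl2 (\<lambda>_. 1)) (sol r \<ominus>\<^bsub>wl2 (\<lambda>_. 1)\<^esub> sol t)) \<longlongrightarrow> 0) (at t within {0..1})"
      if "t \<in> {0..1}" for t
      by (rule uniform_curve_tendsto[OF u that])
    show "sol 0 = \<zero>\<^bsub>wl2 (\<lambda>_. 1)\<^esub>" by (simp add: sol_def[abs_def])
  qed simp
  moreover have "AE t in lebesgue_on {0..1}. ?w t \<oplus>\<^bsub>V.dual\<^esub> associated_operator (wl2 freq) form t (sol t)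
      = to_antidual (wl2 freq) (wl2 (\<lambda>_. 1)) (rhs t)"
    by (intro AE_I2 sol_equation)
  ultimately show ?thesis
    unfolding solves_def by (intro conjI bexI[of _ ?w] w has_weak_derivative_sol)
qed

section \<open>Failure of maximal regularity\<close>

lemma integrable_continuous_times:
  fixes c g :: "real \<Rightarrow> complex"
  assumes c: "continuous_on {0..1} c" and g: "integrable (lebesgue_on {0..1}) g"
  shows "integrable (lebesgue_on {0..1}) (\<lambda>t. c t * g t)"
proof -
  have "bounded (c ` {0..1})"
    by (intro compact_imp_bounded compact_continuous_image c) auto
  then obtain B where "\<forall>x\<in>c ` {0..1}. norm x \<le> B" unfolding bounded_iff by blast
  then have B: "cmod (c t) \<le> B" if "t \<in> {0..1}" for t using that by simp
  show ?thesis
  proof (rule Bochner_Integration.integrable_bound)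
    show "integrable (lebesgue_on {0..1}) (\<lambda>t. complex_of_real B * g t)" using g by simp
    have "c \<in> borel_measurable (lebesgue_on {0..1})"
      by (rule continuous_imp_measurable_on_sets_lebesgue[OF c]) simp
    then show "(\<lambda>t. c t * g t) \<in> borel_measurable (lebesgue_on {0..1})"
      using g by (intro borel_measurable_times) auto
    have "cmod (c t) * cmod (g t) \<le> \<bar>B\<bar> * cmod (g t)" if "t \<in> {0..1}" for t
      using B[OF that] by (intro mult_right_mono) auto
    then show "AE t in lebesgue_on {0..1}. norm (c t * g t) \<le> norm (complex_of_real B * g t)"
      by (intro AE_I2) (simp add: norm_mult)
  qed
qed

context weight
begin

text \<open>
  A weak derivative with values in a sequence space is a weak derivative in each coordinate.
\<close>

lemma weak_derivative_coordinate:
  fixes u W :: "real \<Rightarrow> nat \<Rightarrow> complex"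
  assumes u: "u \<in> L2 1 (wl2 w)" and W: "W \<in> L2 1 (wl2 w)"
    and deriv: "has_weak_derivative 1 (wl2 w) u W" and \<phi>: "\<phi> \<in> test_functions 1"
  shows "(\<integral>t. complex_of_real (deriv \<phi> t) * u t k \<partial>lebesgue_on {0..1})
    = - (\<integral>t. complex_of_real (\<phi> t) * W t k \<partial>lebesgue_on {0..1})"
proof -
  let ?M = "lebesgue_on {0..1::real}"
  note \<phi>D = test_functionD[OF \<phi>]
  have cont: "continuous_on {0..1} (deriv \<phi>)" "continuous_on {0..1} \<phi>"
    using continuous_on_subset[OF \<phi>D(2)] DERIV_continuous_on[OF has_field_derivative_at_within[OF \<phi>D(1)]] by auto
  note int = integrable_continuous_times[OF continuous_on_of_real]
  from deriv \<phi> obtain x where x: "x \<in> carrier (wl2 w)"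
    and int1: "has_integral_in ?M (wl2 w) (\<lambda>t. complex_of_real (deriv \<phi> t) \<odot>\<^bsub>wl2 w\<^esub> u t) x"
    and int2: "has_integral_in ?M (wl2 w) (\<lambda>t. complex_of_real (\<phi> t) \<odot>\<^bsub>wl2 w\<^esub> W t) (\<ominus>\<^bsub>wl2 w\<^esub> x)"
    unfolding has_weak_derivative_def by blast
  have "x k = (\<integral>t. complex_of_real (deriv \<phi> t) * u t k \<partial>?M)"
    using has_integral_coordinate[OF int1, of k] int[OF cont(1) L2_coordinates(1)[OF u]] by simp
  moreover have "- x k = (\<integral>t. complex_of_real (\<phi> t) * W t k \<partial>?M)"
    using has_integral_coordinate[OF int2, of k] int[OF cont(2) L2_coordinates(1)[OF W]] x
    by (simp add: a_inv_wl2)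
  ultimately show ?thesis by (metis minus_minus)
qed

end

text \<open>
  Squaring the positive part of a quadratic polynomial gives a continuously differentiable function
  that vanishes outside of \<open>[1/4, 3/4]\<close>.
\<close>

definition bump :: "real \<Rightarrow> real" where
  "bump t = (max 0 ((t - 1 / 4) * (3 / 4 - t)))\<^sup>2"

definition bump_deriv :: "real \<Rightarrow> real" where
  "bump_deriv t = 2 * max 0 ((t - 1 / 4) * (3 / 4 - t)) * (1 - 2 * t)"

lemma max_square_has_derivative:
  "((\<lambda>x::real. (max 0 x)\<^sup>2) has_real_derivative 2 * max 0 x) (at x)"
proof (cases "x = 0")
  case True
  have "(\<lambda>h::real. (max 0 h)\<^sup>2 / h) \<midarrow>0\<rightarrow> 0"
  proof (rule Lim_null_comparison)
    show "\<forall>\<^sub>F h::real in at 0. norm ((max 0 h)\<^sup>2 / h) \<le> \<bar>h\<bar>"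
      by (rule always_eventually) (auto simp: max_def power2_eq_square)
    show "(\<lambda>h::real. \<bar>h\<bar>) \<midarrow>0\<rightarrow> 0" by (rule tendsto_eq_intros | simp)+
  qed
  with True show ?thesis by (simp add: DERIV_def)
next
  case False
  then consider "0 < x" | "x < 0" by linarith
  then show ?thesis
  proof cases
    case 1
    have "((\<lambda>x::real. x\<^sup>2) has_real_derivative 2 * max 0 x) (at x)"
      using 1 by (auto intro!: derivative_eq_intros)
    then show ?thesis
      by (rule has_field_derivative_transform_within_open[of _ _ _ "{0<..}"]) (use 1 in auto)
  next
    case 2
    have "((\<lambda>x::real. 0) has_real_derivative 2 * max 0 x) (at x)"
      using 2 by (auto intro!: derivative_eq_intros)
    then show ?thesis
      by (rule has_field_derivative_transform_within_open[of _ _ _ "{..<0}"]) (use 2 in auto)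
  qed
qed

lemma bump_has_derivative: "(bump has_real_derivative bump_deriv t) (at t)"
proof -
  have "((\<lambda>t::real. (t - 1 / 4) * (3 / 4 - t)) has_real_derivative (1 - 2 * t)) (at t)"
    by (auto intro!: derivative_eq_intros simp: algebra_simps add_divide_distrib diff_divide_distrib)
  from DERIV_chain2[OF max_square_has_derivative this]
  show ?thesis unfolding bump_def[abs_def] bump_deriv_def .
qed

lemma continuous_on_bump: "continuous_on S bump" "continuous_on S bump_deriv"
  unfolding bump_def[abs_def] bump_deriv_def[abs_def] by (intro continuous_intros)+

lemma bump_eq_0:
  assumes "t \<notin> {1 / 4..3 / 4}"
  shows "bump t = 0"
proof -
  have "(t - 1 / 4) * (3 / 4 - t) \<le> 0"
  proof (cases "t < 1 / 4")
    case True
    then show ?thesis by (intro mult_nonpos_nonneg) simp_all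
  next
    case False
    with assms show ?thesis by (intro mult_nonneg_nonpos) simp_all
  qed
  then show ?thesis by (simp add: bump_def max_def)
qed

lemma bump_bounds: "0 \<le> bump t" "bump t \<le> 1"
proof -
  have "(t - 1 / 4) * (3 / 4 - t) = 1 / 16 - (t - 1 / 2)\<^sup>2"
    by (simp add: power2_eq_square field_simps)
  then have "(t - 1 / 4) * (3 / 4 - t) \<le> 1" using zero_le_power2[of "t - 1 / 2"] by linarith
  then show "0 \<le> bump t" "bump t \<le> 1" by (simp_all add: bump_def power_le_one)
qed

lemma bump_times_test_function:
  fixes g g' :: "real \<Rightarrow> real"
  assumes g: "\<And>t. (g has_real_derivative g' t) (at t)" and "continuous_on UNIV g'"
  shows "(\<lambda>t. bump t * g t) \<in> test_functions 1"
proof -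
  have D: "((\<lambda>t. bump t * g t) has_real_derivative bump_deriv t * g t + g' t * bump t) (at t)" for t
    by (rule DERIV_mult[OF bump_has_derivative g])
  have "continuous_on UNIV g" by (rule DERIV_continuous_on) (rule has_field_derivative_at_within[OF g])
  then have "continuous_on UNIV (\<lambda>t. bump_deriv t * g t + g' t * bump t)"
    by (intro continuous_intros continuous_on_bump assms)
  moreover have "deriv (\<lambda>t. bump t * g t) = (\<lambda>t. bump_deriv t * g t + g' t * bump t)"
    by (intro ext DERIV_imp_deriv D)
  moreover have "(\<lambda>t. bump t * g t) differentiable_on UNIV"
    unfolding differentiable_on_def using D by (auto simp: real_differentiable_def)
  moreover have "0 < (1 / 4 :: real) \<and> (3 / 4 :: real) < 1 \<and> (\<forall>t. t \<notin> {1 / 4..3 / 4} \<longrightarrow> bump t * g t = 0)"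
    using bump_eq_0 by auto
  ultimately show ?thesis
    unfolding test_functions_def mem_Collect_eq by metis
qed

lemma bump_moment_pos: "0 < (\<integral>t. bump t * t \<partial>lebesgue_on {0..1})"
proof -
  have cont: "continuous_on {0..1} (\<lambda>t. bump t * t)"
    by (intro continuous_intros continuous_on_bump)
  have nonneg: "0 \<le> bump t * t" if "t \<in> {0..1}" for t using that by (simp add: bump_bounds)
  have "(\<integral>t. bump t * t \<partial>lebesgue_on {0..1}) = 0 \<longleftrightarrow> (\<forall>t\<in>{0..1}. bump t * t = 0)"
    by (rule integralL_eq_0_iff[OF cont _ nonneg]) simp_all
  moreover have "bump (1 / 2) * (1 / 2) \<noteq> 0" "1 / 2 \<in> {0..1::real}"
    by (simp_all add: bump_def max_def)
  ultimately have "(\<integral>t. bump t * t \<partial>lebesgue_on {0..1}) \<noteq> 0" by blast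
  moreover have "0 \<le> (\<integral>t. bump t * t \<partial>lebesgue_on {0..1})"
    using nonneg by (intro Bochner_Integration.integral_nonneg) simp_all
  ultimately show ?thesis by simp
qed

lemma sol_coordinate:
  assumes "k \<noteq> 0"
  shows "sol t k = complex_of_real (amp k) * (complex_of_real t * cis (freq k * t))"
  using assms by (simp add: sol_def osc_def unit0_def)

lemma sol_coordinate_has_derivative:
  assumes "k \<noteq> 0"
  shows "((\<lambda>t. sol t k) has_vector_derivative
    complex_of_real (amp k) * (1 + \<i> * complex_of_real (freq k * t)) * cis (freq k * t)) (at t)"
proof -
  have "((\<lambda>t. complex_of_real t * cis (freq k * t)) has_vector_derivative
      (1 + \<i> * complex_of_real (freq k * t)) * cis (freq k * t)) (at t)"
    unfolding cis_conv_exp of_real_mult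
    by (rule has_vector_derivative_real_field[of "\<lambda>s. s * exp (\<i> * (complex_of_real (freq k) * s))"])
      (auto intro!: derivative_eq_intros simp: algebra_simps)
  from has_vector_derivative_mult_right[OF this, of "complex_of_real (amp k)"]
  show ?thesis unfolding sol_coordinate[OF assms] by (simp add: mult.assoc)
qed

text \<open>
  Testing with \<open>bump t * cis (- freq k * t)\<close> removes the oscillation of the coordinate \<open>k\<close>: the
  classical derivative becomes \<open>amp k * (1 + \<i> * freq k * t)\<close>, whose imaginary part does not cancel in
  the integral. Test functions are real, so the real and the imaginary part are treated separately and
  combined by linearity.
\<close>

lemma weak_derivative_sol_coordinate_ge:
  assumes W: "W \<in> L2 1 (wl2 (\<lambda>_. 1))" and deriv: "has_weak_derivative 1 (wl2 (\<lambda>_. 1)) sol W"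
    and k: "k \<noteq> 0"
  shows "freq k * amp k * (\<integral>t. bump t * t \<partial>lebesgue_on {0..1}) \<le> (\<integral>t. cmod (W t k) \<partial>lebesgue_on {0..1})"
proof -
  let ?M = "lebesgue_on {0..1::real}"
  define U' where "U' t = complex_of_real (amp k) * (1 + \<i> * complex_of_real (freq k * t)) * cis (freq k * t)" for t
  have sol: "sol \<in> L2 1 (wl2 (\<lambda>_. 1))"
    by (rule H.L2_wl2_curve[OF uniform_curve_V_imp_H[OF uniform_curve_sol]])
  have cont_cis: "continuous_on S (\<lambda>t. cis (freq k * t))" for S
    unfolding cis_conv_exp by (intro continuous_intros)
  have cont_U': "continuous_on S U'" for S
    unfolding U'_def[abs_def] by (intro continuous_intros cont_cis)
  have test: "(\<integral>t. complex_of_real (bump t * g t) * W t k \<partial>?M) = (\<integral>t. complex_of_real (bump t * g t) * U' t \<partial>?M)"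
    if g: "\<And>t. (g has_real_derivative g' t) (at t)" "continuous_on UNIV g'" for g g' :: "real \<Rightarrow> real"
  proof -
    define \<phi> where "\<phi> t = bump t * g t" for t
    have \<phi>: "\<phi> \<in> test_functions 1" unfolding \<phi>_def[abs_def] by (rule bump_times_test_function[OF g])
    note \<phi>D = test_functionD[OF \<phi>]
    have "(\<integral>t. complex_of_real (deriv \<phi> t) * sol t k \<partial>?M) = - (\<integral>t. complex_of_real (\<phi> t) * U' t \<partial>?M)"
    proof (rule integration_by_parts_unit_interval)
      show "((\<lambda>t. complex_of_real (\<phi> t)) has_vector_derivative complex_of_real (deriv \<phi> t)) (at t within {0..1})" for t
        by (rule has_vector_derivative_of_real[OF has_field_derivative_at_within[OF \<phi>D(1)]])
      show "((\<lambda>t. sol t k) has_vector_derivative U' t) (at t within {0..1})" for t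
        unfolding U'_def by (rule has_vector_derivative_at_within[OF sol_coordinate_has_derivative[OF k]])
      show "continuous_on {0..1} (\<lambda>t. complex_of_real (deriv \<phi> t))"
        by (rule continuous_on_of_real[OF continuous_on_subset[OF \<phi>D(2)]]) simp
    qed (use \<phi>D cont_U' in simp_all)
    with H.weak_derivative_coordinate[OF sol W deriv \<phi>, of k] show ?thesis
      by (simp add: \<phi>_def)
  qed
  have "((\<lambda>t. cos (freq k * t)) has_real_derivative - sin (freq k * t) * freq k) (at t)" for t
    by (auto intro!: derivative_eq_intros)
  then have cos: "(\<integral>t. complex_of_real (bump t * cos (freq k * t)) * W t k \<partial>?M)
      = (\<integral>t. complex_of_real (bump t * cos (freq k * t)) * U' t \<partial>?M)"
    by (rule test) (intro continuous_intros)
  have "((\<lambda>t. sin (freq k * t)) has_real_derivative cos (freq k * t) * freq k) (at t)" for t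
    by (auto intro!: derivative_eq_intros)
  then have sin: "(\<integral>t. complex_of_real (bump t * sin (freq k * t)) * W t k \<partial>?M)
      = (\<integral>t. complex_of_real (bump t * sin (freq k * t)) * U' t \<partial>?M)"
    by (rule test) (intro continuous_intros)
  have W_int: "integrable ?M (\<lambda>t. W t k)" by (rule H.L2_coordinates(1)[OF W])
  have U'_int: "integrable ?M U'" by (rule continuous_imp_integrable_real[OF cont_U'])
  have cont_cos: "continuous_on {0..1} (\<lambda>t. complex_of_real (bump t * cos (freq k * t)))"
    and cont_sin: "continuous_on {0..1} (\<lambda>t. complex_of_real (bump t * sin (freq k * t)))"
    by (intro continuous_intros continuous_on_bump)+
  have cis_minus: "complex_of_real (bump t) * cis (- (freq k * t)) * z
      = complex_of_real (bump t * cos (freq k * t)) * z - \<i> * (complex_of_real (bump t * sin (freq k * t)) * z)" for t z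
    by (simp add: complex_eq_iff algebra_simps)
  have "(\<integral>t. complex_of_real (bump t) * cis (- (freq k * t)) * W t k \<partial>?M)
      = (\<integral>t. complex_of_real (bump t) * cis (- (freq k * t)) * U' t \<partial>?M)"
    unfolding cis_minus
    using integrable_continuous_times[OF cont_cos W_int] integrable_continuous_times[OF cont_sin W_int]
      integrable_continuous_times[OF cont_cos U'_int] integrable_continuous_times[OF cont_sin U'_int]
    by (subst (1 2) Bochner_Integration.integral_diff) (simp_all only: integrable_mult_right integral_mult_right_zero cos sin)
  also have "\<dots> = (\<integral>t. complex_of_real (amp k * bump t) + \<i> * complex_of_real (freq k * amp k * (bump t * t)) \<partial>?M)"
  proof (rule Bochner_Integration.integral_cong)
    fix t
    have "cis (- (freq k * t)) * cis (freq k * t) = 1" by (simp add: cis_mult)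
    moreover have "complex_of_real (bump t) * cis (- (freq k * t)) * U' t
        = complex_of_real (bump t) * complex_of_real (amp k) * (1 + \<i> * complex_of_real (freq k * t))
          * (cis (- (freq k * t)) * cis (freq k * t))"
      unfolding U'_def by (simp only: mult_ac)
    ultimately have "complex_of_real (bump t) * cis (- (freq k * t)) * U' t
        = complex_of_real (bump t) * complex_of_real (amp k) * (1 + \<i> * complex_of_real (freq k * t))"
      by simp
    then show "complex_of_real (bump t) * cis (- (freq k * t)) * U' t
        = complex_of_real (amp k * bump t) + \<i> * complex_of_real (freq k * amp k * (bump t * t))"
      by (simp add: algebra_simps)
  qed simp
  also have "\<dots> = complex_of_real (amp k * (\<integral>t. bump t \<partial>?M)) + \<i> * complex_of_real (freq k * amp k * (\<integral>t. bump t * t \<partial>?M))"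
  proof -
    have "integrable ?M (\<lambda>t. complex_of_real (amp k * bump t))"
      "integrable ?M (\<lambda>t. \<i> * complex_of_real (freq k * amp k * (bump t * t)))"
      by (intro continuous_imp_integrable_real continuous_intros continuous_on_bump)+
    then show ?thesis
      by (simp only: Bochner_Integration.integral_add integral_mult_right_zero integral_complex_of_real)
  qed
  finally have "Im (\<integral>t. complex_of_real (bump t) * cis (- (freq k * t)) * W t k \<partial>?M)
      = freq k * amp k * (\<integral>t. bump t * t \<partial>?M)" by simp
  moreover have "Im (\<integral>t. complex_of_real (bump t) * cis (- (freq k * t)) * W t k \<partial>?M)
      \<le> cmod (\<integral>t. complex_of_real (bump t) * cis (- (freq k * t)) * W t k \<partial>?M)"
    by (rule order_trans[OF abs_ge_self abs_Im_le_cmod])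
  ultimately have "freq k * amp k * (\<integral>t. bump t * t \<partial>?M)
      \<le> cmod (\<integral>t. complex_of_real (bump t) * cis (- (freq k * t)) * W t k \<partial>?M)"
    by simp
  also have "\<dots> \<le> (\<integral>t. cmod (complex_of_real (bump t) * cis (- (freq k * t)) * W t k) \<partial>?M)"
    by (rule integral_norm_bound)
  also have "\<dots> \<le> (\<integral>t. cmod (W t k) \<partial>?M)"
  proof (rule Bochner_Integration.integral_mono)
    have "continuous_on {0..1} (\<lambda>t. complex_of_real (bump t) * cis (- (freq k * t)))"
      unfolding cis_conv_exp by (intro continuous_intros continuous_on_bump)
    from integrable_norm[OF integrable_continuous_times[OF this W_int]]
    show "integrable ?M (\<lambda>t. cmod (complex_of_real (bump t) * cis (- (freq k * t)) * W t k))" .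
    show "integrable ?M (\<lambda>t. cmod (W t k))" by (rule integrable_norm[OF W_int])
    show "cmod (complex_of_real (bump t) * cis (- (freq k * t)) * W t k) \<le> cmod (W t k)" for t
      using mult_right_mono[OF bump_bounds(2)[of t], of "cmod (W t k)"] bump_bounds(1)[of t]
      by (simp add: norm_mult)
  qed
  finally show ?thesis .
qed

text \<open>
  The lower bounds for the coordinates are multiples of \<open>1 / sqrt k\<close>, so Bessel's inequality would
  bound the harmonic series.
\<close>

lemma sol_not_H1: "sol \<notin> H1 1 (wl2 (\<lambda>_. 1))"
proof
  assume "sol \<in> H1 1 (wl2 (\<lambda>_. 1))"
  then obtain W where W: "W \<in> L2 1 (wl2 (\<lambda>_. 1))" and deriv: "has_weak_derivative 1 (wl2 (\<lambda>_. 1)) sol W"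
    unfolding H1_def by blast
  define m where "m = (\<integral>t. bump t * t \<partial>lebesgue_on {0..1})"
  have m: "0 < m" unfolding m_def by (rule bump_moment_pos)
  obtain C where C: "\<And>N. (\<Sum>k<N. (\<integral>t. cmod (W t k) \<partial>lebesgue_on {0..1})\<^sup>2) \<le> C"
    using H.L2_coordinates(2)[OF W] by auto
  have term_le: "m\<^sup>2 / 64 * inverse (real k) \<le> (\<integral>t. cmod (W t k) \<partial>lebesgue_on {0..1})\<^sup>2" for k
  proof (cases "k = 0")
    case False
    have "freq k * amp k = 1 / (8 * sqrt (real k))" by (simp add: amp_def freq_def)
    then have "m\<^sup>2 / 64 * inverse (real k) = (freq k * amp k * m)\<^sup>2"
      by (simp add: power_mult_distrib power_divide field_simps)
    also have "\<dots> \<le> (\<integral>t. cmod (W t k) \<partial>lebesgue_on {0..1})\<^sup>2"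
      using weak_derivative_sol_coordinate_ge[OF W deriv False] m
      by (intro power_mono) (simp_all add: m_def amp_def less_imp_le)
    finally show ?thesis .
  qed simp
  have "summable (\<lambda>k. m\<^sup>2 / 64 * inverse (real k))"
  proof (rule bounded_imp_summable)
    show "(\<Sum>k\<le>n. m\<^sup>2 / 64 * inverse (real k)) \<le> C" for n
      unfolding lessThan_Suc_atMost[symmetric]
      by (rule order_trans[OF sum_mono C]) (rule term_le)
  qed simp
  then have "summable (\<lambda>k. inverse (real k))"
    using m by (subst (asm) summable_cmult_iff) simp
  then show False using not_summable_harmonic by blast
qed

section \<open>The counterexample\<close>

lemma not_maximal_regularity_form: "\<not> maximal_regularity UNIV (wl2 freq) (wl2 (\<lambda>_. 1)) 1 form"
  unfolding maximal_regularity_def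
  using H.L2_wl2_curve[OF uniform_curve_rhs] solves_sol sol_not_H1 by blast

theorem proposition10p1:
  fixes p q :: ennreal
  assumes "1 \<le> p" and "2 < q"
  shows "\<exists>(K :: complex set) (V :: (nat \<Rightarrow> complex) inner_module)
            (H :: (nat \<Rightarrow> complex) inner_module) (T :: real)
            (a :: real \<Rightarrow> (nat \<Rightarrow> complex) \<Rightarrow> (nat \<Rightarrow> complex) \<Rightarrow> complex).
      K \<in> {\<real>, UNIV} \<and>
      hilbert_space K V \<and> hilbert_space K H \<and> densely_embedded K V H \<and>
      0 < T \<and>
      nonautonomous_form K V T a \<and> coercive_form V T a \<and> symmetric_form V T a \<and>
      besov_regular {0..T} V (antidual K V) (1 / 2) p q (associated_operator V a) \<and>
      \<not> maximal_regularity K V H T a"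
proof (intro exI conjI)
  show "UNIV \<in> {\<real>, UNIV :: complex set}" by simp
  show "hilbert_space UNIV (wl2 freq)" by (rule V.hilbert_space_wl2)
  show "hilbert_space UNIV (wl2 (\<lambda>_. 1))" by (rule H.hilbert_space_wl2)
  show "densely_embedded UNIV (wl2 freq) (wl2 (\<lambda>_. 1))"
    by (rule densely_embedded_wl2[OF weight_freq weight_one]) simp
  show "(0 :: real) < 1" by simp
  show "nonautonomous_form UNIV (wl2 freq) 1 form" by (rule nonautonomous_form_form)
  show "coercive_form (wl2 freq) 1 form" by (rule coercive_form_form)
  show "symmetric_form (wl2 freq) 1 form" by (rule symmetric_form_form)
  show "besov_regular {0..1} (wl2 freq) (antidual UNIV (wl2 freq)) (1 / 2) p q
      (associated_operator (wl2 freq) form)"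
    by (rule besov_regular_form[OF assms])
  show "\<not> maximal_regularity UNIV (wl2 freq) (wl2 (\<lambda>_. 1)) 1 form"
    by (rule not_maximal_regularity_form)
qed

end
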